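(* Assume the initial state $x_0\in\mathbb{R}^n$ is known and the disturbances satisfy $w_k\in\mathbb{W}:=\{w\in\mathbb{R}^p\mid w^\top Pw\le1\}$ for all $k=0,\dots,T-1$, with $P$ symmetric, $P\succ0$; let $\mathbb{W}^T=\mathbb{W}\times\dots\times\mathbb{W}$ ($T$ times). Let $\bar\mu^*_{\mathrm{PWB}}$ be the optimal value of $$\min_{\bar\mu,\,\Phi}\ \bar\mu\quad\text{s.t.}\quad \bm{\delta}^\top(\Phi^\top\mathcal{C}\Phi-\mathcal{O}-\bar\mu\mathcal{W}_w)\bm{\delta}\le0\ \ \forall\mathbf{w}\in\mathbb{W}^T,\qquad \begin{bmatrix}\mathcal{I}-\mathcal{Z}\mathcal{A} & -\mathcal{Z}\mathcal{B}\end{bmatrix}\Phi=\mathcal{E},$$ with $\bm{\delta}=[x_0^\top\ \mathbf{w}^\top]^\top$. Let $\bar\mu^*$ be the optimal value of the semidefinite program $$\min_{\bar\mu,\bar\lambda_1,\dots,\bar\lambda_T,\,\bar\Phi}\ \bar\mu\quad\text{s.t.}\quad \bar\lambda_i\ge0\ (i=1,\dots,T),\quad \begin{bmatrix}\mathcal{I}-\mathcal{Z}\mathcal{A} & -\mathcal{Z}\mathcal{B}\end{bmatrix}\bar\Phi=\mathcal{E},$$ $$\begin{bmatrix} x_0^\top(\mathcal{O}_1+\bar\mu\mathcal{W}_1)x_0-\sum_{i=1}^T\bar\lambda_i & x_0^\top(\mathcal{O}_2^\top+\bar\mu\mathcal{W}_2^\top) & x_0^\top\bar\Phi_0^\top\mathcal{C}^{1/2}\\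 (\mathcal{O}_2+\bar\mu\mathcal{W}_2)x_0 & \sum_{i=1}^T\bar\lambda_i\mathcal{P}_i+\mathcal{O}_3+\bar\mu\mathcal{W}_3 & \bar\Phi_w^\top\mathcal{C}^{1/2}\\ \mathcal{C}^{1/2}\bar\Phi_0x_0 & \mathcal{C}^{1/2}\bar\Phi_w & \mathcal{I}\end{bmatrix}\succeq0,$$ and let $\mu^*$ be the optimal value of the semidefinite program $$\min_{\mu,\lambda,\Phi}\ \mu\quad\text{s.t.}\quad\lambda\ge0,\quad \begin{bmatrix}\mathcal{I}-\mathcal{Z}\mathcal{A} & -\mathcal{Z}\mathcal{B}\end{bmatrix}\Phi=\mathcal{E},\quad \begin{bmatrix} x_0^\top(\mathcal{O}_1+\mu\mathcal{W}_1)x_0-\lambda\omega & x_0^\top(\mathcal{O}_2^\top+\mu\mathcal{W}_2^\top) & x_0^\top\Phi_0^\top\mathcal{C}^{1/2}\\ (\mathcal{O}_2+\mu\mathcal{W}_2)x_0 & \lambda\mathcal{I}+\mathcal{O}_3+\mu\mathcal{W}_3 & \Phi_w^\top\mathcal{C}^{1/2}\\ \mathcal{C}^{1/2}\Phi_0x_0 & \mathcal{C}^{1/2}\Phi_w & \mathcal{I}\end{bmatrix}\succeq0$$ with $\omega=T/\sigma_{\min}(P)$. Then $$\frac{2}{\pi\,\kappa(\mathcal{W}_w)}\,\bar\mu^*\le\bar\mu^*_{\mathrm{PWB}}\le\bar\mu^*\le\mu^*,$$ where $\kappa(\mathcal{W}_w)=\sigma_{\max}(\mathcal{W}_w)/\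sigma_{\min}(\mathcal{W}_w)$.
   Context: Let $n,m,p,T$ be positive integers. Consider the discrete-time linear time-varying system $x_{k+1}=A_kx_k+B_ku_k+E_kw_k$, $k=0,\dots,T-1$, with known $A_k\in\mathbb{R}^{n\times n}$, $B_k\in\mathbb{R}^{n\times m}$, $E_k\in\mathbb{R}^{n\times p}$, each $E_k$ of full row rank. Write $\mathbf{x}=[x_0^\top\cdots x_T^\top]^\top\in\mathbb{R}^{n(T+1)}$, $\mathbf{u}=[u_0^\top\cdots u_T^\top]^\top\in\mathbb{R}^{m(T+1)}$, $\mathbf{w}=[w_0^\top\cdots w_{T-1}^\top]^\top\in\mathbb{R}^{pT}$, $\bm{\delta}=[x_0^\top\ \mathbf{w}^\top]^\top\in\mathbb{R}^{n+pT}$. Cost matrices: symmetric $Q_k\succeq0$ ($n\times n$), $R_k\succ0$ ($m\times m$), $k=0,\dots,T$; $\mathcal{Q}=\mathrm{blkdiag}(Q_0,\dots,Q_T)$, $\mathcal{R}=\mathrm{blkdiag}(R_0,\dots,R_T)$, $\mathcal{C}=\mathrm{blkdiag}(\mathcal{Q},\mathcal{R})$, and $\mathcal{C}^{1/2}$ its symmetric positive semidefinite square root. Let $F\in\mathbb{R}^{n(T+1)\times m(T+1)}$, $G\in\mathbb{R}^{n(T+1)\times(n+pT)}$ be the matrices such that every trajectory satisfies $\mathbf{x}=F\mathbf{u}+G\bm{\delta}$. Define $\mathcal{O}=G^\top\mathcal{Q}(\mathcal{I}+F\mathcal{R}^{-1}F^\top\mathcal{Q})^{-1}G$ (the optimal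 non-causal cost is $\bm{\delta}^\top\mathcal{O}\bm{\delta}$), partitioned as $\mathcal{O}=\begin{bmatrix}\mathcal{O}_1&\mathcal{O}_2^\top\\ \mathcal{O}_2&\mathcal{O}_3\end{bmatrix}$ with $\mathcal{O}_1\in\mathbb{R}^{n\times n}$, $\mathcal{O}_3\in\mathbb{R}^{pT\times pT}$. A symmetric disturbance weight $\mathcal{W}_w\succ0$ of size $n+pT$ is given, partitioned conformally as $\mathcal{W}_w=\begin{bmatrix}\mathcal{W}_1&\mathcal{W}_2^\top\\ \mathcal{W}_2&\mathcal{W}_3\end{bmatrix}$. Let $\mathcal{A}=\mathrm{blkdiag}(A_0,\dots,A_T)$, $\mathcal{B}=\mathrm{blkdiag}(B_0,\dots,B_T)$ (with $A_T,B_T$ arbitrary; they do not affect the constraint), $\mathcal{E}=\mathrm{blkdiag}(\mathcal{I}_n,E_0,\dots,E_{T-1})$, and $\mathcal{Z}$ the block downshift operator on $\mathbb{R}^{n(T+1)}$ with blocks of size $n$. A system response $\Phi\in\mathbb{R}^{(n+m)(T+1)\times(n+pT)}$ is split by columns as $\Phi=[\Phi_0\ \Phi_w]$ ($\Phi_0$ the first $n$ columns). For $i=1,\dots,T$, $\mathcal{P}_i\in\mathbb{R}^{pT\times pT}$ is block diagonal with $P$ in the $i$-th diagonal $p\times p$ block and zeros elsewhere. $\sigma_{\max},\sigma_{\min}$ denote largest and smallest singular values. *)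

theory Defs
  imports Complex_Main "Jordan_Normal_Form.Jordan_Normal_Form" "Jordan_Normal_Form.DL_Rank"
begin

definition psd_mat :: "real mat \<Rightarrow> bool" where
  "psd_mat M \<longleftrightarrow> square_mat M \<and> transpose_mat M = M \<and>
     (\<forall>v \<in> carrier_vec (dim_row M). 0 \<le> v \<bullet> (M *\<^sub>v v))"

definition pd_mat :: "real mat \<Rightarrow> bool" where
  "pd_mat M \<longleftrightarrow> psd_mat M \<and>
     (\<forall>v \<in> carrier_vec (dim_row M). v \<noteq> 0\<^sub>v (dim_row M) \<longrightarrow> 0 < v \<bullet> (M *\<^sub>v v))"

definition psd_sqrt :: "real mat \<Rightarrow> real mat" where
  "psd_sqrt C = (THE S. psd_mat S \<and> dim_row S = dim_row C \<and> S * S = C)"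

definition minv :: "real mat \<Rightarrow> real mat" where
  "minv A = (THE B. B \<in> carrier_mat (dim_row A) (dim_row A) \<and>
                    A * B = 1\<^sub>m (dim_row A) \<and> B * A = 1\<^sub>m (dim_row A))"

definition sing_vals :: "real mat \<Rightarrow> real set" where
  "sing_vals A = sqrt ` {e. eigenvalue (transpose_mat A * A) e}"

definition sigma_max :: "real mat \<Rightarrow> real" where
  "sigma_max A = Max (sing_vals A)"

definition sigma_min :: "real mat \<Rightarrow> real" where
  "sigma_min A = Min (sing_vals A)"

definition kappa :: "real mat \<Rightarrow> real" where
  "kappa A = sigma_max A / sigma_min A"

definition hcat :: "real mat \<Rightarrow> real mat \<Rightarrow> real mat" where
  "hcat X Y = mat (dim_row X) (dim_col X + dim_col Y)
     (\<lambda>(i,j). if j < dim_col X then X $$ (i,j) else Y $$ (i, j - dim_col X))"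

definition vcat :: "real mat \<Rightarrow> real mat \<Rightarrow> real mat" where
  "vcat X Y = mat (dim_row X + dim_row Y) (dim_col X)
     (\<lambda>(i,j). if i < dim_row X then X $$ (i,j) else Y $$ (i - dim_row X, j))"

definition block3 :: "real mat \<Rightarrow> real mat \<Rightarrow> real mat \<Rightarrow> real mat \<Rightarrow> real mat \<Rightarrow> real mat
                      \<Rightarrow> real mat \<Rightarrow> real mat \<Rightarrow> real mat \<Rightarrow> real mat" where
  "block3 M11 M12 M13 M21 M22 M23 M31 M32 M33 =
     vcat (vcat (hcat (hcat M11 M12) M13) (hcat (hcat M21 M22) M23)) (hcat (hcat M31 M32) M33)"

definition colm :: "real vec \<Rightarrow> real mat" where
  "colm v = mat (dim_vec v) 1 (\<lambda>(i,j). v $ i)"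

definition scal :: "real \<Rightarrow> real mat" where
  "scal s = mat 1 1 (\<lambda>_. s)"

definition mat_sum :: "nat \<Rightarrow> (nat \<Rightarrow> real mat) \<Rightarrow> nat set \<Rightarrow> real mat" where
  "mat_sum k f I = mat k k (\<lambda>(r,c). \<Sum>i\<in>I. f i $$ (r,c))"

definition blk11 :: "real mat \<Rightarrow> nat \<Rightarrow> real mat" where
  "blk11 M k = mat k k (\<lambda>(i,j). M $$ (i,j))"
definition blk21 :: "real mat \<Rightarrow> nat \<Rightarrow> real mat" where
  "blk21 M k = mat (dim_row M - k) k (\<lambda>(i,j). M $$ (i + k, j))"
definition blk22 :: "real mat \<Rightarrow> nat \<Rightarrow> real mat" where
  "blk22 M k = mat (dim_row M - k) (dim_col M - k) (\<lambda>(i,j). M $$ (i + k, j + k))"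

definition colsL :: "real mat \<Rightarrow> nat \<Rightarrow> real mat" where
  "colsL M k = mat (dim_row M) k (\<lambda>(i,j). M $$ (i,j))"
definition colsR :: "real mat \<Rightarrow> nat \<Rightarrow> real mat" where
  "colsR M k = mat (dim_row M) (dim_col M - k) (\<lambda>(i,j). M $$ (i, j + k))"

text \<open>Stacked matrices. n = state dim, m = input dim, p = disturbance dim, T = horizon.\<close>
definition calA :: "nat \<Rightarrow> (nat \<Rightarrow> real mat) \<Rightarrow> real mat" where
  "calA T A = diag_block_mat (map A [0..<Suc T])"

definition calB :: "nat \<Rightarrow> (nat \<Rightarrow> real mat) \<Rightarrow> real mat" where
  "calB T B = diag_block_mat (map B [0..<Suc T])"

definition calE :: "nat \<Rightarrow> nat \<Rightarrow> (nat \<Rightarrow> real mat) \<Rightarrow> real mat" where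
  "calE n T E = diag_block_mat (1\<^sub>m n # map E [0..<T])"

definition calQ :: "nat \<Rightarrow> (nat \<Rightarrow> real mat) \<Rightarrow> real mat" where
  "calQ T Q = diag_block_mat (map Q [0..<Suc T])"

definition calR :: "nat \<Rightarrow> (nat \<Rightarrow> real mat) \<Rightarrow> real mat" where
  "calR T R = diag_block_mat (map R [0..<Suc T])"

definition calC :: "nat \<Rightarrow> (nat \<Rightarrow> real mat) \<Rightarrow> (nat \<Rightarrow> real mat) \<Rightarrow> real mat" where
  "calC T Q R = diag_block_mat [calQ T Q, calR T R]"

definition calZ :: "nat \<Rightarrow> nat \<Rightarrow> real mat" where
  "calZ n T = mat (n * Suc T) (n * Suc T) (\<lambda>(i,j). if i = j + n then 1 else 0)"

definition sls_mat :: "nat \<Rightarrow> nat \<Rightarrow> (nat \<Rightarrow> real mat) \<Rightarrow> (nat \<Rightarrow> real mat) \<Rightarrow> real mat" where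
  "sls_mat n T A B =
     hcat (1\<^sub>m (n * Suc T) - calZ n T * calA T A) ((-1) \<cdot>\<^sub>m (calZ n T * calB T B))"

text \<open>A trajectory (x, u, delta): x_0 = first block of delta and
  x_{k+1} = A_k x_k + B_k u_k + E_k w_k, written in stacked form.\<close>
definition is_traj :: "nat \<Rightarrow> nat \<Rightarrow> (nat \<Rightarrow> real mat) \<Rightarrow> (nat \<Rightarrow> real mat) \<Rightarrow> (nat \<Rightarrow> real mat)
                        \<Rightarrow> real vec \<Rightarrow> real vec \<Rightarrow> real vec \<Rightarrow> bool" where
  "is_traj n T A B E x u \<delta> \<longleftrightarrow> sls_mat n T A B *\<^sub>v (x @\<^sub>v u) = calE n T E *\<^sub>v \<delta>"

definition FG :: "nat \<Rightarrow> nat \<Rightarrow> nat \<Rightarrow> nat \<Rightarrow> (nat \<Rightarrow> real mat) \<Rightarrow> (nat \<Rightarrow> real mat)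
                   \<Rightarrow> (nat \<Rightarrow> real mat) \<Rightarrow> real mat \<times> real mat" where
  "FG n m p T A B E = (THE (F, G).
      F \<in> carrier_mat (n * Suc T) (m * Suc T) \<and> G \<in> carrier_mat (n * Suc T) (n + p * T) \<and>
      (\<forall>x u \<delta>. x \<in> carrier_vec (n * Suc T) \<longrightarrow> u \<in> carrier_vec (m * Suc T) \<longrightarrow>
          \<delta> \<in> carrier_vec (n + p * T) \<longrightarrow> is_traj n T A B E x u \<delta> \<longrightarrow>
          x = F *\<^sub>v u + G *\<^sub>v \<delta>))"

definition calO :: "nat \<Rightarrow> nat \<Rightarrow> nat \<Rightarrow> nat \<Rightarrow> (nat \<Rightarrow> real mat) \<Rightarrow> (nat \<Rightarrow> real mat)
                   \<Rightarrow> (nat \<Rightarrow> real mat) \<Rightarrow> (nat \<Rightarrow> real mat) \<Rightarrow> (nat \<Rightarrow> real mat) \<Rightarrow> real mat" where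
  "calO n m p T A B E Q R = (let F = fst (FG n m p T A B E); G = snd (FG n m p T A B E) in
     transpose_mat G * calQ T Q *
       minv (1\<^sub>m (n * Suc T) + F * minv (calR T R) * transpose_mat F * calQ T Q) * G)"

definition wblk :: "nat \<Rightarrow> real vec \<Rightarrow> nat \<Rightarrow> real vec" where
  "wblk p w i = vec p (\<lambda>j. w $ (i * p + j))"

definition WT :: "nat \<Rightarrow> nat \<Rightarrow> real mat \<Rightarrow> real vec set" where
  "WT p T P = {w \<in> carrier_vec (p * T). \<forall>k < T. wblk p w k \<bullet> (P *\<^sub>v wblk p w k) \<le> 1}"

definition calP :: "nat \<Rightarrow> nat \<Rightarrow> real mat \<Rightarrow> nat \<Rightarrow> real mat" where
  "calP p T P i = diag_block_mat (map (\<lambda>j. if j = i then P else 0\<^sub>m p p) [1..<Suc T])"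

definition mu_PWB :: "nat \<Rightarrow> nat \<Rightarrow> nat \<Rightarrow> nat \<Rightarrow> (nat \<Rightarrow> real mat) \<Rightarrow> (nat \<Rightarrow> real mat)
     \<Rightarrow> (nat \<Rightarrow> real mat) \<Rightarrow> (nat \<Rightarrow> real mat) \<Rightarrow> (nat \<Rightarrow> real mat) \<Rightarrow> real mat \<Rightarrow> real mat
     \<Rightarrow> real vec \<Rightarrow> real" where
  "mu_PWB n m p T A B E Q R P Ww x0 = Inf {\<mu>. \<exists>\<Phi>.
      \<Phi> \<in> carrier_mat ((n + m) * Suc T) (n + p * T) \<and>
      sls_mat n T A B * \<Phi> = calE n T E \<and>
      (\<forall>w \<in> WT p T P.
         (x0 @\<^sub>v w) \<bullet> ((transpose_mat \<Phi> * calC T Q R * \<Phi> - calO n m p T A B E Q R - \<mu> \<cdot>\<^sub>m Ww)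
                        *\<^sub>v (x0 @\<^sub>v w)) \<le> 0)}"

definition mu_bar :: "nat \<Rightarrow> nat \<Rightarrow> nat \<Rightarrow> nat \<Rightarrow> (nat \<Rightarrow> real mat) \<Rightarrow> (nat \<Rightarrow> real mat)
     \<Rightarrow> (nat \<Rightarrow> real mat) \<Rightarrow> (nat \<Rightarrow> real mat) \<Rightarrow> (nat \<Rightarrow> real mat) \<Rightarrow> real mat \<Rightarrow> real mat
     \<Rightarrow> real vec \<Rightarrow> real" where
  "mu_bar n m p T A B E Q R P Ww x0 = Inf {\<mu>. \<exists>lam \<Phi>.
      (\<forall>i \<in> {1..T}. 0 \<le> lam i) \<and>
      \<Phi> \<in> carrier_mat ((n + m) * Suc T) (n + p * T) \<and>
      sls_mat n T A B * \<Phi> = calE n T E \<and>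
      (let Om = calO n m p T A B E Q R; S = psd_sqrt (calC T Q R); X = colm x0;
           \<Phi>0 = colsL \<Phi> n; \<Phi>w = colsR \<Phi> n in
       psd_mat (block3
         (transpose_mat X * (blk11 Om n + \<mu> \<cdot>\<^sub>m blk11 Ww n) * X - scal (\<Sum>i\<in>{1..T}. lam i))
         (transpose_mat X * (transpose_mat (blk21 Om n) + \<mu> \<cdot>\<^sub>m transpose_mat (blk21 Ww n)))
         (transpose_mat X * transpose_mat \<Phi>0 * S)
         ((blk21 Om n + \<mu> \<cdot>\<^sub>m blk21 Ww n) * X)
         (mat_sum (p * T) (\<lambda>i. lam i \<cdot>\<^sub>m calP p T P i) {1..T} + blk22 Om n + \<mu> \<cdot>\<^sub>m blk22 Ww n)
         (transpose_mat \<Phi>w * S)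
         (S * \<Phi>0 * X)
         (S * \<Phi>w)
         (1\<^sub>m ((n + m) * Suc T))))}"

definition mu_star :: "nat \<Rightarrow> nat \<Rightarrow> nat \<Rightarrow> nat \<Rightarrow> (nat \<Rightarrow> real mat) \<Rightarrow> (nat \<Rightarrow> real mat)
     \<Rightarrow> (nat \<Rightarrow> real mat) \<Rightarrow> (nat \<Rightarrow> real mat) \<Rightarrow> (nat \<Rightarrow> real mat) \<Rightarrow> real mat \<Rightarrow> real mat
     \<Rightarrow> real vec \<Rightarrow> real" where
  "mu_star n m p T A B E Q R P Ww x0 = Inf {\<mu>. \<exists>lam \<Phi>.
      0 \<le> lam \<and>
      \<Phi> \<in> carrier_mat ((n + m) * Suc T) (n + p * T) \<and>
      sls_mat n T A B * \<Phi> = calE n T E \<and>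
      (let Om = calO n m p T A B E Q R; S = psd_sqrt (calC T Q R); X = colm x0;
           \<Phi>0 = colsL \<Phi> n; \<Phi>w = colsR \<Phi> n; \<omega> = real T / sigma_min P in
       psd_mat (block3
         (transpose_mat X * (blk11 Om n + \<mu> \<cdot>\<^sub>m blk11 Ww n) * X - scal (lam * \<omega>))
         (transpose_mat X * (transpose_mat (blk21 Om n) + \<mu> \<cdot>\<^sub>m transpose_mat (blk21 Ww n)))
         (transpose_mat X * transpose_mat \<Phi>0 * S)
         ((blk21 Om n + \<mu> \<cdot>\<^sub>m blk21 Ww n) * X)
         (lam \<cdot>\<^sub>m 1\<^sub>m (p * T) + blk22 Om n + \<mu> \<cdot>\<^sub>m blk22 Ww n)
         (transpose_mat \<Phi>w * S)
         (S * \<Phi>0 * X)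
         (S * \<Phi>w)
         (1\<^sub>m ((n + m) * Suc T))))}"

end

theory Submission
  imports "HOL-Probability.Distributions" "Jordan_Normal_Form.Spectral_Radius" Defs
begin

text \<open>
  For an achievable \<open>\<Phi>\<close> the regret matrix \<open>\<Phi>\<^sup>T C \<Phi> - O\<close> is positive semidefinite, because \<open>O\<close> is
  the cost of the best non-causal input. By Schur complements each of the two semidefinite programs
  bounds the regret form on the vectors \<open>(t x0, w)\<close>; setting \<open>t = 1\<close>, respectively
  \<open>\<lambda>i = \<lambda> / \<sigma>\<^sub>m\<^sub>i\<^sub>n(P)\<close>, gives the second and the third inequality.

  For the first inequality, the multipliers \<open>\<lambda>i\<close> are obtained from a theorem of the alternative for
  functions on finite lists of vectors; such lists stand for Gram representations of positive
  semidefinite matrices. Its hypothesis is verified by Gaussian sign rounding in the eigenbasis of \<open>P\<close>.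
  In that basis the rounded vector keeps the coordinatewise second moments. Therefore it satisfies the ball
  constraints and has the same Euclidean norm as the list, while a positive semidefinite form loses at
  most the factor \<open>2 / \<pi>\<close>. Comparing \<open>W\<close> with the Euclidean norm costs the factor \<open>\<kappa>(W)\<close>.
\<close>

unbundle no inner_syntax
unbundle no vec_syntax

section \<open>Gaussian linear forms\<close>

text \<open>Rounding preserves only second moments of single coordinates. In eigen-coordinates of
  \<open>P\<close> every ball constraint is diagonal and survives exactly, with no loss that grows
  with \<open>T\<close>. The form of \<open>W\<close> is in general not diagonal there and can only
  be carried across through the norm: \<open>sigma_max\<close> bounds it above at the rounded
  vector, \<open>sigma_min\<close> below on the list, and their quotient is \<open>kappa\<close>.
  The constant 2/pi is the square of E |g| for a standard normal g. The constraints are homogenised: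
  a scalar t multiplies \<open>x0\<close>, and a ball of radius 1 becomes one of radius |t|. All
  functions are then quadratic forms, so scaling by square roots and concatenating lists realises
  convex combinations of their values. Separation can be carried out on these values by induction on
  the number of functions, with no closedness or compactness argument. The alternative only yields
  multipliers that are not all zero; at t = 1, w = 0 every constraint is strict, which forces the
  multiplier of the objective to be positive.\<close>

definition std_gaussian :: "nat \<Rightarrow> (nat \<Rightarrow> real) measure" where
  "std_gaussian K = Pi\<^sub>M {..<K} (\<lambda>_. density lborel std_normal_density)"

lemma prob_space_std_normal: "prob_space (density lborel std_normal_density)"
  by (rule prob_space_normal_density) simp

lemma prob_space_std_gaussian: "prob_space (std_gaussian K)"
  unfolding std_gaussian_def by (intro prob_space_PiM prob_space_std_normal)

lemma measurable_std_gaussian_component [measurable]: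
  "k < K \<Longrightarrow> (\<lambda>\<omega>. \<omega> k) \<in> borel_measurable (std_gaussian K)"
  unfolding std_gaussian_def
  by (rule measurable_compose[OF measurable_component_singleton]) auto

lemma measurable_std_gaussian_linear [measurable]:
  "(\<lambda>\<omega>. \<Sum>k<K. u k * \<omega> k) \<in> borel_measurable (std_gaussian K)"
  by (intro borel_measurable_sum borel_measurable_times) auto

lemma std_gaussian_component:
  assumes "k < K"
  shows "distr (std_gaussian K) borel (\<lambda>\<omega>. \<omega> k) = density lborel std_normal_density"
proof -
  have "distr (std_gaussian K) (density lborel std_normal_density) (\<lambda>\<omega>. \<omega> k)
      = density lborel std_normal_density"
    unfolding std_gaussian_def
    by (rule distr_PiM_component) (use assms prob_space_std_normal in auto)
  moreover have "distr (std_gaussian K) borel (\<lambda>\<omega>. \<omega> k)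
      = distr (std_gaussian K) (density lborel std_normal_density) (\<lambda>\<omega>. \<omega> k)"
    by (rule distr_cong) auto
  ultimately show ?thesis by simp
qed

text \<open>Independence is read off from the joint law, which is by construction the product of the
  marginals. The characterisation used concerns nonempty index sets, so \<open>K = 0\<close> is
  split off.\<close>

lemma std_gaussian_indep:
  "prob_space.indep_vars (std_gaussian K) (\<lambda>_. borel) (\<lambda>k \<omega>. \<omega> k) {..<K}"
proof (cases "K = 0")
  case True
  interpret prob_space "std_gaussian K" by (rule prob_space_std_gaussian)
  show ?thesis using True unfolding indep_vars_def2 indep_sets_def by auto
next
  case False
  interpret prob_space "std_gaussian K" by (rule prob_space_std_gaussian)
  \<comment> \<open>Points of the product space are already extensional on \<open>{..<K}\<close>, so
    restricting them changes nothing.\<close>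
  have "distr (std_gaussian K) (\<Pi>\<^sub>M i\<in>{..<K}. borel) (\<lambda>x. \<lambda>i\<in>{..<K}. x i)
      = distr (std_gaussian K) (std_gaussian K) (\<lambda>x. x)"
    by (rule distr_cong)
       (auto simp: std_gaussian_def space_PiM intro!: sets_PiM_cong ext simp: PiE_def extensional_def)
  also have "\<dots> = std_gaussian K" by (rule distr_id)
  also have "\<dots> = (\<Pi>\<^sub>M i\<in>{..<K}. distr (std_gaussian K) borel (\<lambda>\<omega>. \<omega> i))"
    by (subst (1) std_gaussian_def, rule PiM_cong) (auto simp: std_gaussian_component)
  finally show ?thesis
    by (subst indep_vars_iff_distr_eq_PiM') (use False in auto)
qed

lemma std_gaussian_linear_distributed:
  assumes "\<exists>k<K. u k \<noteq> 0"
  shows "distributed (std_gaussian K) lborel (\<lambda>\<omega>. \<Sum>k<K. u k * \<omega> k)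
           (normal_density 0 (sqrt (\<Sum>k<K. (u k)\<^sup>2)))"
proof -
  interpret prob_space "std_gaussian K" by (rule prob_space_std_gaussian)
  \<comment> \<open>Only a nonzero coefficient gives a summand with a normal density; the other
    terms are dropped before the sum rule is applied and restored afterwards as zeros.\<close>
  define I where "I = {k. k < K \<and> u k \<noteq> 0}"
  have I: "finite I" "I \<noteq> {}" "I \<subseteq> {..<K}" using assms by (auto simp: I_def)
  have d: "distributed (std_gaussian K) lborel (\<lambda>\<omega>. u k * \<omega> k) (normal_density 0 \<bar>u k\<bar>)"
    if "k \<in> I" for k
  proof -
    have "distributed (std_gaussian K) lborel (\<lambda>\<omega>. \<omega> k) std_normal_density"
      unfolding distributed_def
      using std_gaussian_component[of k K] that I by (auto simp: I_def measurable_lborel1 cong: distr_cong)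
    from normal_density_affine[OF this, of "u k" 0] that show ?thesis by (simp add: I_def)
  qed
  have "indep_vars (\<lambda>_. borel) (\<lambda>k \<omega>. u k * \<omega> k) I"
    using indep_vars_compose2[OF indep_vars_subset[OF std_gaussian_indep I(3)],
       of "\<lambda>k x. u k * x" "\<lambda>_. borel"] by auto
  from sum_indep_normal[OF I(1,2) this, of "\<lambda>k. \<bar>u k\<bar>" "\<lambda>_. 0"] d
  have "distributed (std_gaussian K) lborel (\<lambda>\<omega>. \<Sum>k\<in>I. u k * \<omega> k)
           (normal_density 0 (sqrt (\<Sum>k\<in>I. (u k)\<^sup>2)))"
    by (simp add: I_def)
  moreover have "(\<Sum>k\<in>I. u k * \<omega> k) = (\<Sum>k<K. u k * \<omega> k)" for \<omega>
    by (rule sum.mono_neutral_left) (auto simp: I_def)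
  moreover have "(\<Sum>k\<in>I. (u k)\<^sup>2) = (\<Sum>k<K. (u k)\<^sup>2)"
    by (rule sum.mono_neutral_left) (auto simp: I_def)
  ultimately show ?thesis by simp
qed

text \<open>A nonzero form is centred normal; the zero form has no density and is treated apart. The
  factor \<open>sqrt (2/pi)\<close> is the absolute first moment of a standard normal
  variable.\<close>

lemma std_gaussian_linear_moments:
  shows "integrable (std_gaussian K) (\<lambda>\<omega>. (\<Sum>k<K. u k * \<omega> k)\<^sup>2)" (is ?a)
    and "(\<integral>\<omega>. (\<Sum>k<K. u k * \<omega> k)\<^sup>2 \<partial>std_gaussian K) = (\<Sum>k<K. (u k)\<^sup>2)" (is ?b)
    and "integrable (std_gaussian K) (\<lambda>\<omega>. \<bar>\<Sum>k<K. u k * \<omega> k\<bar>)" (is ?c)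
    and "(\<integral>\<omega>. \<bar>\<Sum>k<K. u k * \<omega> k\<bar> \<partial>std_gaussian K) = sqrt (2/pi) * sqrt (\<Sum>k<K. (u k)\<^sup>2)" (is ?d)
proof -
  have "?a \<and> ?b \<and> ?c \<and> ?d"
  proof (cases "\<exists>k<K. u k \<noteq> 0")
    case False
    then have "(\<Sum>k<K. u k * \<omega> k) = 0" for \<omega> by (intro sum.neutral) auto
    moreover have "(\<Sum>k<K. (u k)\<^sup>2) = 0" using False by (intro sum.neutral) auto
    ultimately show ?thesis by simp
  next
    case True
    define s where "s = sqrt (\<Sum>k<K. (u k)\<^sup>2)"
    have pos: "(\<Sum>k<K. (u k)\<^sup>2) > 0" using True by (auto intro!: sum_pos2)
    then have s: "s > 0" "s\<^sup>2 = (\<Sum>k<K. (u k)\<^sup>2)" by (auto simp: s_def)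
    note d = std_gaussian_linear_distributed[OF True, folded s_def]
    have 2: "has_bochner_integral lborel (\<lambda>x. normal_density 0 s x * x\<^sup>2) (s\<^sup>2)"
      using normal_moment_even[OF s(1), of 0 1] by (simp add: power2_eq_square field_simps)
    have 1: "has_bochner_integral lborel (\<lambda>x. normal_density 0 s x * \<bar>x\<bar>) (sqrt (2/pi) * s)"
      using normal_moment_abs_odd[OF s(1), of 0 0] by (simp add: mult.commute)
    have i2: "integrable (std_gaussian K) (\<lambda>\<omega>. (\<Sum>k<K. u k * \<omega> k)\<^sup>2)"
      using distributed_integrable[OF d, of "\<lambda>x. x\<^sup>2"] 2 by (auto simp: has_bochner_integral_iff)
    have i1: "integrable (std_gaussian K) (\<lambda>\<omega>. \<bar>\<Sum>k<K. u k * \<omega> k\<bar>)"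
      using distributed_integrable[OF d, of "\<lambda>x. \<bar>x\<bar>"] 1 by (auto simp: has_bochner_integral_iff)
    show ?thesis using i1 i2
      distributed_integral[OF d, of "\<lambda>x. x\<^sup>2"] distributed_integral[OF d, of "\<lambda>x. \<bar>x\<bar>"] 1 2 s
      by (auto simp: has_bochner_integral_iff s_def)
  qed
  then show ?a ?b ?c ?d by auto
qed

text \<open>The value at 0 is 1, unlike that of \<open>sgn\<close>, so the square is 1 everywhere
  and rounding has the prescribed squared coordinates at every sample point, not just almost
  surely.\<close>

definition pm_sign :: "real \<Rightarrow> real" where
  "pm_sign x = (if 0 \<le> x then 1 else -1)"

lemma pm_sign_measurable [measurable]: "pm_sign \<in> borel_measurable borel"
  unfolding pm_sign_def[abs_def] by measurable

lemma pm_sign_sq: "(pm_sign x)\<^sup>2 = 1" and abs_pm_sign: "\<bar>pm_sign x\<bar> = 1"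
  by (auto simp: pm_sign_def)

lemma std_gaussian_linear_integrable:
  "integrable (std_gaussian K) (\<lambda>\<omega>. \<Sum>k<K. u k * \<omega> k)"
  using std_gaussian_linear_moments(3)[of K u] by (subst (asm) integrable_abs_iff) auto

text \<open>Polarisation of the second moments of the forms with coefficients \<open>u + v\<close>,
  \<open>u\<close> and \<open>v\<close>.\<close>

lemma std_gaussian_covariance:
  shows "integrable (std_gaussian K) (\<lambda>\<omega>. (\<Sum>k<K. u k * \<omega> k) * (\<Sum>k<K. v k * \<omega> k))" (is ?a)
    and "(\<integral>\<omega>. (\<Sum>k<K. u k * \<omega> k) * (\<Sum>k<K. v k * \<omega> k) \<partial>std_gaussian K) = (\<Sum>k<K. u k * v k)" (is ?b)
proof -
  have add: "(\<Sum>k<K. (u k + v k) * \<omega> k) = (\<Sum>k<K. u k * \<omega> k) + (\<Sum>k<K. v k * \<omega> k)" for \<omega>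
    by (simp add: sum.distrib distrib_right)
  have pol: "(\<lambda>\<omega>. (\<Sum>k<K. u k * \<omega> k) * (\<Sum>k<K. v k * \<omega> k)) =
     (\<lambda>\<omega>. ((\<Sum>k<K. (u k + v k) * \<omega> k)\<^sup>2 - (\<Sum>k<K. u k * \<omega> k)\<^sup>2 - (\<Sum>k<K. v k * \<omega> k)\<^sup>2) / 2)"
    unfolding add by (auto simp: power2_eq_square algebra_simps)
  note m = std_gaussian_linear_moments(1,2)
  show ?a unfolding pol by (intro integrable_divide Bochner_Integration.integrable_diff m)
  have "(\<Sum>k<K. (u k + v k)\<^sup>2) = (\<Sum>k<K. (u k)\<^sup>2) + (\<Sum>k<K. (v k)\<^sup>2) + 2 * (\<Sum>k<K. u k * v k)"
    by (simp add: power2_sum sum.distrib sum_distrib_left mult.assoc)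
  then show ?b unfolding pol by (simp add: m Bochner_Integration.integrable_diff)
qed

lemma integrable_pm_sign_mult:
  assumes [measurable]: "X \<in> borel_measurable M" and Y: "integrable M Y"
  shows "integrable M (\<lambda>\<omega>. pm_sign (X \<omega>) * Y \<omega>)"
proof -
  have [measurable]: "Y \<in> borel_measurable M" using Y by auto
  show ?thesis
    by (rule Bochner_Integration.integrable_bound[OF Y]) (auto simp: abs_mult abs_pm_sign)
qed

text \<open>By the subgradient inequality for the absolute value, the linear functional
  \<open>v \<mapsto> E (sign \<langle>u, g\<rangle> \<langle>v, g\<rangle>)\<close> supports \<open>v \<mapsto> E \<bar>\<langle>v, g\<rangle>\<bar> = sqrt (2 / pi) * \<parallel>v\<parallel>\<close> at \<open>u\<close>, hence is its gradient there.\<close>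
lemma std_gaussian_sign_covariance:
  "sqrt (\<Sum>k<K. (u k)\<^sup>2) * (\<integral>\<omega>. pm_sign (\<Sum>k<K. u k * \<omega> k) * (\<Sum>k<K. v k * \<omega> k) \<partial>std_gaussian K)
     = sqrt (2/pi) * (\<Sum>k<K. u k * v k)"
proof (cases "\<exists>k<K. u k \<noteq> 0")
  case False
  then show ?thesis by simp
next
  case True
  define a where "a = (\<Sum>k<K. (u k)\<^sup>2)"
  define b where "b = (\<Sum>k<K. u k * v k)"
  define d where "d = (\<Sum>k<K. (v k)\<^sup>2)"
  define c where "c = sqrt (2/pi)"
  define e where "e = (\<integral>\<omega>. pm_sign (\<Sum>k<K. u k * \<omega> k) * (\<Sum>k<K. v k * \<omega> k) \<partial>std_gaussian K)"
  have a: "a > 0" unfolding a_def using True by (auto intro!: sum_pos2)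
  have quad: "(\<Sum>k<K. (u k + t * v k)\<^sup>2) = a + 2 * b * t + d * t\<^sup>2" for t
    by (simp add: a_def b_def d_def power2_sum sum.distrib sum_distrib_left sum_distrib_right
        power_mult_distrib algebra_simps)
  have supp: "c * sqrt a + t * e \<le> c * sqrt (a + 2 * b * t + d * t\<^sup>2)" for t
  proof -
    have sp: "\<bar>x\<bar> + t * (pm_sign x * y) \<le> \<bar>x + t * y\<bar>" for x y by (auto simp: pm_sign_def)
    have lin: "(\<Sum>k<K. (u k + t * v k) * \<omega> k) = (\<Sum>k<K. u k * \<omega> k) + t * (\<Sum>k<K. v k * \<omega> k)" for \<omega>
      by (simp add: sum.distrib sum_distrib_left distrib_right mult.assoc)
    note int = std_gaussian_linear_moments(3)
      integrable_pm_sign_mult[OF measurable_std_gaussian_linear std_gaussian_linear_integrable]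
    have "(\<integral>\<omega>. \<bar>\<Sum>k<K. u k * \<omega> k\<bar> + t * (pm_sign (\<Sum>k<K. u k * \<omega> k) * (\<Sum>k<K. v k * \<omega> k)) \<partial>std_gaussian K)
       \<le> (\<integral>\<omega>. \<bar>\<Sum>k<K. (u k + t * v k) * \<omega> k\<bar> \<partial>std_gaussian K)"
      by (rule integral_mono) (use sp in \<open>auto simp: lin[symmetric] intro!: int\<close>, simp add: lin sp)
    also have "\<dots> = c * sqrt (a + 2 * b * t + d * t\<^sup>2)"
      by (simp add: std_gaussian_linear_moments(4) quad c_def)
    finally show ?thesis
      by (simp add: int std_gaussian_linear_moments(4) e_def c_def a_def)
  qed
  \<comment> \<open>By \<open>supp\<close>, \<open>f\<close> has a minimum at 0. Since
    \<open>a > 0\<close> it is differentiable there, and its vanishing derivative determines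
    \<open>e\<close>.\<close>
  define f where "f t = c * sqrt (a + 2 * b * t + d * t\<^sup>2) - t * e" for t
  have "(f has_real_derivative c * (2 * b / (2 * sqrt a)) - e) (at 0)"
    unfolding f_def using a by (auto intro!: derivative_eq_intros simp: field_simps)
  moreover have "\<forall>y. \<bar>0 - y\<bar> < 1 \<longrightarrow> f 0 \<le> f y" using supp by (auto simp: f_def algebra_simps)
  ultimately have "c * (2 * b / (2 * sqrt a)) - e = 0" by - (rule DERIV_local_min[where d=1], auto)
  then have "sqrt a * e = c * b" using a by (auto simp: field_simps)
  then show ?thesis by (simp add: a_def b_def c_def e_def)
qed

lemma quad_form_eq_sum:
  fixes M :: "real mat"
  assumes "M \<in> carrier_mat N N" "v \<in> carrier_vec N"
  shows "v \<bullet> (M *\<^sub>v v) = (\<Sum>i<N. \<Sum>j<N. M $$ (i,j) * (v $ i * v $ j))"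
  using assms
  by (auto simp: scalar_prod_def mult_mat_vec_def sum_distrib_left lessThan_atLeast0 ac_simps intro!: sum.cong)

text \<open>Rietz' argument: with \<open>\<xi> = \<Sum>k. g k \<cdot> vs ! k\<close>, the vector \<open>Y j = d j * sign (\<xi> j)\<close> satisfies
  \<open>0 \<le> E q(Y - c \<xi>) = E q(Y) - c\<^sup>2 E q(\<xi>)\<close> for \<open>c = sqrt (2 / pi)\<close>.\<close>
lemma gaussian_sign_rounding:
  fixes M :: "real mat"
  assumes M: "M \<in> carrier_mat N N" and psd: "\<And>v. v \<in> carrier_vec N \<Longrightarrow> 0 \<le> v \<bullet> (M *\<^sub>v v)"
    and vs: "set vs \<subseteq> carrier_vec N"
  obtains y where "y \<in> carrier_vec N" "\<And>j. j < N \<Longrightarrow> (y $ j)\<^sup>2 = (\<Sum>v\<leftarrow>vs. (v $ j)\<^sup>2)"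
    "2 / pi * (\<Sum>v\<leftarrow>vs. v \<bullet> (M *\<^sub>v v)) \<le> y \<bullet> (M *\<^sub>v y)"
proof -
  define K where "K = length vs"
  interpret prob_space "std_gaussian K" by (rule prob_space_std_gaussian)
  define u where "u j k = vs ! k $ j" for j k
  define c where "c = sqrt (2/pi)"
  \<comment> \<open>The standard deviation of coordinate \<open>j\<close> of \<open>\<xi>\<close>.
    This scaling cancels the square root in the sign covariance, so the mixed moments of
    \<open>Y\<close> and \<open>\<xi>\<close> become \<open>c * r i j\<close>.\<close>
  define d where "d j = sqrt (\<Sum>k<K. (u j k)\<^sup>2)" for j
  define \<xi> where "\<xi> \<omega> j = (\<Sum>k<K. u j k * \<omega> k)" for \<omega> j
  define Y where "Y \<omega> j = d j * pm_sign (\<xi> \<omega> j)" for \<omega> j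
  define r where "r i j = (\<Sum>k<K. u i k * u j k)" for i j
  have [measurable]: "(\<lambda>\<omega>. \<xi> \<omega> j) \<in> borel_measurable (std_gaussian K)" for j
    unfolding \<xi>_def by measurable
  have c2: "c * c = 2/pi" by (simp add: c_def)
  have i1: "integrable (std_gaussian K) (\<lambda>\<omega>. \<xi> \<omega> i * \<xi> \<omega> j)"
    and e1: "expectation (\<lambda>\<omega>. \<xi> \<omega> i * \<xi> \<omega> j) = r i j" for i j
    unfolding \<xi>_def r_def by (rule std_gaussian_covariance)+
  have i2: "integrable (std_gaussian K) (\<lambda>\<omega>. Y \<omega> i * \<xi> \<omega> j)" for i j
  proof -
    have "integrable (std_gaussian K) (\<lambda>\<omega>. d i * (pm_sign (\<xi> \<omega> i) * \<xi> \<omega> j))"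
      by (intro integrable_mult_right integrable_pm_sign_mult)
        (auto simp: \<xi>_def std_gaussian_linear_integrable)
    then show ?thesis by (simp add: Y_def mult.assoc)
  qed
  have e2: "expectation (\<lambda>\<omega>. Y \<omega> i * \<xi> \<omega> j) = c * r i j" for i j
    using std_gaussian_sign_covariance[where K=K and u="u i" and v="u j"]
    by (simp add: Y_def mult.assoc c_def r_def d_def \<xi>_def)
  have i3: "integrable (std_gaussian K) (\<lambda>\<omega>. Y \<omega> i * Y \<omega> j)" for i j
    by (rule integrable_const_bound[where B="\<bar>d i\<bar> * \<bar>d j\<bar>"]) (auto simp: Y_def abs_mult abs_pm_sign)
  define q where "q x = (\<Sum>i<N. \<Sum>j<N. M $$ (i,j) * (x i * x j))" for x
  have q: "q x = vec N x \<bullet> (M *\<^sub>v vec N x)" for x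
    by (subst quad_form_eq_sum[OF M]) (auto simp: q_def)
  define S where "S = (\<Sum>i<N. \<Sum>j<N. M $$ (i,j) * r i j)"
  have S: "S = (\<Sum>v\<leftarrow>vs. v \<bullet> (M *\<^sub>v v))"
  proof -
    have "(\<Sum>v\<leftarrow>vs. v \<bullet> (M *\<^sub>v v)) = (\<Sum>k<K. \<Sum>i<N. \<Sum>j<N. M $$ (i,j) * (u i k * u j k))"
      using vs by (auto simp: sum_list_sum_nth K_def u_def lessThan_atLeast0[symmetric] subset_iff
        intro!: sum.cong quad_form_eq_sum[OF M])
    also have "\<dots> = S" unfolding S_def r_def sum_distrib_left
      by (subst sum.swap, rule sum.cong[OF refl], subst sum.swap, rule refl)
    finally show ?thesis ..
  qed
  have exp: "q (\<lambda>j. Y \<omega> j - c * \<xi> \<omega> j) = (\<Sum>i<N. \<Sum>j<N. M $$ (i,j) *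
      (Y \<omega> i * Y \<omega> j - c * (Y \<omega> i * \<xi> \<omega> j) - c * (Y \<omega> j * \<xi> \<omega> i) + c * c * (\<xi> \<omega> i * \<xi> \<omega> j)))" for \<omega>
    unfolding q_def by (intro sum.cong refl) (simp add: algebra_simps)
  have rsym: "r j i = r i j" for i j by (simp add: r_def mult.commute)
  have "0 \<le> expectation (\<lambda>\<omega>. q (\<lambda>j. Y \<omega> j - c * \<xi> \<omega> j))"
    by (rule Bochner_Integration.integral_nonneg) (simp add: q psd)
  \<comment> \<open>The two cross terms contribute \<open>- 2 * c * c * r i j\<close> and the square
    of \<open>c * \<xi>\<close> contributes \<open>c * c * r i j\<close>, which leaves one negative
    copy.\<close>
  also have "\<dots> = (\<Sum>i<N. \<Sum>j<N. M $$ (i,j) * (expectation (\<lambda>\<omega>. Y \<omega> i * Y \<omega> j) - c * c * r i j))"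
    unfolding exp by (simp add: i1 i2 i3 e1 e2 rsym mult.assoc)
  also have "\<dots> = expectation (\<lambda>\<omega>. q (Y \<omega>)) - c * c * S"
  proof -
    have "expectation (\<lambda>\<omega>. q (Y \<omega>)) = (\<Sum>i<N. \<Sum>j<N. M $$ (i,j) * expectation (\<lambda>\<omega>. Y \<omega> i * Y \<omega> j))"
      unfolding q_def by (simp add: i3)
    then show ?thesis
      by (simp add: S_def sum_subtractf right_diff_distrib sum_distrib_left mult.left_commute)
  qed
  finally have le: "c * c * S \<le> expectation (\<lambda>\<omega>. q (Y \<omega>))" by simp
  have int: "integrable (std_gaussian K) (\<lambda>\<omega>. q (Y \<omega>))" by (auto simp: q_def i3)
  \<comment> \<open>A random variable cannot stay strictly below a lower bound of its mean, so some
    sample point is as good as the average.\<close>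
  have "\<exists>\<omega>. c * c * S \<le> q (Y \<omega>)"
  proof (rule ccontr)
    assume "\<not> ?thesis"
    then have "q (Y \<omega>) < c * c * S" for \<omega> by (auto simp: not_le)
    then have "expectation (\<lambda>\<omega>. q (Y \<omega>)) < c * c * S"
      by (intro expectation_less int) auto
    with le show False by simp
  qed
  then obtain \<omega> where \<omega>: "c * c * S \<le> q (Y \<omega>)" by auto
  show thesis
  proof (rule that[of "vec N (Y \<omega>)"])
    fix j assume "j < N"
    have "d j ^ 2 = (\<Sum>k<K. (u j k)\<^sup>2)" unfolding d_def by (simp add: sum_nonneg)
    also have "\<dots> = (\<Sum>v\<leftarrow>vs. (v $ j)\<^sup>2)"
      by (simp add: sum_list_sum_nth K_def u_def lessThan_atLeast0)
    finally show "(vec N (Y \<omega>) $ j)\<^sup>2 = (\<Sum>v\<leftarrow>vs. (v $ j)\<^sup>2)" using \<open>j < N\<close>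
      by (simp add: Y_def power_mult_distrib pm_sign_sq)
  next
    show "2 / pi * (\<Sum>v\<leftarrow>vs. v \<bullet> (M *\<^sub>v v)) \<le> vec N (Y \<omega>) \<bullet> (M *\<^sub>v vec N (Y \<omega>))"
      using \<omega> unfolding q S c2 .
  qed auto
qed

section \<open>A theorem of the alternative\<close>

text \<open>Separation in the plane by slopes. If both functions are positive somewhere, the
  multiplier of \<open>h\<close> has to lie above all ratios \<open>g x / - h x\<close> with
  \<open>0 < g x\<close> and below all ratios \<open>- g y / h y\<close> with
  \<open>0 < h y\<close>; \<open>cross\<close> makes these two families compatible.\<close>

lemma concavelike_alternative_two:
  fixes g h :: "'a \<Rightarrow> real"
  assumes conc: "\<And>x y t. x \<in> C \<Longrightarrow> y \<in> C \<Longrightarrow> 0 \<le> t \<Longrightarrow> t \<le> 1 \<Longrightarrow>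
      \<exists>z\<in>C. t * g x + (1 - t) * g y \<le> g z \<and> t * h x + (1 - t) * h y \<le> h z"
    and no: "\<And>x. x \<in> C \<Longrightarrow> 0 < g x \<Longrightarrow> h x \<le> 0"
  obtains a b where "0 \<le> a" "0 \<le> b" "a \<noteq> 0 \<or> b \<noteq> 0" "\<And>x. x \<in> C \<Longrightarrow> a * g x + b * h x \<le> 0"
proof (cases "(\<forall>x\<in>C. g x \<le> 0) \<or> (\<forall>x\<in>C. h x \<le> 0)")
  case True
  then show thesis
  proof
    assume "\<forall>x\<in>C. g x \<le> 0" then show thesis using that[of 1 0] by auto
  next
    assume "\<forall>x\<in>C. h x \<le> 0" then show thesis using that[of 0 1] by auto
  qed
next
  case False
  then obtain x0 y0 where x0: "x0 \<in> C" "0 < g x0" and y0: "y0 \<in> C" "0 < h y0" by (auto simp: not_le)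
  \<comment> \<open>If this failed, a suitable mixture of \<open>x\<close> and \<open>y\<close>
    would be dominated by a point where both functions are positive, against
    \<open>no\<close>.\<close>
  have cross: "g x * h y \<le> g y * h x" if x: "x \<in> C" "0 < g x" and y: "y \<in> C" "0 < h y" for x y
  proof (rule ccontr)
    assume "\<not> ?thesis"
    then have lt: "g y * h x < g x * h y" by simp
    have gy: "g y \<le> 0" using no[OF y(1)] y(2) by force
    have hx: "h x \<le> 0" using no[OF x] .
    \<comment> \<open>\<open>r\<close> is the weight of \<open>x\<close> relative to
      \<open>y\<close>. The two strict inequalities confine it to an interval that is nonempty
      because of \<open>lt\<close>; for \<open>h x = 0\<close> only the lower end remains, and the
      chosen value makes the first expression equal to 1.\<close>
    obtain r where r: "0 \<le> r" "0 < r * g x + g y" "0 < r * h x + h y"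
    proof (cases "h x = 0")
      case True
      show thesis by (rule that[of "(1 - g y) / g x"]) (use True x y gy in \<open>auto simp: field_simps\<close>)
    next
      case False
      then have "h x < 0" using hx by simp
      then have "- g y / g x < h y / - h x" using lt x by (simp add: field_simps)
      then obtain r where "- g y / g x < r" "r < h y / - h x" using dense by blast
      moreover from this have "0 \<le> r"
        using divide_nonneg_pos[of "- g y" "g x"] gy x by linarith
      ultimately show thesis using that[of r] x \<open>h x < 0\<close> by (simp add: field_simps)
    qed
    define t where "t = r / (1 + r)"
    have t: "0 \<le> t" "t \<le> 1" "1 - t = 1 / (1 + r)" using r by (auto simp: t_def field_simps)
    obtain z where z: "z \<in> C" "t * g x + (1 - t) * g y \<le> g z" "t * h x + (1 - t) * h y \<le> h z"
      using conc[OF x(1) y(1) t(1,2)] by auto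
    have "t * g x + (1 - t) * g y = (r * g x + g y) / (1 + r)"
      unfolding t(3) by (simp add: t_def add_divide_distrib)
    then have "0 < g z" using z r by (smt (verit) divide_pos_pos)
    have "t * h x + (1 - t) * h y = (r * h x + h y) / (1 + r)"
      unfolding t(3) by (simp add: t_def add_divide_distrib)
    then have "0 < h z" using z r by (smt (verit) divide_pos_pos)
    with no[OF z(1) \<open>0 < g z\<close>] show False by simp
  qed
  have hneg: "h x < 0" if "x \<in> C" "0 < g x" for x
  proof -
    have "0 < g x * h y0" using that y0 by simp
    then have "h x \<noteq> 0" using cross[OF that y0] by auto
    then show ?thesis using no[OF that] by simp
  qed
  define X where "X = {x \<in> C. 0 < g x}"
  \<comment> \<open>The least multiplier compatible with all points of \<open>X\<close>; any single
    point with positive \<open>h\<close>, such as \<open>y0\<close>, bounds it from above.\<close>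
  define b where "b = (SUP x\<in>X. g x / - h x)"
  have up: "g x / - h x \<le> - g y / h y" if "x \<in> X" "y \<in> C" "0 < h y" for x y
    using cross[of x y] that hneg[of x] by (auto simp: X_def field_simps)
  have bdd: "bdd_above ((\<lambda>x. g x / - h x) ` X)"
    by (rule bdd_aboveI2[where M="- g y0 / h y0"]) (use up y0 in auto)
  have ne: "X \<noteq> {}" using x0 by (auto simp: X_def)
  have bX: "g x / - h x \<le> b" if "x \<in> X" for x unfolding b_def by (rule cSUP_upper[OF that bdd])
  have b0: "0 \<le> b" using bX[of x0] x0 hneg[of x0] by (smt (verit) X_def divide_pos_pos mem_Collect_eq)
  show thesis
  proof (rule that[of 1 b])
    fix x assume x: "x \<in> C"
    consider "0 < g x" | "0 < h x" | "g x \<le> 0" "h x \<le> 0" by linarith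
    then show "1 * g x + b * h x \<le> 0"
    proof cases
      case 1
      then show ?thesis using bX[of x] hneg[OF x 1] x by (simp add: X_def field_simps)
    next
      case 2
      have "b \<le> - g x / h x" unfolding b_def by (rule cSUP_least[OF ne]) (use up x 2 in auto)
      then show ?thesis using 2 by (simp add: field_simps)
    next
      case 3
      then show ?thesis using b0 by (smt (verit) mult_nonneg_nonpos)
    qed
  qed (use b0 in auto)
qed

text \<open>Induction on the number of functions. On the points where the last function is positive,
  the induction hypothesis combines the others into a \<open>g\<close> that is never positive. Hence
  \<open>g\<close> and the last function are never positive together, and the case of two functions
  applies to them.\<close>

lemma concavelike_alternative:
  fixes f :: "nat \<Rightarrow> 'a \<Rightarrow> real"
  assumes conc: "\<And>x y t. x \<in> C \<Longrightarrow> y \<in> C \<Longrightarrow> 0 \<le> t \<Longrightarrow> t \<le> 1 \<Longrightarrow>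
      \<exists>z\<in>C. \<forall>i\<le>k. t * f i x + (1 - t) * f i y \<le> f i z"
    and no: "\<And>x. x \<in> C \<Longrightarrow> \<exists>i\<le>k. f i x \<le> 0"
  shows "\<exists>c. (\<forall>i\<le>k. 0 \<le> c i) \<and> (\<exists>i\<le>k. c i \<noteq> 0) \<and> (\<forall>x\<in>C. (\<Sum>i\<le>k. c i * f i x) \<le> 0)"
  using assms
proof (induction k arbitrary: C)
  case 0
  then show ?case by (intro exI[of _ "\<lambda>_. 1"]) auto
next
  case (Suc k)
  define D where "D = {x \<in> C. 0 < f (Suc k) x}"
  have "\<exists>c. (\<forall>i\<le>k. 0 \<le> c i) \<and> (\<exists>i\<le>k. c i \<noteq> 0) \<and> (\<forall>x\<in>D. (\<Sum>i\<le>k. c i * f i x) \<le> 0)"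
  proof (rule Suc.IH)
    fix x y t assume xy: "x \<in> D" "y \<in> D" and t: "0 \<le> t" "t \<le> (1::real)"
    obtain z where z: "z \<in> C" "\<And>i. i \<le> Suc k \<Longrightarrow> t * f i x + (1 - t) * f i y \<le> f i z"
      using Suc.prems(1)[of x y t] xy t by (auto simp: D_def)
    have "0 < t * f (Suc k) x + (1 - t) * f (Suc k) y"
      using xy t by (cases "t = 0") (auto simp: D_def intro: add_pos_nonneg)
    then have "z \<in> D" using z(2)[of "Suc k"] z(1) by (auto simp: D_def)
    then show "\<exists>z\<in>D. \<forall>i\<le>k. t * f i x + (1 - t) * f i y \<le> f i z" using z(2) by (auto intro: le_SucI)
  next
    fix x assume "x \<in> D"
    then show "\<exists>i\<le>k. f i x \<le> 0" using Suc.prems(2)[of x] by (auto simp: D_def le_Suc_eq)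
  qed
  then obtain c where c: "\<And>i. i \<le> k \<Longrightarrow> 0 \<le> c i" "\<exists>i\<le>k. c i \<noteq> 0"
    "\<And>x. x \<in> D \<Longrightarrow> (\<Sum>i\<le>k. c i * f i x) \<le> 0" by auto
  define g where "g x = (\<Sum>i\<le>k. c i * f i x)" for x
  obtain a b where ab: "0 \<le> a" "0 \<le> b" "a \<noteq> 0 \<or> b \<noteq> 0"
    "\<And>x. x \<in> C \<Longrightarrow> a * g x + b * f (Suc k) x \<le> 0"
  proof (rule concavelike_alternative_two[of C g "f (Suc k)"])
    fix x y t assume xy: "x \<in> C" "y \<in> C" and t: "0 \<le> t" "t \<le> (1::real)"
    obtain z where z: "z \<in> C" "\<And>i. i \<le> Suc k \<Longrightarrow> t * f i x + (1 - t) * f i y \<le> f i z"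
      using Suc.prems(1)[of x y t] xy t by auto
    have "t * g x + (1 - t) * g y = (\<Sum>i\<le>k. c i * (t * f i x + (1 - t) * f i y))"
      by (simp add: g_def sum_distrib_left distrib_left sum.distrib mult.left_commute)
    also have "\<dots> \<le> g z" unfolding g_def by (intro sum_mono mult_left_mono z(2) c(1)) auto
    finally show "\<exists>z\<in>C. t * g x + (1 - t) * g y \<le> g z \<and>
        t * f (Suc k) x + (1 - t) * f (Suc k) y \<le> f (Suc k) z"
      using z by auto
  next
    fix x assume "x \<in> C" "0 < g x"
    then show "f (Suc k) x \<le> 0" using c(3)[of x] by (auto simp: D_def g_def not_le[symmetric])
  qed auto
  define c' where "c' i = (if i \<le> k then a * c i else b)" for i
  have "(\<Sum>i\<le>Suc k. c' i * f i x) = a * g x + b * f (Suc k) x" for x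
    by (simp add: c'_def g_def sum_distrib_left mult.assoc)
  moreover have "\<exists>i\<le>Suc k. c' i \<noteq> 0"
  proof (cases "a = 0")
    case True then show ?thesis using ab by (intro exI[of _ "Suc k"]) (auto simp: c'_def)
  next
    case False
    obtain i where "i \<le> k" "c i \<noteq> 0" using c(2) by auto
    then show ?thesis using False by (intro exI[of _ i]) (auto simp: c'_def)
  qed
  ultimately show ?case using ab c(1) by (intro exI[of _ c']) (auto simp: c'_def)
qed

section \<open>Real symmetric matrices\<close>

text \<open>Stated with equal dimensions instead of a common carrier, these rules have no dimension
  variable left to guess and can serve as conditional rewrite rules.\<close>

lemma scalar_prod_add_right_dim:
  fixes a :: "real vec"
  assumes "dim_vec b = dim_vec a" "dim_vec c = dim_vec a"
  shows "a \<bullet> (b + c) = a \<bullet> b + a \<bullet> c"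
  by (rule scalar_prod_add_distrib[of _ "dim_vec a"]) (use assms in \<open>auto intro: carrier_vecI\<close>)

lemma scalar_prod_add_left_dim:
  fixes a :: "real vec"
  assumes "dim_vec a = dim_vec c" "dim_vec b = dim_vec c"
  shows "(a + b) \<bullet> c = a \<bullet> c + b \<bullet> c"
  by (rule add_scalar_prod_distrib[of _ "dim_vec c"]) (use assms in \<open>auto intro: carrier_vecI\<close>)

lemma scalar_prod_minus_right_dim:
  fixes a :: "real vec"
  assumes "dim_vec b = dim_vec a" "dim_vec c = dim_vec a"
  shows "a \<bullet> (b - c) = a \<bullet> b - a \<bullet> c"
  by (rule scalar_prod_minus_distrib[of _ "dim_vec a"]) (use assms in \<open>auto intro: carrier_vecI\<close>)

lemma scalar_prod_minus_left_dim:
  fixes a :: "real vec"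
  assumes "dim_vec a = dim_vec c" "dim_vec b = dim_vec c"
  shows "(a - b) \<bullet> c = a \<bullet> c - b \<bullet> c"
  by (rule minus_scalar_prod_distrib[of _ "dim_vec c"]) (use assms in \<open>auto intro: carrier_vecI\<close>)

lemmas scalar_prod_dim_simps = scalar_prod_add_right_dim scalar_prod_add_left_dim
  scalar_prod_minus_right_dim scalar_prod_minus_left_dim

lemma scalar_prod_self_ge_0: "0 \<le> v \<bullet> (v :: real vec)"
  by (auto simp: scalar_prod_def intro!: sum_nonneg)

lemma scalar_prod_self_eq_0_iff:
  assumes "(v :: real vec) \<in> carrier_vec n"
  shows "v \<bullet> v = 0 \<longleftrightarrow> v = 0\<^sub>v n"
  using assms by (auto simp: scalar_prod_def sum_nonneg_eq_0_iff)

lemma scalar_prod_self_pos: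
  assumes "(v :: real vec) \<in> carrier_vec n" "v \<noteq> 0\<^sub>v n"
  shows "0 < v \<bullet> v"
  using scalar_prod_self_ge_0[of v] scalar_prod_self_eq_0_iff[OF assms(1)] assms(2) by linarith

lemma mat_eq_mult_vecI:
  fixes A :: "real mat"
  assumes "A \<in> carrier_mat nr nc" "B \<in> carrier_mat nr nc"
    and eq: "\<And>v. v \<in> carrier_vec nc \<Longrightarrow> A *\<^sub>v v = B *\<^sub>v v"
  shows "A = B"
proof (rule eq_matI)
  fix i j assume ij: "i < dim_row B" "j < dim_col B"
  then have "(A *\<^sub>v unit_vec nc j) $ i = (B *\<^sub>v unit_vec nc j) $ i" using eq by simp
  then show "A $$ (i, j) = B $$ (i, j)" using assms(1,2) ij by simp
qed (use assms in auto)

section \<open>Self-adjointness and the spectral theorem for real symmetric matrices\<close>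

lemma adjoint_scalar_prod:
  assumes "(A :: real mat) \<in> carrier_mat nr nc" "x \<in> carrier_vec nc" "y \<in> carrier_vec nr"
  shows "y \<bullet> (A *\<^sub>v x) = (A\<^sup>T *\<^sub>v y) \<bullet> x"
  using transpose_vec_mult_scalar[OF assms] by simp

lemma symmetric_scalar_prod:
  assumes "(A :: real mat) \<in> carrier_mat n n" "A\<^sup>T = A" "x \<in> carrier_vec n" "y \<in> carrier_vec n"
  shows "y \<bullet> (A *\<^sub>v x) = x \<bullet> (A *\<^sub>v y)"
  using adjoint_scalar_prod[OF assms(1,3,4)] assms comm_scalar_prod[of "A *\<^sub>v y" n x] by simp

lemma symmetricI_scalar_prod:
  assumes A: "(A :: real mat) \<in> carrier_mat n n"
    and eq: "\<And>x y. x \<in> carrier_vec n \<Longrightarrow> y \<in> carrier_vec n \<Longrightarrow> y \<bullet> (A *\<^sub>v x) = x \<bullet> (A *\<^sub>v y)"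
  shows "A\<^sup>T = A"
proof (rule eq_matI)
  fix i j assume "i < dim_row A" "j < dim_col A"
  then have ij: "i < n" "j < n" using A by auto
  then have "unit_vec n j \<bullet> (A *\<^sub>v unit_vec n i) = unit_vec n i \<bullet> (A *\<^sub>v unit_vec n j)"
    by (intro eq) auto
  then show "A\<^sup>T $$ (i, j) = A $$ (i, j)" using A ij by simp
qed (use A in auto)

text \<open>A complex eigenvector is split into its real and imaginary parts \<open>x\<close> and
  \<open>y\<close>. Symmetry gives \<open>Im k * (x \<bullet> x + y \<bullet> y) = 0\<close>, so the
  eigenvalue is real and whichever part is nonzero is a real eigenvector.\<close>

lemma real_symmetric_eigenvector:
  fixes A :: "real mat"
  assumes A: "A \<in> carrier_mat n n" and sym: "A\<^sup>T = A" and n: "0 < n"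
  obtains v e where "v \<in> carrier_vec n" "v \<bullet> v = 1" "A *\<^sub>v v = e \<cdot>\<^sub>v v"
proof -
  let ?A = "map_mat complex_of_real A"
  have A': "?A \<in> carrier_mat n n" using A by auto
  obtain k where "eigenvalue ?A k"
    using spectrum_non_empty[OF A' n] by (auto simp: spectrum_def)
  then obtain z where z: "z \<in> carrier_vec n" "z \<noteq> 0\<^sub>v n" "?A *\<^sub>v z = k \<cdot>\<^sub>v z"
    using A' by (auto simp: eigenvalue_def eigenvector_def)
  define x where "x = map_vec Re z"
  define y where "y = map_vec Im z"
  have xy: "x \<in> carrier_vec n" "y \<in> carrier_vec n" using z by (auto simp: x_def y_def)
  have ent: "(\<Sum>j = 0..<n. of_real (A $$ (i,j)) * z $ j) = k * z $ i" if "i < n" for i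
    using arg_cong[OF z(3), of "\<lambda>v. v $ i"] that A z(1) by (simp add: scalar_prod_def)
  have Ax: "A *\<^sub>v x = Re k \<cdot>\<^sub>v x - Im k \<cdot>\<^sub>v y"
  proof (rule eq_vecI)
    fix i assume "i < dim_vec (Re k \<cdot>\<^sub>v x - Im k \<cdot>\<^sub>v y)"
    then have i: "i < n" using xy by simp
    show "(A *\<^sub>v x) $ i = (Re k \<cdot>\<^sub>v x - Im k \<cdot>\<^sub>v y) $ i"
      using arg_cong[OF ent[OF i], of Re] i A z(1) by (simp add: scalar_prod_def x_def y_def)
  qed (use xy A in auto)
  have Ay: "A *\<^sub>v y = Im k \<cdot>\<^sub>v x + Re k \<cdot>\<^sub>v y"
  proof (rule eq_vecI)
    fix i assume "i < dim_vec (Im k \<cdot>\<^sub>v x + Re k \<cdot>\<^sub>v y)"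
    then have i: "i < n" using xy by simp
    show "(A *\<^sub>v y) $ i = (Im k \<cdot>\<^sub>v x + Re k \<cdot>\<^sub>v y) $ i"
      using arg_cong[OF ent[OF i], of Im] i A z(1) by (simp add: scalar_prod_def x_def y_def)
  qed (use xy A in auto)
  have ne: "x \<noteq> 0\<^sub>v n \<or> y \<noteq> 0\<^sub>v n"
  proof (rule ccontr)
    assume "\<not> ?thesis"
    then have 0: "x = 0\<^sub>v n" "y = 0\<^sub>v n" by auto
    have "z $ i = 0" if "i < n" for i
      using arg_cong[OF 0(1), of "\<lambda>v. v $ i"] arg_cong[OF 0(2), of "\<lambda>v. v $ i"] that z(1)
      by (simp add: x_def y_def complex_eq_iff)
    then have "z = 0\<^sub>v n" using z(1) by (intro eq_vecI) auto
    then show False using z(2) by simp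
  qed
  have "x \<bullet> (A *\<^sub>v y) = y \<bullet> (A *\<^sub>v x)" by (rule symmetric_scalar_prod[OF A sym xy(2,1)])
  then have "Im k * (x \<bullet> x + y \<bullet> y) = 0"
    unfolding Ax Ay using xy comm_scalar_prod[OF xy] by (simp add: scalar_prod_dim_simps algebra_simps)
  moreover have "0 < x \<bullet> x + y \<bullet> y"
    using ne scalar_prod_self_pos[OF xy(1)] scalar_prod_self_pos[OF xy(2)]
      scalar_prod_self_ge_0[of x] scalar_prod_self_ge_0[of y] by fastforce
  ultimately have k: "Im k = 0" by auto
  have "\<exists>w. w \<in> carrier_vec n \<and> w \<noteq> 0\<^sub>v n \<and> A *\<^sub>v w = Re k \<cdot>\<^sub>v w"
  proof (cases "x = 0\<^sub>v n")
    case False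
    have "A *\<^sub>v x = Re k \<cdot>\<^sub>v x" unfolding Ax k using xy by (intro eq_vecI) auto
    then show ?thesis using False xy by blast
  next
    case True
    have "A *\<^sub>v y = Re k \<cdot>\<^sub>v y" unfolding Ay k using xy by (intro eq_vecI) auto
    then show ?thesis using True ne xy by blast
  qed
  then obtain w where w: "w \<in> carrier_vec n" "w \<noteq> 0\<^sub>v n" "A *\<^sub>v w = Re k \<cdot>\<^sub>v w" by blast
  have pos: "0 < w \<bullet> w" by (rule scalar_prod_self_pos[OF w(1,2)])
  define v where "v = (1 / sqrt (w \<bullet> w)) \<cdot>\<^sub>v w"
  show thesis
  proof (rule that[of v "Re k"])
    show "v \<in> carrier_vec n" using w by (simp add: v_def)
    show "v \<bullet> v = 1" using pos by (simp add: v_def field_simps)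
    show "A *\<^sub>v v = Re k \<cdot>\<^sub>v v" unfolding v_def mult_mat_vec[OF A w(1)] w(3)
      by (simp add: smult_smult_assoc mult.commute)
  qed
qed

text \<open>Extends \<open>v\<close> to an orthonormal basis, the columns of \<open>H\<close>,
  without Gram-Schmidt. The matrix is its own transpose and inverse, which keeps conjugation by it
  simple. When \<open>v\<close> is already the unit vector there is no direction to reflect along,
  hence the case split.\<close>

lemma orthogonal_symmetric_to_unit_vec:
  fixes v :: "real vec"
  assumes v: "v \<in> carrier_vec n" and vv: "v \<bullet> v = 1" and n: "0 < n"
  obtains H where "H \<in> carrier_mat n n" "H\<^sup>T = H" "H * H = 1\<^sub>m n" "H *\<^sub>v unit_vec n 0 = v"
proof (cases "v = unit_vec n 0")
  case True
  then show thesis using that[of "1\<^sub>m n"] by auto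
next
  case False
  define e where "e = (unit_vec n 0 :: real vec)"
  have e: "e \<in> carrier_vec n" "e \<bullet> e = 1" using n by (auto simp: e_def)
  define w where "w = v - e"
  have w: "w \<in> carrier_vec n" using v e by (simp add: w_def)
  have w0: "w \<noteq> 0\<^sub>v n"
  proof
    assume "w = 0\<^sub>v n"
    have "v $ i = e $ i" if "i < n" for i
      using arg_cong[OF \<open>w = 0\<^sub>v n\<close>, of "\<lambda>u. u $ i"] that v e by (simp add: w_def)
    then have "v = e" using v e by (intro eq_vecI) auto
    then show False using False by (simp add: e_def)
  qed
  have pos: "0 < w \<bullet> w" by (rule scalar_prod_self_pos[OF w w0])
  \<comment> \<open>Both vectors have norm one, so \<open>w \<bullet> w\<close> is
    \<open>2 - 2 * (v \<bullet> e)\<close> and \<open>w \<bullet> e\<close> is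
    \<open>v \<bullet> e - 1\<close>. This is why the reflection carries \<open>e\<close> exactly
    onto \<open>v\<close>.\<close>
  have ww: "w \<bullet> w = - 2 * (w \<bullet> e)"
    using v e vv comm_scalar_prod[OF v e(1)] by (simp add: w_def scalar_prod_dim_simps)
  text \<open>The Householder reflection along \<open>v - e\<close>.\<close>
  define H where "H = mat n n (\<lambda>(i,j). (if i = j then 1 else 0) - 2 / (w \<bullet> w) * (w $ i * w $ j))"
  have H: "H \<in> carrier_mat n n" by (simp add: H_def)
  have Hx: "H *\<^sub>v x = x - (2 * (w \<bullet> x) / (w \<bullet> w)) \<cdot>\<^sub>v w" if x: "x \<in> carrier_vec n" for x
  proof (rule eq_vecI)
    fix i assume "i < dim_vec (x - (2 * (w \<bullet> x) / (w \<bullet> w)) \<cdot>\<^sub>v w)"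
    then have i: "i < n" using w by simp
    have "(H *\<^sub>v x) $ i = (\<Sum>j = 0..<n. ((if i = j then 1 else 0) - 2 / (w \<bullet> w) * (w $ i * w $ j)) * x $ j)"
      using i x by (simp add: H_def scalar_prod_def)
    also have "\<dots> = (\<Sum>j = 0..<n. (if i = j then x $ j else 0) - 2 / (w \<bullet> w) * w $ i * (w $ j * x $ j))"
      by (intro sum.cong) (auto simp: algebra_simps)
    also have "\<dots> = x $ i - 2 / (w \<bullet> w) * w $ i * (\<Sum>j = 0..<n. w $ j * x $ j)"
      using i by (simp add: sum_subtractf sum_distrib_left)
    also have "(\<Sum>j = 0..<n. w $ j * x $ j) = w \<bullet> x" using x by (simp add: scalar_prod_def)
    finally show "(H *\<^sub>v x) $ i = (x - (2 * (w \<bullet> x) / (w \<bullet> w)) \<cdot>\<^sub>v w) $ i"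
      using i x w by simp
  qed (use w x H in auto)
  show thesis
  proof (rule that[of H])
    show "H \<in> carrier_mat n n" by fact
    show "H\<^sup>T = H" by (rule eq_matI) (auto simp: H_def)
    show "H *\<^sub>v unit_vec n 0 = v"
    proof -
      have "2 * (w \<bullet> e) / (w \<bullet> w) = - 1" using ww pos by (simp add: field_simps)
      then show ?thesis unfolding e_def[symmetric] Hx[OF e(1)]
        using v e by (intro eq_vecI) (auto simp: w_def)
    qed
    show "H * H = 1\<^sub>m n"
    proof (rule mat_eq_mult_vecI[of _ n n])
      fix x :: "real vec" assume x: "x \<in> carrier_vec n"
      define a where "a = 2 * (w \<bullet> x) / (w \<bullet> w)"
      have "w \<bullet> (x - a \<cdot>\<^sub>v w) = - (w \<bullet> x)"
        using x w pos by (simp add: scalar_prod_dim_simps a_def)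
      then have "2 * (w \<bullet> (x - a \<cdot>\<^sub>v w)) / (w \<bullet> w) = - a" by (simp add: a_def)
      then have "H *\<^sub>v (x - a \<cdot>\<^sub>v w) = (x - a \<cdot>\<^sub>v w) - (- a) \<cdot>\<^sub>v w"
        by (subst Hx) (use x w in auto)
      also have "\<dots> = x" using x w by (intro eq_vecI) auto
      finally show "H * H *\<^sub>v x = 1\<^sub>m n *\<^sub>v x"
        using x H by (simp add: Hx[OF x] a_def[symmetric] assoc_mult_mat_vec[OF H H x])
    qed (use H in auto)
  qed
qed

text \<open>Deflation. Conjugating by a reflection that moves the first unit vector onto an
  eigenvector clears the first column, by symmetry also the first row, and leaves a smaller
  symmetric block for the induction hypothesis.\<close>

lemma orthogonal_diagonalization_ex:
  fixes A :: "real mat"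
  assumes "A \<in> carrier_mat n n" "A\<^sup>T = A"
  shows "\<exists>U. U \<in> carrier_mat n n \<and> U\<^sup>T * U = 1\<^sub>m n \<and> diagonal_mat (U\<^sup>T * A * U)"
  using assms
proof (induction n arbitrary: A)
  case 0
  then show ?case by (intro exI[of _ "1\<^sub>m 0"]) (auto simp: diagonal_mat_def)
next
  case (Suc n)
  note A = Suc.prems(1) and sym = Suc.prems(2)
  obtain v e where v: "v \<in> carrier_vec (Suc n)" "v \<bullet> v = 1" "A *\<^sub>v v = e \<cdot>\<^sub>v v"
    using real_symmetric_eigenvector[OF A sym] by auto
  obtain H where H: "H \<in> carrier_mat (Suc n) (Suc n)" "H\<^sup>T = H" "H * H = 1\<^sub>m (Suc n)"
    "H *\<^sub>v unit_vec (Suc n) 0 = v"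
    using orthogonal_symmetric_to_unit_vec[OF v(1,2)] by auto
  define B where "B = H * A * H"
  have B: "B \<in> carrier_mat (Suc n) (Suc n)" using H A by (simp add: B_def)
  have HA: "H * A \<in> carrier_mat (Suc n) (Suc n)" using H A by simp
  have Bsym: "B\<^sup>T = B"
    unfolding B_def transpose_mult[OF HA H(1)] transpose_mult[OF H(1) A]
    using H A sym by (simp add: assoc_mult_mat[OF H(1) A H(1)])
  have "B *\<^sub>v unit_vec (Suc n) 0 = e \<cdot>\<^sub>v unit_vec (Suc n) 0"
  proof -
    have "B *\<^sub>v unit_vec (Suc n) 0 = H * A *\<^sub>v (H *\<^sub>v unit_vec (Suc n) 0)"
      unfolding B_def by (rule assoc_mult_mat_vec[OF HA H(1)]) simp
    also have "\<dots> = H *\<^sub>v (A *\<^sub>v v)"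
      unfolding H(4) by (rule assoc_mult_mat_vec[OF H(1) A v(1)])
    also have "\<dots> = e \<cdot>\<^sub>v (H *\<^sub>v (H *\<^sub>v unit_vec (Suc n) 0))"
      unfolding v(3) mult_mat_vec[OF H(1) v(1)] H(4) ..
    also have "H *\<^sub>v (H *\<^sub>v unit_vec (Suc n) 0) = unit_vec (Suc n) 0"
      using assoc_mult_mat_vec[OF H(1) H(1), of "unit_vec (Suc n) 0"] H(3) by simp
    finally show ?thesis .
  qed
  then have col0: "B $$ (i, 0) = (if i = 0 then e else 0)" if "i < Suc n" for i
    using that B by (auto dest!: arg_cong[of _ _ "\<lambda>u. u $ i"])
  have row0: "B $$ (0, i) = (if i = 0 then e else 0)" if "i < Suc n" for i
    using col0[OF that] arg_cong[OF Bsym, of "\<lambda>M. M $$ (i, 0)"] B that by auto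
  define B' where "B' = mat n n (\<lambda>(i,j). B $$ (Suc i, Suc j))"
  have B': "B' \<in> carrier_mat n n" by (simp add: B'_def)
  have B'sym: "B'\<^sup>T = B'"
  proof (rule eq_matI)
    fix i j assume "i < dim_row B'" "j < dim_col B'"
    then show "B'\<^sup>T $$ (i, j) = B' $$ (i, j)"
      using arg_cong[OF Bsym, of "\<lambda>M. M $$ (Suc i, Suc j)"] B by (simp add: B'_def)
  qed (auto simp: B'_def)
  let ?e = "mat 1 1 (\<lambda>_. e)"
  have blk: "B = four_block_mat ?e (0\<^sub>m 1 n) (0\<^sub>m n 1) B'"
    using B col0 row0 by (intro eq_matI) (auto simp: B'_def)
  obtain V where V: "V \<in> carrier_mat n n" "V\<^sup>T * V = 1\<^sub>m n" "diagonal_mat (V\<^sup>T * B' * V)"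
    using Suc.IH[OF B' B'sym] by blast
  define W where "W = four_block_mat (1\<^sub>m 1) (0\<^sub>m 1 n) (0\<^sub>m n 1) V"
  have W: "W \<in> carrier_mat (Suc n) (Suc n)" using V by (auto simp: W_def)
  have WT: "W\<^sup>T = four_block_mat (1\<^sub>m 1) (0\<^sub>m 1 n) (0\<^sub>m n 1) (V\<^sup>T)"
    unfolding W_def by (subst transpose_four_block_mat[of _ 1 1 _ n _ n]) (use V in auto)
  have WTW: "W\<^sup>T * W = 1\<^sub>m (Suc n)"
    unfolding WT unfolding W_def
    by (subst mult_four_block_mat[of _ 1 1 _ n _ n _ _ 1 _ n])
       (use V in \<open>auto intro!: eq_matI\<close>)
  have WBW: "W\<^sup>T * B * W = four_block_mat ?e (0\<^sub>m 1 n) (0\<^sub>m n 1) (V\<^sup>T * B' * V)"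
  proof -
    have "W\<^sup>T * B = four_block_mat ?e (0\<^sub>m 1 n) (0\<^sub>m n 1) (V\<^sup>T * B')"
      unfolding WT blk
      by (subst mult_four_block_mat[of _ 1 1 _ n _ n _ _ 1 _ n]) (use V B' in auto)
    then show ?thesis unfolding W_def
      by (simp, subst mult_four_block_mat[of _ 1 1 _ n _ n _ _ 1 _ n]) (use V B' in auto)
  qed
  define U where "U = H * W"
  have U: "U \<in> carrier_mat (Suc n) (Suc n)" using H W by (simp add: U_def)
  have UT: "U\<^sup>T = W\<^sup>T * H" unfolding U_def transpose_mult[OF H(1) W] H(2) ..
  have WT': "W\<^sup>T \<in> carrier_mat (Suc n) (Suc n)" using W by simp
  have "U\<^sup>T * U = W\<^sup>T * (H * (H * W))"
    by (subst UT, subst U_def, rule assoc_mult_mat[OF WT' H(1)]) (use H W in auto)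
  also have "H * (H * W) = W"
    using assoc_mult_mat[OF H(1) H(1) W] H(3) W by simp
  finally have 1: "U\<^sup>T * U = 1\<^sub>m (Suc n)" using WTW by simp
  have "U\<^sup>T * A * U = W\<^sup>T * B * W"
  proof -
    have "U\<^sup>T * A * U = W\<^sup>T * H * A * (H * W)" unfolding UT by (subst U_def) (rule refl)
    also have "\<dots> = W\<^sup>T * (H * A) * (H * W)" using assoc_mult_mat[OF WT' H(1) A] by simp
    also have "\<dots> = W\<^sup>T * (H * A) * H * W"
      by (rule assoc_mult_mat[symmetric]) (use WT' H W A in auto)
    also have "W\<^sup>T * (H * A) * H = W\<^sup>T * B" unfolding B_def
      by (rule assoc_mult_mat) (use WT' H W A in auto)
    finally show ?thesis .
  qed
  moreover have "diagonal_mat (W\<^sup>T * B * W)"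
    unfolding WBW using V(3,1) B' by (auto simp: diagonal_mat_def)
  ultimately show ?case using U 1 by auto
qed

lemma real_spectral_theorem:
  fixes A :: "real mat"
  assumes A: "A \<in> carrier_mat n n" and sym: "A\<^sup>T = A"
  obtains U d where "U \<in> carrier_mat n n" "U\<^sup>T * U = 1\<^sub>m n" "U * U\<^sup>T = 1\<^sub>m n"
    "A = U * mat_diag n d * U\<^sup>T"
proof -
  obtain U where U: "U \<in> carrier_mat n n" "U\<^sup>T * U = 1\<^sub>m n" "diagonal_mat (U\<^sup>T * A * U)"
    using orthogonal_diagonalization_ex[OF assms] by blast
  have UT: "U\<^sup>T \<in> carrier_mat n n" using U by simp
  have UU: "U * U\<^sup>T = 1\<^sub>m n" by (rule mat_mult_left_right_inverse[OF UT U(1,2)])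
  define D where "D = U\<^sup>T * A * U"
  have D: "D \<in> carrier_mat n n" using U A by (simp add: D_def)
  have "D = mat_diag n (\<lambda>i. D $$ (i,i))"
    using U(3) D unfolding D_def[symmetric] by (auto simp: diagonal_mat_def mat_diag_def)
  moreover have "U * D * U\<^sup>T = A"
  proof -
    have "U * D = U * (U\<^sup>T * (A * U))" unfolding D_def using assoc_mult_mat[OF UT A U(1)] by simp
    also have "\<dots> = U * U\<^sup>T * (A * U)" by (rule assoc_mult_mat[symmetric]) (use U UT A in auto)
    also have "\<dots> = A * U" using UU A U by simp
    finally show ?thesis using assoc_mult_mat[OF A U(1) UT] UU A by simp
  qed
  ultimately show thesis using that[OF U(1,2) UU] by metis
qed

context
  fixes A U :: "real mat" and n :: nat and d :: "nat \<Rightarrow> real"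
  assumes U: "U \<in> carrier_mat n n" "U\<^sup>T * U = 1\<^sub>m n" "U * U\<^sup>T = 1\<^sub>m n"
    and A: "A = U * mat_diag n d * U\<^sup>T"
begin

lemma UT_carrier: "U\<^sup>T \<in> carrier_mat n n" using U by simp

lemma orthogonal_cancel:
  assumes "v \<in> carrier_vec n"
  shows "U *\<^sub>v (U\<^sup>T *\<^sub>v v) = v" "U\<^sup>T *\<^sub>v (U *\<^sub>v v) = v"
  using assoc_mult_mat_vec[OF U(1) UT_carrier assms] assoc_mult_mat_vec[OF UT_carrier U(1) assms]
    assms U(2,3) by simp_all

lemma orthogonal_scalar_prod:
  assumes "v \<in> carrier_vec n" "w \<in> carrier_vec n"
  shows "(U *\<^sub>v v) \<bullet> (U *\<^sub>v w) = v \<bullet> w"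
  using assms U(1) adjoint_scalar_prod[of U n n w "U *\<^sub>v v"] orthogonal_cancel(2)[of v] by simp

lemma spectral_mult_vec:
  assumes v: "v \<in> carrier_vec n"
  shows "A *\<^sub>v v = U *\<^sub>v vec n (\<lambda>j. d j * (U\<^sup>T *\<^sub>v v) $ j)"
proof -
  have D: "mat_diag n d \<in> carrier_mat n n" by simp
  have "mat_diag n d *\<^sub>v w = vec n (\<lambda>j. d j * w $ j)" if w: "w \<in> carrier_vec n" for w
  proof (rule eq_vecI)
    fix i assume "i < dim_vec (vec n (\<lambda>j. d j * w $ j))"
    then have i: "i < n" by simp
    have "(mat_diag n d *\<^sub>v w) $ i = (\<Sum>j = 0..<n. (if i = j then d j else 0) * w $ j)"
      using i w by (simp add: mat_diag_def scalar_prod_def)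
    also have "\<dots> = (\<Sum>j = 0..<n. if i = j then d j * w $ j else 0)" by (intro sum.cong) auto
    finally show "(mat_diag n d *\<^sub>v w) $ i = vec n (\<lambda>j. d j * w $ j) $ i" using i by simp
  qed (auto simp: mat_diag_def)
  then have "mat_diag n d *\<^sub>v (U\<^sup>T *\<^sub>v v) = vec n (\<lambda>j. d j * (U\<^sup>T *\<^sub>v v) $ j)"
    using UT_carrier v by simp
  moreover have "A *\<^sub>v v = U * mat_diag n d *\<^sub>v (U\<^sup>T *\<^sub>v v)"
    unfolding A by (rule assoc_mult_mat_vec[of _ n n, OF _ UT_carrier v]) (use U(1) D in auto)
  moreover have "\<dots> = U *\<^sub>v (mat_diag n d *\<^sub>v (U\<^sup>T *\<^sub>v v))"
    by (rule assoc_mult_mat_vec[OF U(1) D]) (use UT_carrier v in auto)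
  ultimately show ?thesis by simp
qed

lemma spectral_quad_form:
  assumes v: "v \<in> carrier_vec n"
  shows "v \<bullet> (A *\<^sub>v v) = (\<Sum>j<n. d j * ((U\<^sup>T *\<^sub>v v) $ j)\<^sup>2)"
  unfolding spectral_mult_vec[OF v]
  by (subst adjoint_scalar_prod[OF U(1) _ v])
     (auto simp: scalar_prod_def power2_eq_square lessThan_atLeast0 intro!: sum.cong)

lemma spectral_norm:
  assumes v: "v \<in> carrier_vec n"
  shows "v \<bullet> v = (\<Sum>j<n. ((U\<^sup>T *\<^sub>v v) $ j)\<^sup>2)"
proof -
  have "v \<bullet> v = (U\<^sup>T *\<^sub>v v) \<bullet> (U\<^sup>T *\<^sub>v v)"
    using adjoint_scalar_prod[OF U(1) _ v, of "U\<^sup>T *\<^sub>v v"] orthogonal_cancel[OF v] v UT_carrier by simp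
  then show ?thesis
    using U(1) by (simp add: scalar_prod_def power2_eq_square lessThan_atLeast0)
qed

lemma spectral_eigenvector:
  assumes j: "j < n"
  shows "A *\<^sub>v (U *\<^sub>v unit_vec n j) = d j \<cdot>\<^sub>v (U *\<^sub>v unit_vec n j)"
    and "(U *\<^sub>v unit_vec n j) \<bullet> (U *\<^sub>v unit_vec n j) = 1"
proof -
  have "vec n (\<lambda>i. d i * unit_vec n j $ i) = d j \<cdot>\<^sub>v unit_vec n j"
    by (intro eq_vecI) (use j in \<open>auto simp: unit_vec_def\<close>)
  then show "A *\<^sub>v (U *\<^sub>v unit_vec n j) = d j \<cdot>\<^sub>v (U *\<^sub>v unit_vec n j)"
    using spectral_mult_vec[of "U *\<^sub>v unit_vec n j"] orthogonal_cancel(2)[of "unit_vec n j"] U(1)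
    by (simp add: mult_mat_vec[OF U(1)])
  show "(U *\<^sub>v unit_vec n j) \<bullet> (U *\<^sub>v unit_vec n j) = 1"
    using orthogonal_scalar_prod[of "unit_vec n j" "unit_vec n j"] j by simp
qed

end

section \<open>Square roots, inverses and singular values of definite matrices\<close>

lemma psd_matD:
  assumes "psd_mat M" "M \<in> carrier_mat n n"
  shows "M\<^sup>T = M" "v \<in> carrier_vec n \<Longrightarrow> 0 \<le> v \<bullet> (M *\<^sub>v v)"
  using assms by (auto simp: psd_mat_def)

lemma psd_matI:
  assumes "M \<in> carrier_mat n n" "M\<^sup>T = M" "\<And>v. v \<in> carrier_vec n \<Longrightarrow> 0 \<le> v \<bullet> (M *\<^sub>v v)"
  shows "psd_mat M"
  using assms by (auto simp: psd_mat_def)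

lemma pd_matD:
  assumes "pd_mat M" "M \<in> carrier_mat n n"
  shows "psd_mat M" "v \<in> carrier_vec n \<Longrightarrow> v \<noteq> 0\<^sub>v n \<Longrightarrow> 0 < v \<bullet> (M *\<^sub>v v)"
  using assms by (auto simp: pd_mat_def)

lemma mult_mat_zero_vec: "(A :: real mat) \<in> carrier_mat nr nc \<Longrightarrow> A *\<^sub>v 0\<^sub>v nc = 0\<^sub>v nr"
  by (intro eq_vecI) auto

text \<open>All entries of the diagonal form are eigenvalues of unit eigenvectors. Equality of two
  symmetric matrices can thus be tested on the eigenvectors of their difference.\<close>

lemma symmetric_eq_zeroI:
  assumes D: "(D :: real mat) \<in> carrier_mat n n" "D\<^sup>T = D"
    and eig: "\<And>v e. v \<in> carrier_vec n \<Longrightarrow> v \<bullet> v = 1 \<Longrightarrow> D *\<^sub>v v = e \<cdot>\<^sub>v v \<Longrightarrow> e = 0"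
  shows "D = 0\<^sub>m n n"
proof -
  obtain U d where U: "U \<in> carrier_mat n n" "U\<^sup>T * U = 1\<^sub>m n" "U * U\<^sup>T = 1\<^sub>m n"
    "D = U * mat_diag n d * U\<^sup>T"
    using real_spectral_theorem[OF D] by blast
  have d: "d j = 0" if "j < n" for j
    using eig[of "U *\<^sub>v unit_vec n j" "d j"] spectral_eigenvector[OF U that] U(1) by simp
  show ?thesis
  proof (rule mat_eq_mult_vecI[OF D(1)])
    fix v :: "real vec" assume v: "v \<in> carrier_vec n"
    have "vec n (\<lambda>j. d j * (U\<^sup>T *\<^sub>v v) $ j) = 0\<^sub>v n" using d by (intro eq_vecI) auto
    then show "D *\<^sub>v v = 0\<^sub>m n n *\<^sub>v v" using spectral_mult_vec[OF U v] U(1) v by (auto simp: mult_mat_zero_vec intro!: eq_vecI)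
  qed auto
qed

lemma psd_sqrt_ex:
  assumes C: "C \<in> carrier_mat n n" "psd_mat C"
  obtains S where "psd_mat S" "S \<in> carrier_mat n n" "S * S = C"
proof -
  obtain U d where U: "U \<in> carrier_mat n n" "U\<^sup>T * U = 1\<^sub>m n" "U * U\<^sup>T = 1\<^sub>m n"
    "C = U * mat_diag n d * U\<^sup>T"
    using real_spectral_theorem[OF C(1) psd_matD(1)[OF C(2,1)]] by blast
  have d: "0 \<le> d j" if "j < n" for j
    using psd_matD(2)[OF C(2,1), of "U *\<^sub>v unit_vec n j"] spectral_eigenvector[OF U that] U(1) by simp
  define s where "s j = sqrt (d j)" for j
  define S where "S = U * mat_diag n s * U\<^sup>T"
  note U' = U(1-3) S_def
  have S: "S \<in> carrier_mat n n" unfolding S_def using U(1) by (intro mult_carrier_mat[of _ n n]) auto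
  have "S * S = C"
  proof (rule mat_eq_mult_vecI[of _ n n])
    fix v :: "real vec" assume v: "v \<in> carrier_vec n"
    have c: "vec n (\<lambda>j. s j * (U\<^sup>T *\<^sub>v v) $ j) \<in> carrier_vec n" by simp
    have "S * S *\<^sub>v v = S *\<^sub>v (U *\<^sub>v vec n (\<lambda>j. s j * (U\<^sup>T *\<^sub>v v) $ j))"
      using assoc_mult_mat_vec[OF S S v] spectral_mult_vec[OF U' v] by simp
    also have "\<dots> = U *\<^sub>v vec n (\<lambda>j. d j * (U\<^sup>T *\<^sub>v v) $ j)"
      using spectral_mult_vec[OF U', of "U *\<^sub>v vec n (\<lambda>j. s j * (U\<^sup>T *\<^sub>v v) $ j)"]
        orthogonal_cancel(2)[OF U c] U(1)
      by (simp, intro arg_cong[of _ _ "\<lambda>v. U *\<^sub>v v"] eq_vecI) (auto simp: s_def d mult.assoc[symmetric])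
    finally show "S * S *\<^sub>v v = C *\<^sub>v v" using spectral_mult_vec[OF U v] by simp
  qed (use S C in auto)
  moreover have "psd_mat S"
  proof (rule psd_matI[OF S])
    have "(mat_diag n s)\<^sup>T = mat_diag n s" by (rule eq_matI) (auto simp: mat_diag_def)
    then show "S\<^sup>T = S" unfolding S_def
      by (subst transpose_mult[of _ n n _ n], use U(1) in auto,
          subst transpose_mult[of _ n n _ n]) (use U(1) in \<open>auto simp: assoc_mult_mat[of _ n n _ n _ n]\<close>)
    show "0 \<le> v \<bullet> (S *\<^sub>v v)" if "v \<in> carrier_vec n" for v
      unfolding spectral_quad_form[OF U' that] by (intro sum_nonneg) (auto simp: s_def d)
  qed
  ultimately show thesis using that S by blast
qed

text \<open>Let \<open>e\<close> be an eigenvalue of the difference with unit eigenvector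
  \<open>v\<close>. Equal squares give \<open>S *\<^sub>v v\<close> and \<open>K *\<^sub>v v\<close>
  the same norm, so their difference is orthogonal to their sum and \<open>e * (v \<bullet> (S
  *\<^sub>v v) + v \<bullet> (K *\<^sub>v v)) = 0\<close>. If \<open>e\<close> were nonzero, both
  nonnegative forms would vanish, yet \<open>e\<close> is their difference.\<close>

lemma psd_sqrt_unique:
  assumes S: "psd_mat S" "S \<in> carrier_mat n n" and K: "psd_mat K" "K \<in> carrier_mat n n"
    and eq: "S * S = K * K"
  shows "S = K"
proof -
  define D where "D = S - K"
  have D: "D \<in> carrier_mat n n" unfolding D_def by (rule minus_carrier_mat[OF K(2)])
  have Dv: "D *\<^sub>v v = S *\<^sub>v v - K *\<^sub>v v" if "v \<in> carrier_vec n" for v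
    unfolding D_def by (rule minus_mult_distrib_mat_vec[OF S(2) K(2) that])
  have "D\<^sup>T = D" using psd_matD(1)[OF S] psd_matD(1)[OF K] S K
    by (simp add: D_def transpose_minus[OF S(2) K(2)])
  have "D = 0\<^sub>m n n"
  proof (rule symmetric_eq_zeroI[OF D \<open>D\<^sup>T = D\<close>])
    fix v e assume v: "v \<in> carrier_vec n" and vv: "v \<bullet> v = 1" and ev: "D *\<^sub>v v = e \<cdot>\<^sub>v v"
    have Sv: "S *\<^sub>v v \<in> carrier_vec n" and Kv: "K *\<^sub>v v \<in> carrier_vec n" using S K v by auto
    have "(S *\<^sub>v v) \<bullet> (S *\<^sub>v v) = v \<bullet> (S * S *\<^sub>v v)"
      using adjoint_scalar_prod[OF S(2) Sv v] psd_matD(1)[OF S] assoc_mult_mat_vec[OF S(2) S(2) v] by simp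
    moreover have "(K *\<^sub>v v) \<bullet> (K *\<^sub>v v) = v \<bullet> (K * K *\<^sub>v v)"
      using adjoint_scalar_prod[OF K(2) Kv v] psd_matD(1)[OF K] assoc_mult_mat_vec[OF K(2) K(2) v] by simp
    ultimately have "(S *\<^sub>v v) \<bullet> (S *\<^sub>v v) = (K *\<^sub>v v) \<bullet> (K *\<^sub>v v)" using eq by simp
    then have "(D *\<^sub>v v) \<bullet> (S *\<^sub>v v + K *\<^sub>v v) = 0"
      unfolding Dv[OF v] using S(2) K(2) v comm_scalar_prod[OF Sv Kv]
      by (simp add: scalar_prod_dim_simps)
    then have "e * (v \<bullet> (S *\<^sub>v v) + v \<bullet> (K *\<^sub>v v)) = 0"
      unfolding ev distrib_left using v S(2) K(2) by (simp add: scalar_prod_dim_simps del: mult_eq_0_iff)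
    moreover have "v \<bullet> (S *\<^sub>v v) - v \<bullet> (K *\<^sub>v v) = e"
    proof -
      have "v \<bullet> (D *\<^sub>v v) = e" unfolding ev using v vv by simp
      then show ?thesis unfolding Dv[OF v] using v S(2) K(2) by (simp add: scalar_prod_dim_simps)
    qed
    ultimately show "e = 0" using psd_matD(2)[OF S v] psd_matD(2)[OF K v] by auto
  qed
  have "S = D + K" unfolding D_def using S(2) K(2) by (intro eq_matI) auto
  then show ?thesis using \<open>D = 0\<^sub>m n n\<close> K by simp
qed

lemma psd_sqrt_props:
  assumes C: "C \<in> carrier_mat n n" "psd_mat C"
  shows "psd_mat (psd_sqrt C)" "psd_sqrt C \<in> carrier_mat n n" "psd_sqrt C * psd_sqrt C = C"
proof -
  obtain S where S: "psd_mat S" "S \<in> carrier_mat n n" "S * S = C" using psd_sqrt_ex[OF C] by blast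
  have "psd_sqrt C = S" unfolding psd_sqrt_def
  proof (rule the_equality)
    fix K assume "psd_mat K \<and> dim_row K = dim_row C \<and> K * K = C"
    then show "K = S"
      by (intro psd_sqrt_unique[OF _ _ S(1,2)]) (use C S in \<open>auto simp: psd_mat_def intro: carrier_matI\<close>)
  qed (use S C in auto)
  then show "psd_mat (psd_sqrt C)" "psd_sqrt C \<in> carrier_mat n n" "psd_sqrt C * psd_sqrt C = C"
    using S by auto
qed

lemma minv_props:
  assumes A: "A \<in> carrier_mat n n" and inj: "\<And>v. v \<in> carrier_vec n \<Longrightarrow> A *\<^sub>v v = 0\<^sub>v n \<Longrightarrow> v = 0\<^sub>v n"
  shows "minv A \<in> carrier_mat n n" "A * minv A = 1\<^sub>m n" "minv A * A = 1\<^sub>m n"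
proof -
  have "det A \<noteq> 0" using det_0_iff_vec_prod_zero_field[OF A] inj by blast
  from det_non_zero_imp_unit[OF A this, of "()"]
  obtain B where B: "B \<in> carrier_mat n n" "A * B = 1\<^sub>m n" "B * A = 1\<^sub>m n"
    by (auto simp: Units_def ring_mat_def)
  have "minv A = B" unfolding minv_def
  proof (rule the_equality)
    fix B' assume *: "B' \<in> carrier_mat (dim_row A) (dim_row A) \<and> A * B' = 1\<^sub>m (dim_row A) \<and> B' * A = 1\<^sub>m (dim_row A)"
    then have B': "B' \<in> carrier_mat n n" using A by auto
    have "B' = B' * (A * B)" using B B' by simp
    also have "\<dots> = B' * A * B" by (rule assoc_mult_mat[symmetric, OF B' A B(1)])
    finally show "B' = B" using * A B by simp
  qed (use A B in auto)
  then show "minv A \<in> carrier_mat n n" "A * minv A = 1\<^sub>m n" "minv A * A = 1\<^sub>m n" using B by auto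
qed

lemma pd_minv_props:
  assumes A: "A \<in> carrier_mat n n" "pd_mat A"
  shows "minv A \<in> carrier_mat n n" "A * minv A = 1\<^sub>m n" "minv A * A = 1\<^sub>m n"
proof -
  have "v = 0\<^sub>v n" if "v \<in> carrier_vec n" "A *\<^sub>v v = 0\<^sub>v n" for v
    using pd_matD(2)[OF A(2,1), of v] that by force
  from minv_props[OF A(1) this]
  show "minv A \<in> carrier_mat n n" "A * minv A = 1\<^sub>m n" "minv A * A = 1\<^sub>m n" by auto
qed

text \<open>For a positive definite matrix the entries of its diagonal form are singular values, so
  the extreme singular values bound the quadratic form in eigen-coordinates. \<open>0 < n\<close>
  makes the finite set of singular values nonempty, so that \<open>Min\<close> and
  \<open>Max\<close> are attained.\<close>

lemma pd_sing_vals: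
  assumes A: "A \<in> carrier_mat n n" "pd_mat A" and n: "0 < n"
  shows "0 < sigma_min A" "0 < sigma_max A"
    and "v \<in> carrier_vec n \<Longrightarrow> sigma_min A * (v \<bullet> v) \<le> v \<bullet> (A *\<^sub>v v)"
    and "v \<in> carrier_vec n \<Longrightarrow> v \<bullet> (A *\<^sub>v v) \<le> sigma_max A * (v \<bullet> v)"
proof -
  note sym = psd_matD(1)[OF pd_matD(1)[OF A(2,1)] A(1)]
  have AA: "A\<^sup>T * A \<in> carrier_mat n n" using A by simp
  have AAv: "A\<^sup>T * A *\<^sub>v v = A *\<^sub>v (A *\<^sub>v v)" if "v \<in> carrier_vec n" for v
    using assoc_mult_mat_vec[OF A(1) A(1) that] sym by simp
  have fin: "finite (sing_vals A)"
    unfolding sing_vals_def using card_finite_spectrum(1)[OF AA] by (simp add: spectrum_def)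
  have pos: "0 < s" if "s \<in> sing_vals A" for s
  proof -
    obtain e where s: "s = sqrt e" and e: "eigenvalue (A\<^sup>T * A) e"
      using \<open>s \<in> sing_vals A\<close> unfolding sing_vals_def by auto
    obtain v where v: "v \<in> carrier_vec n" "v \<noteq> 0\<^sub>v n" "A\<^sup>T * A *\<^sub>v v = e \<cdot>\<^sub>v v"
      using e AA unfolding eigenvalue_def eigenvector_def by auto
    note v = v(1,2) v(3)[unfolded AAv[OF v(1)]]
    have Av: "A *\<^sub>v v \<in> carrier_vec n" using A v by simp
    have "A *\<^sub>v v \<noteq> 0\<^sub>v n" using pd_matD(2)[OF A(2,1) v(1,2)] v by auto
    then have "0 < (A *\<^sub>v v) \<bullet> (A *\<^sub>v v)" by (rule scalar_prod_self_pos[OF Av])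
    also have "\<dots> = v \<bullet> (A *\<^sub>v (A *\<^sub>v v))" using adjoint_scalar_prod[OF A(1) Av v(1)] sym by simp
    also have "\<dots> = e * (v \<bullet> v)" using v by simp
    finally show ?thesis using scalar_prod_self_ge_0[of v] s by (simp add: zero_less_mult_iff)
  qed
  obtain U d where U: "U \<in> carrier_mat n n" "U\<^sup>T * U = 1\<^sub>m n" "U * U\<^sup>T = 1\<^sub>m n"
    "A = U * mat_diag n d * U\<^sup>T"
    using real_spectral_theorem[OF A(1) sym] by blast
  \<comment> \<open>By symmetry \<open>A\<^sup>T * A\<close> is the square of \<open>A\<close> and
    has the same eigenvector with eigenvalue \<open>(d j)\<^sup>2\<close>; positivity of
    \<open>d j\<close> makes it the root of that square.\<close>
  have mem: "d j \<in> sing_vals A" if j: "j < n" for j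
  proof -
    let ?u = "U *\<^sub>v unit_vec n j"
    note ev = spectral_eigenvector[OF U j]
    have u: "?u \<in> carrier_vec n" using U(1) by simp
    have u0: "?u \<noteq> 0\<^sub>v n" using ev(2) scalar_prod_self_eq_0_iff[OF u] by simp
    have "0 < d j" using pd_matD(2)[OF A(2,1) u u0] ev u by simp
    moreover have "A *\<^sub>v (A *\<^sub>v ?u) = (d j)\<^sup>2 \<cdot>\<^sub>v ?u"
      unfolding ev(1) mult_mat_vec[OF A(1) u] by (simp add: smult_smult_assoc power2_eq_square)
    then have "eigenvalue (A\<^sup>T * A) ((d j)\<^sup>2)"
      unfolding eigenvalue_def eigenvector_def using u u0 AAv[OF u] A(1) by auto
    ultimately show ?thesis unfolding sing_vals_def by (intro image_eqI[of _ _ "(d j)\<^sup>2"]) auto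
  qed
  then have ne: "sing_vals A \<noteq> {}" using n by blast
  show "0 < sigma_min A" "0 < sigma_max A"
    unfolding sigma_min_def sigma_max_def using fin ne pos by auto
  have bounds: "sigma_min A \<le> d j" "d j \<le> sigma_max A" if "j < n" for j
    unfolding sigma_min_def sigma_max_def using fin mem[OF that] by auto
  show "sigma_min A * (v \<bullet> v) \<le> v \<bullet> (A *\<^sub>v v)" "v \<bullet> (A *\<^sub>v v) \<le> sigma_max A * (v \<bullet> v)"
    if v: "v \<in> carrier_vec n"
    unfolding spectral_quad_form[OF U v] spectral_norm[OF U v] sum_distrib_left
    by (intro sum_mono mult_right_mono bounds; simp)+
qed

section \<open>Block diagonal matrices\<close>

lemma wblk_carrier [simp]: "wblk k w i \<in> carrier_vec k" "dim_vec (wblk k w i) = k"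
  by (auto simp: wblk_def)

lemma wblk_index [simp]: "r < k \<Longrightarrow> wblk k w i $ r = w $ (i * k + r)"
  by (simp add: wblk_def)

lemma block_index_less: "i < N \<Longrightarrow> r < k \<Longrightarrow> i * k + r < k * (N :: nat)"
proof -
  assume "i < N" "r < k"
  then have "i * k + r < Suc i * k" by simp
  also have "\<dots> \<le> N * k" using \<open>i < N\<close> by (intro mult_le_mono1) simp
  finally show ?thesis by (simp add: mult.commute)
qed

lemma sum_blocks:
  fixes f :: "nat \<Rightarrow> 'a :: comm_monoid_add"
  shows "(\<Sum>j = 0..<k * N. f j) = (\<Sum>i<N. \<Sum>r<k. f (i * k + r))"
proof -
  have "(\<Sum>j = 0..<k * N. f j) = (\<Sum>i<N. sum f {i * k..<i * k + k})"
    using sum.nat_group[of f k N] by (simp add: lessThan_atLeast0 mult.commute)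
  also have "\<dots> = (\<Sum>i<N. \<Sum>r<k. f (i * k + r))"
  proof (rule sum.cong[OF refl])
    show "sum f {i * k..<i * k + k} = (\<Sum>r<k. f (i * k + r))" for i
      using sum.shift_bounds_nat_ivl[of f 0 "i * k" k] by (simp add: lessThan_atLeast0 add.commute)
  qed
  finally show ?thesis .
qed

lemma scalar_prod_wblk:
  fixes v w :: "real vec"
  assumes "v \<in> carrier_vec (k * N)" "w \<in> carrier_vec (k * N)"
  shows "v \<bullet> w = (\<Sum>i<N. wblk k v i \<bullet> wblk k w i)"
  using assms by (simp add: scalar_prod_def sum_blocks) (simp add: lessThan_atLeast0)

lemma wblk_eqI:
  assumes "v \<in> carrier_vec (k * N)" "w \<in> carrier_vec (k * N)"
    and eq: "\<And>i. i < N \<Longrightarrow> wblk k v i = wblk k w i"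
  shows "v = w"
proof (rule eq_vecI)
  fix j assume "j < dim_vec w"
  then have j: "j < N * k" using assms by (simp add: mult.commute)
  then have k: "0 < k" by (cases k) auto
  have "j div k < N" using j by (simp add: less_mult_imp_div_less)
  from arg_cong[OF eq[OF this], of "\<lambda>u. u $ (j mod k)"] k show "v $ j = w $ j" by simp
qed (use assms in auto)

lemma diag_block_mat_uniform:
  assumes "\<forall>M\<in>set Ms. M \<in> carrier_mat k l"
  shows "diag_block_mat Ms \<in> carrier_mat (k * length Ms) (l * length Ms)"
  using assms by (induction Ms) (auto simp: Let_def)

lemma diag_block_mat_index:
  fixes Ms :: "real mat list"
  assumes "\<forall>M\<in>set Ms. M \<in> carrier_mat k l" "i < k * length Ms" "j < l * length Ms"
  shows "diag_block_mat Ms $$ (i, j) =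
    (if i div k = j div l then (Ms ! (i div k)) $$ (i mod k, j mod l) else 0)"
  using assms
proof (induction Ms arbitrary: i j)
  case Nil
  then show ?case by simp
next
  case (Cons M Ms)
  have M: "M \<in> carrier_mat k l" and Ms: "\<forall>M\<in>set Ms. M \<in> carrier_mat k l" using Cons.prems by auto
  note D = diag_block_mat_uniform[OF Ms]
  have kl: "0 < k" "0 < l" using Cons.prems by (auto intro: gr0I)
  have dv: "i div k = Suc ((i - k) div k)" "i mod k = (i - k) mod k" if "\<not> i < k"
    using that kl by (simp_all add: le_div_geq le_mod_geq)
  have dw: "j div l = Suc ((j - l) div l)" "j mod l = (j - l) mod l" if "\<not> j < l"
    using that kl by (simp_all add: le_div_geq le_mod_geq)
  have i: "i < k + k * length Ms" and j: "j < l + l * length Ms" using Cons.prems by auto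
  have *: "diag_block_mat (M # Ms) $$ (i, j) =
     (if i < k then if j < l then M $$ (i, j) else 0
      else if j < l then 0 else diag_block_mat Ms $$ (i - k, j - l))"
    using M D i j by (auto simp: Let_def)
  show ?case
  proof (cases "i < k")
    case True
    then show ?thesis unfolding * using dw by (cases "j < l") auto
  next
    case False
    show ?thesis
    proof (cases "j < l")
      case True
      then show ?thesis unfolding * using False dv by simp
    next
      case False': False
      have "diag_block_mat Ms $$ (i - k, j - l) = (if (i - k) div k = (j - l) div l
          then (Ms ! ((i - k) div k)) $$ ((i - k) mod k, (j - l) mod l) else 0)"
        by (rule Cons.IH[OF Ms]) (use False False' i j in auto)
      then show ?thesis unfolding * using False False' dv dw by simp
    qed
  qed
qed

text \<open>Once the sum over the columns is regrouped by blocks, only the diagonal block survives.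
  Symmetry and definiteness of the stacked matrices reduce to those of the blocks through this
  rule.\<close>

lemma wblk_diag_block_mat:
  fixes Ms :: "real mat list"
  assumes Ms: "\<forall>M\<in>set Ms. M \<in> carrier_mat k l" and w: "w \<in> carrier_vec (l * length Ms)"
    and i: "i < length Ms"
  shows "wblk k (diag_block_mat Ms *\<^sub>v w) i = (Ms ! i) *\<^sub>v wblk l w i"
proof (rule eq_vecI)
  note D = diag_block_mat_uniform[OF Ms]
  have Mi: "Ms ! i \<in> carrier_mat k l" using Ms i by auto
  fix r assume "r < dim_vec ((Ms ! i) *\<^sub>v wblk l w i)"
  then have r: "r < k" using Mi by simp
  have ir: "i * k + r < k * length Ms" by (rule block_index_less[OF i r])
  have "wblk k (diag_block_mat Ms *\<^sub>v w) i $ r = (\<Sum>j = 0..<l * length Ms. diag_block_mat Ms $$ (i * k + r, j) * w $ j)"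
    using r ir D w by (simp add: scalar_prod_def)
  also have "\<dots> = (\<Sum>b<length Ms. \<Sum>s<l. diag_block_mat Ms $$ (i * k + r, b * l + s) * w $ (b * l + s))"
    by (rule sum_blocks)
  also have "\<dots> = (\<Sum>b<length Ms. if i = b then \<Sum>s<l. (Ms ! i) $$ (r, s) * w $ (i * l + s) else 0)"
    using r ir by (intro sum.cong refl)
      (auto simp: diag_block_mat_index[OF Ms] block_index_less)
  also have "\<dots> = (\<Sum>s<l. (Ms ! i) $$ (r, s) * w $ (i * l + s))" using i by simp
  also have "\<dots> = ((Ms ! i) *\<^sub>v wblk l w i) $ r"
    using r Mi by (simp add: scalar_prod_def lessThan_atLeast0)
  finally show "wblk k (diag_block_mat Ms *\<^sub>v w) i $ r = ((Ms ! i) *\<^sub>v wblk l w i) $ r" .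
qed (use Ms i in auto)

lemma bilinear_form_diag_block_mat:
  fixes Ms :: "real mat list"
  assumes Ms: "\<forall>M\<in>set Ms. M \<in> carrier_mat k k"
    and v: "v \<in> carrier_vec (k * length Ms)" and w: "w \<in> carrier_vec (k * length Ms)"
  shows "w \<bullet> (diag_block_mat Ms *\<^sub>v v) = (\<Sum>i<length Ms. wblk k w i \<bullet> ((Ms ! i) *\<^sub>v wblk k v i))"
  using scalar_prod_wblk[OF w, of "diag_block_mat Ms *\<^sub>v v"] diag_block_mat_uniform[OF Ms] v
  by (simp add: wblk_diag_block_mat[OF Ms v])

lemma psd_diag_block_mat:
  assumes Ms: "\<forall>M\<in>set Ms. M \<in> carrier_mat k k \<and> psd_mat M"
  shows "psd_mat (diag_block_mat Ms)"
proof (rule psd_matI)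
  have c: "\<forall>M\<in>set Ms. M \<in> carrier_mat k k" using Ms by auto
  show D: "diag_block_mat Ms \<in> carrier_mat (k * length Ms) (k * length Ms)"
    by (rule diag_block_mat_uniform[OF c])
  show "(diag_block_mat Ms)\<^sup>T = diag_block_mat Ms"
  proof (rule symmetricI_scalar_prod[OF D])
    fix x y :: "real vec"
    assume xy: "x \<in> carrier_vec (k * length Ms)" "y \<in> carrier_vec (k * length Ms)"
    show "y \<bullet> (diag_block_mat Ms *\<^sub>v x) = x \<bullet> (diag_block_mat Ms *\<^sub>v y)"
      unfolding bilinear_form_diag_block_mat[OF c xy] bilinear_form_diag_block_mat[OF c xy(2,1)]
      using Ms by (intro sum.cong refl symmetric_scalar_prod[of _ k] psd_matD(1)[of _ k]) auto
  qed
  show "0 \<le> v \<bullet> (diag_block_mat Ms *\<^sub>v v)" if v: "v \<in> carrier_vec (k * length Ms)" for v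
    unfolding bilinear_form_diag_block_mat[OF c v v]
    using Ms by (intro sum_nonneg psd_matD(2)[of _ k]) auto
qed

lemma pd_diag_block_mat:
  assumes Ms: "\<forall>M\<in>set Ms. M \<in> carrier_mat k k \<and> pd_mat M"
  shows "pd_mat (diag_block_mat Ms)"
proof -
  have c: "\<forall>M\<in>set Ms. M \<in> carrier_mat k k" using Ms by auto
  have psd: "\<forall>M\<in>set Ms. M \<in> carrier_mat k k \<and> psd_mat M" using Ms pd_matD(1) by auto
  note D = diag_block_mat_uniform[OF c]
  have "0 < v \<bullet> (diag_block_mat Ms *\<^sub>v v)"
    if v: "v \<in> carrier_vec (k * length Ms)" "v \<noteq> 0\<^sub>v (k * length Ms)" for v
  proof -
    have "\<exists>i<length Ms. wblk k v i \<noteq> 0\<^sub>v k"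
    proof (rule ccontr)
      assume *: "\<not> ?thesis"
      have "v = 0\<^sub>v (k * length Ms)"
      proof (rule wblk_eqI[OF v(1)])
        fix i assume i: "i < length Ms"
        have "wblk k v i = 0\<^sub>v k" using * i by blast
        also have "\<dots> = wblk k (0\<^sub>v (k * length Ms)) i"
          by (intro eq_vecI) (auto simp: block_index_less[OF i])
        finally show "wblk k v i = wblk k (0\<^sub>v (k * length Ms)) i" .
      qed simp
      then show False using v(2) by simp
    qed
    then obtain i where i: "i < length Ms" "wblk k v i \<noteq> 0\<^sub>v k" by blast
    show ?thesis unfolding bilinear_form_diag_block_mat[OF c v(1) v(1)]
    proof (rule sum_pos2[OF _ _ _ psd_matD(2)[of _ k]])
      show "0 < wblk k v i \<bullet> ((Ms ! i) *\<^sub>v wblk k v i)"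
        by (rule pd_matD(2)[of _ k]) (use Ms i in auto)
    qed (use i psd in auto)
  qed
  then show ?thesis using psd_diag_block_mat[OF psd] D by (auto simp: pd_mat_def)
qed

section \<open>The stacked dynamics and the optimal non-causal cost\<close>

lemma hcat_carrier [simp]:
  "X \<in> carrier_mat r c1 \<Longrightarrow> Y \<in> carrier_mat r c2 \<Longrightarrow> hcat X Y \<in> carrier_mat r (c1 + c2)"
  by (auto simp: hcat_def)

lemma vcat_carrier [simp]:
  "X \<in> carrier_mat r1 c \<Longrightarrow> Y \<in> carrier_mat r2 c \<Longrightarrow> vcat X Y \<in> carrier_mat (r1 + r2) c"
  by (auto simp: vcat_def)

lemma hcat_vcat_dims [simp]:
  "dim_row (hcat X Y) = dim_row X" "dim_col (hcat X Y) = dim_col X + dim_col Y"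
  "dim_row (vcat X Y) = dim_row X + dim_row Y" "dim_col (vcat X Y) = dim_col X"
  by (auto simp: hcat_def vcat_def)

lemma hcat_mult_vec:
  assumes X: "X \<in> carrier_mat r c1" and Y: "Y \<in> carrier_mat r c2"
    and a: "a \<in> carrier_vec c1" and b: "b \<in> carrier_vec c2"
  shows "hcat X Y *\<^sub>v (a @\<^sub>v b) = X *\<^sub>v a + Y *\<^sub>v b"
proof (rule eq_vecI)
  fix i assume "i < dim_vec (X *\<^sub>v a + Y *\<^sub>v b)"
  then have i: "i < r" using Y by simp
  have "row (hcat X Y) i = row X i @\<^sub>v row Y i"
    using i X Y by (intro eq_vecI) (auto simp: hcat_def)
  then show "(hcat X Y *\<^sub>v (a @\<^sub>v b)) $ i = (X *\<^sub>v a + Y *\<^sub>v b) $ i"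
    using i X Y a b by (simp add: scalar_prod_append[of _ c1 _ c2])
qed (use X Y in auto)

lemma vcat_mult_vec:
  assumes X: "X \<in> carrier_mat r1 c" and Y: "Y \<in> carrier_mat r2 c" and a: "a \<in> carrier_vec c"
  shows "vcat X Y *\<^sub>v a = (X *\<^sub>v a) @\<^sub>v (Y *\<^sub>v a)"
proof (rule eq_vecI)
  fix i assume i: "i < dim_vec ((X *\<^sub>v a) @\<^sub>v (Y *\<^sub>v a))"
  have "row (vcat X Y) i = (if i < r1 then row X i else row Y (i - r1))"
    using i X Y by (intro eq_vecI) (auto simp: vcat_def)
  then show "(vcat X Y *\<^sub>v a) $ i = ((X *\<^sub>v a) @\<^sub>v (Y *\<^sub>v a)) $ i"
    using i X Y a by auto
qed (use X Y in auto)

section \<open>Solving the stacked dynamics for the state\<close>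

locale ltv_system =
  fixes n m p T :: nat and A B E :: "nat \<Rightarrow> real mat"
  assumes A: "\<And>k. k \<le> T \<Longrightarrow> A k \<in> carrier_mat n n"
    and B: "\<And>k. k \<le> T \<Longrightarrow> B k \<in> carrier_mat n m"
    and E: "\<And>k. k < T \<Longrightarrow> E k \<in> carrier_mat n p"
begin

lemma calA_carrier: "calA T A \<in> carrier_mat (n * Suc T) (n * Suc T)"
  using diag_block_mat_uniform[of "map A [0..<Suc T]" n n] A by (auto simp: calA_def less_Suc_eq_le)

lemma calB_carrier: "calB T B \<in> carrier_mat (n * Suc T) (m * Suc T)"
  using diag_block_mat_uniform[of "map B [0..<Suc T]" n m] B by (auto simp: calB_def less_Suc_eq_le)

lemma calE_carrier: "calE n T E \<in> carrier_mat (n * Suc T) (n + p * T)"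
proof -
  have "diag_block_mat (map E [0..<T]) \<in> carrier_mat (n * T) (p * T)"
    using diag_block_mat_uniform[of "map E [0..<T]" n p] E by auto
  then show ?thesis by (auto simp: calE_def Let_def)
qed

lemma calZ_carrier: "calZ n T \<in> carrier_mat (n * Suc T) (n * Suc T)"
  by (simp add: calZ_def)

text \<open>The part of \<open>sls_mat\<close> that acts on the state. Inverting it solves the
  recursion for the state in terms of input and disturbance.\<close>

definition dyn :: "real mat" where
  "dyn = 1\<^sub>m (n * Suc T) - calZ n T * calA T A"

lemma dyn_carrier: "dyn \<in> carrier_mat (n * Suc T) (n * Suc T)"
  unfolding dyn_def
  by (rule minus_carrier_mat) (rule mult_carrier_mat[OF calZ_carrier calA_carrier])

text \<open>The shift takes row \<open>i\<close> of the product from row \<open>i - n\<close> of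
  \<open>calA\<close>, one block higher. As \<open>calA\<close> is block diagonal, nonzero entries
  occur only strictly below the block diagonal.\<close>

lemma ZA_index:
  assumes ij: "i < n * Suc T" "j < n * Suc T" "i \<le> j"
  shows "(calZ n T * calA T A) $$ (i, j) = 0"
proof -
  have n: "0 < n" using ij by (cases n) auto
  have "calZ n T $$ (i, c) * calA T A $$ (c, j) = 0" if c: "c < n * Suc T" for c
  proof (cases "i = c + n")
    case True
    have "c div n \<noteq> j div n"
    proof -
      have "Suc (c div n) = i div n" using True n by simp
      also have "\<dots> \<le> j div n" using ij(3) by (rule div_le_mono)
      finally show ?thesis by simp
    qed
    then have "calA T A $$ (c, j) = 0" unfolding calA_def
      by (subst diag_block_mat_index[of _ n n]) (use A c ij in \<open>auto simp: less_Suc_eq_le\<close>)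
    then show ?thesis by simp
  qed (use c ij in \<open>simp add: calZ_def\<close>)
  then have "(\<Sum>c = 0..<n * Suc T. calZ n T $$ (i, c) * calA T A $$ (c, j)) = 0"
    by (intro sum.neutral) auto
  then show ?thesis using ij calZ_carrier calA_carrier by (simp add: scalar_prod_def)
qed

text \<open>The matrix is lower triangular with unit diagonal, so its determinant is 1.\<close>

lemma dyn_inverse:
  obtains L where "L \<in> carrier_mat (n * Suc T) (n * Suc T)"
    "dyn * L = 1\<^sub>m (n * Suc T)" "L * dyn = 1\<^sub>m (n * Suc T)"
proof -
  have ZA: "calZ n T * calA T A \<in> carrier_mat (n * Suc T) (n * Suc T)"
    by (rule mult_carrier_mat[OF calZ_carrier calA_carrier])
  have idx: "dyn $$ (i, j) = (if i = j then 1 else 0)"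
    if "i < n * Suc T" "j < n * Suc T" "i \<le> j" for i j
    using that ZA ZA_index[OF that] unfolding dyn_def by (subst index_minus_mat) auto
  have "det dyn = prod_list (diag_mat dyn)"
    by (rule det_lower_triangular[OF _ dyn_carrier]) (simp add: idx)
  also have "\<dots> = 1"
    unfolding prod_list_diag_prod using dyn_carrier by (intro prod.neutral) (auto simp: idx)
  finally have "det dyn \<noteq> 0" by simp
  from det_non_zero_imp_unit[OF dyn_carrier this, of "()"] that show thesis
    by (auto simp: Units_def ring_mat_def)
qed

lemma ZB_carrier: "calZ n T * calB T B \<in> carrier_mat (n * Suc T) (m * Suc T)"
  by (rule mult_carrier_mat[OF calZ_carrier calB_carrier])

lemma sls_mat_carrier: "sls_mat n T A B \<in> carrier_mat (n * Suc T) ((n + m) * Suc T)"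
  using hcat_carrier[OF dyn_carrier smult_carrier_mat[OF ZB_carrier, of "-1"]]
  unfolding sls_mat_def dyn_def distrib_right .

lemma is_traj_iff:
  assumes x: "x \<in> carrier_vec (n * Suc T)" and u: "u \<in> carrier_vec (m * Suc T)"
    and d: "\<delta> \<in> carrier_vec (n + p * T)"
  shows "is_traj n T A B E x u \<delta> \<longleftrightarrow>
    dyn *\<^sub>v x = (calZ n T * calB T B) *\<^sub>v u + calE n T E *\<^sub>v \<delta>"
proof -
  let ?ZB = "calZ n T * calB T B"
  have c: "dyn *\<^sub>v x \<in> carrier_vec (n * Suc T)" "?ZB *\<^sub>v u \<in> carrier_vec (n * Suc T)"
    "calE n T E *\<^sub>v \<delta> \<in> carrier_vec (n * Suc T)"
    using mult_mat_vec_carrier[OF dyn_carrier x] mult_mat_vec_carrier[OF ZB_carrier u]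
      mult_mat_vec_carrier[OF calE_carrier d] .
  have neg: "((-1) \<cdot>\<^sub>m ?ZB) *\<^sub>v u = - (?ZB *\<^sub>v u)"
    using ZB_carrier u by (intro eq_vecI) auto
  have "sls_mat n T A B *\<^sub>v (x @\<^sub>v u) = dyn *\<^sub>v x + - (?ZB *\<^sub>v u)"
    unfolding sls_mat_def dyn_def[symmetric] neg[symmetric]
    by (rule hcat_mult_vec[OF dyn_carrier smult_carrier_mat[OF ZB_carrier] x u])
  moreover have "a + - b = e \<longleftrightarrow> a = b + e"
    if "a \<in> carrier_vec k" "b \<in> carrier_vec k" "e \<in> carrier_vec k" for a b e :: "real vec" and k
    using that by (auto simp: vec_eq_iff)
  ultimately show ?thesis unfolding is_traj_def using c by simp
qed

text \<open>The witnesses are the input and disturbance matrices multiplied by the inverse of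
  \<open>dyn\<close>. The equivalence is stronger than the implication in the definition of
  \<open>FG\<close>: its converse direction also produces trajectories, as the existence of an
  achievable response requires.\<close>

lemma FG_props:
  defines "F \<equiv> fst (FG n m p T A B E)" and "G \<equiv> snd (FG n m p T A B E)"
  shows "F \<in> carrier_mat (n * Suc T) (m * Suc T)" (is ?F)
    and "G \<in> carrier_mat (n * Suc T) (n + p * T)" (is ?G)
    and "\<And>x u \<delta>. x \<in> carrier_vec (n * Suc T) \<Longrightarrow> u \<in> carrier_vec (m * Suc T) \<Longrightarrow>
      \<delta> \<in> carrier_vec (n + p * T) \<Longrightarrow> is_traj n T A B E x u \<delta> \<longleftrightarrow> x = F *\<^sub>v u + G *\<^sub>v \<delta>"
proof -
  let ?ZB = "calZ n T * calB T B" and ?E = "calE n T E"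
  obtain L where L: "L \<in> carrier_mat (n * Suc T) (n * Suc T)"
    "dyn * L = 1\<^sub>m (n * Suc T)" "L * dyn = 1\<^sub>m (n * Suc T)" by (rule dyn_inverse)
  define F0 where "F0 = L * ?ZB"
  define G0 where "G0 = L * ?E"
  have F0: "F0 \<in> carrier_mat (n * Suc T) (m * Suc T)"
    unfolding F0_def by (rule mult_carrier_mat[OF L(1) ZB_carrier])
  have G0: "G0 \<in> carrier_mat (n * Suc T) (n + p * T)"
    unfolding G0_def by (rule mult_carrier_mat[OF L(1) calE_carrier])
  have tr: "is_traj n T A B E x u \<delta> \<longleftrightarrow> x = F0 *\<^sub>v u + G0 *\<^sub>v \<delta>"
    if x: "x \<in> carrier_vec (n * Suc T)" and u: "u \<in> carrier_vec (m * Suc T)"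
      and d: "\<delta> \<in> carrier_vec (n + p * T)" for x u \<delta>
  proof -
    let ?r = "?ZB *\<^sub>v u + ?E *\<^sub>v \<delta>"
    have cu: "?ZB *\<^sub>v u \<in> carrier_vec (n * Suc T)" by (rule mult_mat_vec_carrier[OF ZB_carrier u])
    have cd: "?E *\<^sub>v \<delta> \<in> carrier_vec (n * Suc T)" by (rule mult_mat_vec_carrier[OF calE_carrier d])
    have r: "?r \<in> carrier_vec (n * Suc T)" using cu cd by simp
    have "F0 *\<^sub>v u + G0 *\<^sub>v \<delta> = L *\<^sub>v (?ZB *\<^sub>v u) + L *\<^sub>v (?E *\<^sub>v \<delta>)"
      unfolding F0_def G0_def assoc_mult_mat_vec[OF L(1) ZB_carrier u]
        assoc_mult_mat_vec[OF L(1) calE_carrier d] ..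
    also have "\<dots> = L *\<^sub>v ?r" by (rule mult_add_distrib_mat_vec[symmetric, OF L(1) cu cd])
    finally have FG: "F0 *\<^sub>v u + G0 *\<^sub>v \<delta> = L *\<^sub>v ?r" .
    have "dyn *\<^sub>v x = ?r \<longleftrightarrow> x = L *\<^sub>v ?r"
    proof
      assume "dyn *\<^sub>v x = ?r"
      then show "x = L *\<^sub>v ?r"
        using assoc_mult_mat_vec[OF L(1) dyn_carrier x] L(3) x by simp
    next
      assume "x = L *\<^sub>v ?r"
      then show "dyn *\<^sub>v x = ?r"
        using assoc_mult_mat_vec[OF dyn_carrier L(1) r] L(2) r by simp
    qed
    then show ?thesis unfolding is_traj_iff[OF that] FG .
  qed
  have "FG n m p T A B E = (F0, G0)" unfolding FG_def
  proof (rule the_equality, safe)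
    fix x u \<delta> :: "real vec"
    assume "x \<in> carrier_vec (n * Suc T)" "u \<in> carrier_vec (m * Suc T)"
      "\<delta> \<in> carrier_vec (n + p * T)" "is_traj n T A B E x u \<delta>"
    then show "x = F0 *\<^sub>v u + G0 *\<^sub>v \<delta>" using tr by blast
  next
    fix F1 G1 :: "real mat"
    assume F1: "F1 \<in> carrier_mat (n * Suc T) (m * Suc T)" and G1: "G1 \<in> carrier_mat (n * Suc T) (n + p * T)"
      and *: "\<forall>x u \<delta>. x \<in> carrier_vec (n * Suc T) \<longrightarrow> u \<in> carrier_vec (m * Suc T) \<longrightarrow>
        \<delta> \<in> carrier_vec (n + p * T) \<longrightarrow> is_traj n T A B E x u \<delta> \<longrightarrow> x = F1 *\<^sub>v u + G1 *\<^sub>v \<delta>"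
    \<comment> \<open>Every pair of input and disturbance is realised by a trajectory, so the
      competing matrices agree with \<open>F0\<close> and \<open>G0\<close> on all arguments;
      setting one argument to zero separates the two.\<close>
    have eq: "F0 *\<^sub>v u + G0 *\<^sub>v \<delta> = F1 *\<^sub>v u + G1 *\<^sub>v \<delta>"
      if u: "u \<in> carrier_vec (m * Suc T)" and d: "\<delta> \<in> carrier_vec (n + p * T)" for u \<delta>
    proof -
      have "F0 *\<^sub>v u + G0 *\<^sub>v \<delta> \<in> carrier_vec (n * Suc T)"
        using mult_mat_vec_carrier[OF F0 u] mult_mat_vec_carrier[OF G0 d] by simp
      then show ?thesis using * tr u d by blast
    qed
    show "F1 = F0"
    proof (rule mat_eq_mult_vecI[OF F1 F0])
      fix u :: "real vec" assume u: "u \<in> carrier_vec (m * Suc T)"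
      show "F1 *\<^sub>v u = F0 *\<^sub>v u"
        using eq[OF u zero_carrier_vec] mult_mat_vec_carrier[OF F0 u] mult_mat_vec_carrier[OF F1 u]
        by (simp add: mult_mat_zero_vec[OF G0] mult_mat_zero_vec[OF G1])
    qed
    show "G1 = G0"
    proof (rule mat_eq_mult_vecI[OF G1 G0])
      fix d :: "real vec" assume d: "d \<in> carrier_vec (n + p * T)"
      show "G1 *\<^sub>v d = G0 *\<^sub>v d"
        using eq[OF zero_carrier_vec d, unfolded mult_mat_zero_vec[OF F0] mult_mat_zero_vec[OF F1]]
          mult_mat_vec_carrier[OF G0 d] mult_mat_vec_carrier[OF G1 d] by simp
    qed
  qed (use F0 G0 in auto)
  then have "F = F0" "G = G0" by (auto simp: F_def G_def)
  then show ?F ?G "\<And>x u \<delta>. x \<in> carrier_vec (n * Suc T) \<Longrightarrow> u \<in> carrier_vec (m * Suc T) \<Longrightarrow>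
      \<delta> \<in> carrier_vec (n + p * T) \<Longrightarrow> is_traj n T A B E x u \<delta> \<longleftrightarrow> x = F *\<^sub>v u + G *\<^sub>v \<delta>"
    using F0 G0 tr by blast+
qed

end

text \<open>Least squares with the state eliminated. \<open>y \<delta>\<close> is the state under
  the optimal input, and \<open>form\<close> identifies the bilinear form of \<open>O'\<close> with
  the cost pairing of two such optimal responses, which gives symmetry and the optimal value at
  once.\<close>

lemma optimal_cost_matrix:
  fixes Q R F G :: "real mat"
  assumes Q: "Q \<in> carrier_mat N N" "psd_mat Q" and R: "R \<in> carrier_mat M M" "pd_mat R"
    and F: "F \<in> carrier_mat N M" and G: "G \<in> carrier_mat N q"
  defines "O' \<equiv> G\<^sup>T * Q * minv (1\<^sub>m N + F * minv R * F\<^sup>T * Q) * G"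
  shows "O' \<in> carrier_mat q q" "O'\<^sup>T = O'"
    and "\<And>u \<delta>. u \<in> carrier_vec M \<Longrightarrow> \<delta> \<in> carrier_vec q \<Longrightarrow> \<delta> \<bullet> (O' *\<^sub>v \<delta>) \<le>
      (F *\<^sub>v u + G *\<^sub>v \<delta>) \<bullet> (Q *\<^sub>v (F *\<^sub>v u + G *\<^sub>v \<delta>)) + u \<bullet> (R *\<^sub>v u)"
proof -
  define Ri where "Ri = minv R"
  have Ri: "Ri \<in> carrier_mat M M" "R * Ri = 1\<^sub>m M"
    using pd_minv_props[OF R] by (auto simp: Ri_def)
  have FT: "F\<^sup>T \<in> carrier_mat M N" and GT: "G\<^sup>T \<in> carrier_mat q N" using F G by auto
  note Rpsd = pd_matD(1)[OF R(2,1)]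
  \<comment> \<open>The negative of the input that stationarity assigns to a state \<open>v\<close>:
    the optimal input solves \<open>R u = - F\<^sup>T Q x\<close>.\<close>
  define a where "a v = Ri *\<^sub>v (F\<^sup>T *\<^sub>v (Q *\<^sub>v v))" for v
  have Qv: "Q *\<^sub>v v \<in> carrier_vec N" if "v \<in> carrier_vec N" for v using Q that by auto
  have FQv: "F\<^sup>T *\<^sub>v (Q *\<^sub>v v) \<in> carrier_vec M" if "v \<in> carrier_vec N" for v
    using mult_mat_vec_carrier[OF FT Qv[OF that]] .
  have a: "a v \<in> carrier_vec M" if "v \<in> carrier_vec N" for v
    unfolding a_def using mult_mat_vec_carrier[OF Ri(1) FQv[OF that]] .
  have Ra: "R *\<^sub>v a v = F\<^sup>T *\<^sub>v (Q *\<^sub>v v)" if "v \<in> carrier_vec N" for v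
    unfolding a_def using assoc_mult_mat_vec[OF R(1) Ri(1) FQv[OF that]] Ri(2) FQv[OF that] by simp
  have Fh: "F *\<^sub>v h \<in> carrier_vec N" if "h \<in> carrier_vec M" for h
    using mult_mat_vec_carrier[OF F that] .
  have FQ: "(F *\<^sub>v h) \<bullet> (Q *\<^sub>v v) = h \<bullet> (R *\<^sub>v a v)"
    if h: "h \<in> carrier_vec M" and v: "v \<in> carrier_vec N" for h v
    unfolding Ra[OF v] using adjoint_scalar_prod[OF F h Qv[OF v]]
      comm_scalar_prod[OF Fh[OF h] Qv[OF v]] comm_scalar_prod[OF h FQv[OF v]] by simp
  define K where "K = 1\<^sub>m N + F * Ri * F\<^sup>T * Q"
  have c1: "F * Ri \<in> carrier_mat N M" by (rule mult_carrier_mat[OF F Ri(1)])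
  have c2: "F * Ri * F\<^sup>T \<in> carrier_mat N N" by (rule mult_carrier_mat[OF c1 FT])
  have c3: "F * Ri * F\<^sup>T * Q \<in> carrier_mat N N" by (rule mult_carrier_mat[OF c2 Q(1)])
  have K: "K \<in> carrier_mat N N" using c3 by (simp add: K_def)
  have Kv: "K *\<^sub>v v = v + F *\<^sub>v a v" if v: "v \<in> carrier_vec N" for v
  proof -
    have "K *\<^sub>v v = 1\<^sub>m N *\<^sub>v v + (F * Ri * F\<^sup>T * Q) *\<^sub>v v"
      unfolding K_def by (rule add_mult_distrib_mat_vec[OF one_carrier_mat c3 v])
    also have "(F * Ri * F\<^sup>T * Q) *\<^sub>v v = F *\<^sub>v a v"
      unfolding a_def assoc_mult_mat_vec[OF c2 Q(1) v] assoc_mult_mat_vec[OF c1 FT Qv[OF v]]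
        assoc_mult_mat_vec[OF F Ri(1) FQv[OF v]] ..
    finally show ?thesis using v by simp
  qed
  \<comment> \<open>Pairing \<open>v + F *\<^sub>v a v = 0\<close> with \<open>Q *\<^sub>v v\<close>
    gives a sum of two nonnegative forms equal to zero. Definiteness of \<open>R\<close> forces
    \<open>a v = 0\<close>, and then \<open>v = 0\<close>.\<close>
  have inj: "v = 0\<^sub>v N" if v: "v \<in> carrier_vec N" "K *\<^sub>v v = 0\<^sub>v N" for v
  proof -
    have 0: "v + F *\<^sub>v a v = 0\<^sub>v N" using v Kv by simp
    have "0 = (v + F *\<^sub>v a v) \<bullet> (Q *\<^sub>v v)" unfolding 0 using Qv[OF v(1)] by simp
    also have "\<dots> = v \<bullet> (Q *\<^sub>v v) + a v \<bullet> (R *\<^sub>v a v)"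
      using v(1) Q(1) Fh[OF a[OF v(1)]] FQ[OF a[OF v(1)] v(1)] F by (simp add: scalar_prod_dim_simps)
    finally have "a v \<bullet> (R *\<^sub>v a v) \<le> 0" using psd_matD(2)[OF Q(2,1) v(1)] by linarith
    then have "a v = 0\<^sub>v M" using pd_matD(2)[OF R(2,1) a[OF v(1)]] by force
    then show ?thesis using 0 v(1) by (simp add: mult_mat_zero_vec[OF F])
  qed
  define L where "L = minv K"
  have L: "L \<in> carrier_mat N N" "K * L = 1\<^sub>m N"
    using minv_props[OF K inj] by (auto simp: L_def)
  define y where "y \<delta> = L *\<^sub>v (G *\<^sub>v \<delta>)" for \<delta>
  have Gd: "G *\<^sub>v \<delta> \<in> carrier_vec N" if "\<delta> \<in> carrier_vec q" for \<delta>
    using mult_mat_vec_carrier[OF G that] .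
  have y: "y \<delta> \<in> carrier_vec N" if "\<delta> \<in> carrier_vec q" for \<delta>
    unfolding y_def using mult_mat_vec_carrier[OF L(1) Gd[OF that]] .
  have Ky: "G *\<^sub>v \<delta> = y \<delta> + F *\<^sub>v a (y \<delta>)" if d: "\<delta> \<in> carrier_vec q" for \<delta>
    unfolding Kv[OF y[OF d], symmetric] unfolding y_def
    using assoc_mult_mat_vec[OF K L(1) Gd[OF d]] L(2) Gd[OF d] by simp
  have O'_eq: "O' = G\<^sup>T * Q * L * G" by (simp add: O'_def L_def K_def Ri_def)
  have d1: "G\<^sup>T * Q \<in> carrier_mat q N" by (rule mult_carrier_mat[OF GT Q(1)])
  have d2: "G\<^sup>T * Q * L \<in> carrier_mat q N" by (rule mult_carrier_mat[OF d1 L(1)])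
  show O': "O' \<in> carrier_mat q q" unfolding O'_eq by (rule mult_carrier_mat[OF d2 G])
  have form: "\<epsilon> \<bullet> (O' *\<^sub>v \<delta>) = y \<epsilon> \<bullet> (Q *\<^sub>v y \<delta>) + a (y \<epsilon>) \<bullet> (R *\<^sub>v a (y \<delta>))"
    if e: "\<epsilon> \<in> carrier_vec q" and d: "\<delta> \<in> carrier_vec q" for \<epsilon> \<delta>
  proof -
    have "O' *\<^sub>v \<delta> = G\<^sup>T *\<^sub>v (Q *\<^sub>v y \<delta>)"
      unfolding O'_eq y_def assoc_mult_mat_vec[OF d2 G d] assoc_mult_mat_vec[OF d1 L(1) Gd[OF d]]
      by (rule assoc_mult_mat_vec[OF GT Q(1)]) (use y[OF d] in \<open>simp add: y_def\<close>)
    then have "\<epsilon> \<bullet> (O' *\<^sub>v \<delta>) = (G *\<^sub>v \<epsilon>) \<bullet> (Q *\<^sub>v y \<delta>)"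
      using transpose_vec_mult_scalar[OF GT Qv[OF y[OF d]] e] by simp
    then show ?thesis
      unfolding Ky[OF e] using y[OF e] y[OF d] a[OF y[OF e]] F Q(1) FQ[OF a[OF y[OF e]] y[OF d]]
      by (simp add: scalar_prod_dim_simps)
  qed
  show "O'\<^sup>T = O'"
  proof (rule symmetricI_scalar_prod[OF O'])
    fix \<delta> \<epsilon> :: "real vec" assume "\<delta> \<in> carrier_vec q" "\<epsilon> \<in> carrier_vec q"
    then show "\<epsilon> \<bullet> (O' *\<^sub>v \<delta>) = \<delta> \<bullet> (O' *\<^sub>v \<epsilon>)"
      using symmetric_scalar_prod[OF Q(1) psd_matD(1)[OF Q(2,1)], of "y \<delta>" "y \<epsilon>"]
        symmetric_scalar_prod[OF R(1) psd_matD(1)[OF Rpsd R(1)], of "a (y \<delta>)" "a (y \<epsilon>)"] y a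
      by (simp add: form)
  qed
  fix u \<delta> :: "real vec" assume u: "u \<in> carrier_vec M" and d: "\<delta> \<in> carrier_vec q"
  text \<open>The optimal input is \<open>- a (y \<delta>)\<close>; complete the square around it.\<close>
  define h where "h = u + a (y \<delta>)"
  have h: "h \<in> carrier_vec M" using u a[OF y[OF d]] by (simp add: h_def)
  have u_eq: "u = h - a (y \<delta>)" using u a[OF y[OF d]] by (auto simp: h_def)
  have x_eq: "F *\<^sub>v u + G *\<^sub>v \<delta> = y \<delta> + F *\<^sub>v h"
    unfolding Ky[OF d] h_def mult_add_distrib_mat_vec[OF F u a[OF y[OF d]]]
    using Fh[OF u] Fh[OF a[OF y[OF d]]] y[OF d] by (intro eq_vecI) auto
  have "(y \<delta> + F *\<^sub>v h) \<bullet> (Q *\<^sub>v (y \<delta> + F *\<^sub>v h)) =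
      y \<delta> \<bullet> (Q *\<^sub>v y \<delta>) + 2 * (h \<bullet> (R *\<^sub>v a (y \<delta>))) + (F *\<^sub>v h) \<bullet> (Q *\<^sub>v (F *\<^sub>v h))"
    unfolding mult_add_distrib_mat_vec[OF Q(1) y[OF d] Fh[OF h]]
    using y[OF d] Fh[OF h] Q(1) F FQ[OF h y[OF d]]
      symmetric_scalar_prod[OF Q(1) psd_matD(1)[OF Q(2,1)] Fh[OF h] y[OF d]]
    by (simp add: scalar_prod_dim_simps)
  moreover have "u \<bullet> (R *\<^sub>v u) = h \<bullet> (R *\<^sub>v h) - 2 * (h \<bullet> (R *\<^sub>v a (y \<delta>))) + a (y \<delta>) \<bullet> (R *\<^sub>v a (y \<delta>))"
    unfolding u_eq mult_minus_distrib_mat_vec[OF R(1) h a[OF y[OF d]]]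
    using h a[OF y[OF d]] R(1)
      symmetric_scalar_prod[OF R(1) psd_matD(1)[OF Rpsd R(1)] h a[OF y[OF d]]]
    by (simp add: scalar_prod_dim_simps)
  ultimately show "\<delta> \<bullet> (O' *\<^sub>v \<delta>) \<le>
      (F *\<^sub>v u + G *\<^sub>v \<delta>) \<bullet> (Q *\<^sub>v (F *\<^sub>v u + G *\<^sub>v \<delta>)) + u \<bullet> (R *\<^sub>v u)"
    unfolding x_eq form[OF d d]
    using psd_matD(2)[OF Q(2,1) Fh[OF h]] psd_matD(2)[OF Rpsd R(1) h] by simp
qed

section \<open>Schur complement of the matrix inequality\<close>

lemma scalar_prod_append_dim:
  fixes a b c d :: "real vec"
  assumes "dim_vec a = dim_vec c" "dim_vec b = dim_vec d"
  shows "(a @\<^sub>v b) \<bullet> (c @\<^sub>v d) = a \<bullet> c + b \<bullet> d"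
  by (rule scalar_prod_append[of _ "dim_vec c" _ "dim_vec d"]) (use assms in \<open>auto intro: carrier_vecI\<close>)

lemma transpose_smult_mat: "(k \<cdot>\<^sub>m A)\<^sup>T = k \<cdot>\<^sub>m A\<^sup>T"
  by (rule eq_matI) auto

lemma smult_mat_mult_vec:
  "dim_vec v = dim_col (A :: real mat) \<Longrightarrow> (k \<cdot>\<^sub>m A) *\<^sub>v v = k \<cdot>\<^sub>v (A *\<^sub>v v)"
  by (rule eq_vecI) auto

text \<open>Completing the square in the third component, whose diagonal block is the identity: the
  full form is the Schur complement plus the squared norm of
  \<open>z + (M31 *\<^sub>v x + M32 *\<^sub>v y)\<close>.\<close>

lemma block3_psd_iff:
  fixes M11 M21 M22 M31 M32 :: "real mat"
  assumes M11: "M11 \<in> carrier_mat a a" "M11\<^sup>T = M11" and M22: "M22 \<in> carrier_mat b b" "M22\<^sup>T = M22"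
    and M21: "M21 \<in> carrier_mat b a" and M31: "M31 \<in> carrier_mat c a" and M32: "M32 \<in> carrier_mat c b"
  shows "psd_mat (block3 M11 (M21\<^sup>T) (M31\<^sup>T) M21 M22 (M32\<^sup>T) M31 M32 (1\<^sub>m c)) \<longleftrightarrow>
    (\<forall>x \<in> carrier_vec a. \<forall>y \<in> carrier_vec b.
      0 \<le> x \<bullet> (M11 *\<^sub>v x) + 2 * (y \<bullet> (M21 *\<^sub>v x)) + y \<bullet> (M22 *\<^sub>v y)
           - (M31 *\<^sub>v x + M32 *\<^sub>v y) \<bullet> (M31 *\<^sub>v x + M32 *\<^sub>v y))"
    (is "psd_mat ?M \<longleftrightarrow> ?R")
proof -
  have T: "M21\<^sup>T \<in> carrier_mat a b" "M31\<^sup>T \<in> carrier_mat a c" "M32\<^sup>T \<in> carrier_mat b c"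
    using M21 M31 M32 by auto
  note h = hcat_carrier[OF hcat_carrier[OF M11(1) T(1)] T(2)]
    hcat_carrier[OF hcat_carrier[OF M21 M22(1)] T(3)]
    hcat_carrier[OF hcat_carrier[OF M31 M32] one_carrier_mat]
  have M: "?M \<in> carrier_mat (a + b + c) (a + b + c)"
    unfolding block3_def by (rule vcat_carrier[OF vcat_carrier[OF h(1,2)] h(3)])
  have Mv: "?M *\<^sub>v ((x @\<^sub>v y) @\<^sub>v z) =
     (((M11 *\<^sub>v x + M21\<^sup>T *\<^sub>v y) + M31\<^sup>T *\<^sub>v z) @\<^sub>v ((M21 *\<^sub>v x + M22 *\<^sub>v y) + M32\<^sup>T *\<^sub>v z))
      @\<^sub>v ((M31 *\<^sub>v x + M32 *\<^sub>v y) + z)"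
    if x: "x \<in> carrier_vec a" and y: "y \<in> carrier_vec b" and z: "z \<in> carrier_vec c" for x y z
  proof -
    have xy: "x @\<^sub>v y \<in> carrier_vec (a + b)" and xyz: "(x @\<^sub>v y) @\<^sub>v z \<in> carrier_vec (a + b + c)"
      using x y z by auto
    have one: "1\<^sub>m c *\<^sub>v z = z" using z by simp
    show ?thesis
      unfolding block3_def vcat_mult_vec[OF vcat_carrier[OF h(1,2)] h(3) xyz] vcat_mult_vec[OF h(1,2) xyz]
        hcat_mult_vec[OF hcat_carrier[OF M11(1) T(1)] T(2) xy z] hcat_mult_vec[OF M11(1) T(1) x y]
        hcat_mult_vec[OF hcat_carrier[OF M21 M22(1)] T(3) xy z] hcat_mult_vec[OF M21 M22(1) x y]
        hcat_mult_vec[OF hcat_carrier[OF M31 M32] one_carrier_mat xy z] hcat_mult_vec[OF M31 M32 x y] one ..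
  qed
  have form: "((x' @\<^sub>v y') @\<^sub>v z') \<bullet> (?M *\<^sub>v ((x @\<^sub>v y) @\<^sub>v z)) =
      x' \<bullet> (M11 *\<^sub>v x) + y \<bullet> (M21 *\<^sub>v x') + z \<bullet> (M31 *\<^sub>v x')
      + y' \<bullet> (M21 *\<^sub>v x) + y' \<bullet> (M22 *\<^sub>v y) + z \<bullet> (M32 *\<^sub>v y')
      + z' \<bullet> (M31 *\<^sub>v x) + z' \<bullet> (M32 *\<^sub>v y) + z' \<bullet> z"
    if x: "x \<in> carrier_vec a" and y: "y \<in> carrier_vec b" and z: "z \<in> carrier_vec c"
      and x': "x' \<in> carrier_vec a" and y': "y' \<in> carrier_vec b" and z': "z' \<in> carrier_vec c" for x y z x' y' z'
  proof -
    have "x' \<bullet> (M21\<^sup>T *\<^sub>v y) = y \<bullet> (M21 *\<^sub>v x')" "x' \<bullet> (M31\<^sup>T *\<^sub>v z) = z \<bullet> (M31 *\<^sub>v x')"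
      "y' \<bullet> (M32\<^sup>T *\<^sub>v z) = z \<bullet> (M32 *\<^sub>v y')"
      using adjoint_scalar_prod[OF T(1) y x'] adjoint_scalar_prod[OF T(2) z x'] adjoint_scalar_prod[OF T(3) z y']
        comm_scalar_prod[OF mult_mat_vec_carrier[OF M21 x'] y]
        comm_scalar_prod[OF mult_mat_vec_carrier[OF M31 x'] z]
        comm_scalar_prod[OF mult_mat_vec_carrier[OF M32 y'] z] by simp_all
    then show ?thesis unfolding Mv[OF x y z]
      using x y z x' y' z' M11(1) M22(1) M21 M31 M32
      by (simp add: scalar_prod_append_dim scalar_prod_dim_simps)
  qed
  have split: "\<exists>x y z. x \<in> carrier_vec a \<and> y \<in> carrier_vec b \<and> z \<in> carrier_vec c \<and> v = (x @\<^sub>v y) @\<^sub>v z"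
    if v: "v \<in> carrier_vec (a + b + c)" for v :: "real vec"
  proof (intro exI conjI)
    show "v = (vec_first (vec_first v (a + b)) a @\<^sub>v vec_last (vec_first v (a + b)) b) @\<^sub>v vec_last v c"
      using vec_first_last_append[OF v] vec_first_last_append[of "vec_first v (a + b)" a b] by simp
  qed auto
  have sym: "?M\<^sup>T = ?M"
  proof (rule symmetricI_scalar_prod[OF M])
    fix u v :: "real vec" assume "u \<in> carrier_vec (a + b + c)" "v \<in> carrier_vec (a + b + c)"
    then obtain x y z x' y' z' where
      u: "x \<in> carrier_vec a" "y \<in> carrier_vec b" "z \<in> carrier_vec c" "u = (x @\<^sub>v y) @\<^sub>v z" and
      v: "x' \<in> carrier_vec a" "y' \<in> carrier_vec b" "z' \<in> carrier_vec c" "v = (x' @\<^sub>v y') @\<^sub>v z'"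
      using split[of u] split[of v] by blast
    show "v \<bullet> (?M *\<^sub>v u) = u \<bullet> (?M *\<^sub>v v)"
      unfolding u(4) v(4) form[OF u(1-3) v(1-3)] form[OF v(1-3) u(1-3)]
      using symmetric_scalar_prod[OF M11 u(1) v(1)] symmetric_scalar_prod[OF M22 u(2) v(2)]
        comm_scalar_prod[OF u(3) v(3)] by simp
  qed
  have quad: "((x @\<^sub>v y) @\<^sub>v z) \<bullet> (?M *\<^sub>v ((x @\<^sub>v y) @\<^sub>v z)) =
      x \<bullet> (M11 *\<^sub>v x) + 2 * (y \<bullet> (M21 *\<^sub>v x)) + y \<bullet> (M22 *\<^sub>v y)
      - (M31 *\<^sub>v x + M32 *\<^sub>v y) \<bullet> (M31 *\<^sub>v x + M32 *\<^sub>v y)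
      + (z + (M31 *\<^sub>v x + M32 *\<^sub>v y)) \<bullet> (z + (M31 *\<^sub>v x + M32 *\<^sub>v y))"
    if x: "x \<in> carrier_vec a" and y: "y \<in> carrier_vec b" and z: "z \<in> carrier_vec c" for x y z
    unfolding form[OF that that]
    using x y z M31 M32 comm_scalar_prod[OF mult_mat_vec_carrier[OF M31 x] z]
        comm_scalar_prod[OF mult_mat_vec_carrier[OF M32 y] z] by (simp add: scalar_prod_dim_simps)
  show ?thesis
  proof
    assume psd: "psd_mat ?M"
    show ?R
    proof (intro ballI)
      fix x y :: "real vec" assume x: "x \<in> carrier_vec a" and y: "y \<in> carrier_vec b"
      \<comment> \<open>\<open>- g\<close> minimises over the third component; there the last square
        in \<open>quad\<close> vanishes and only the Schur complement remains.\<close>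
      define g where "g = M31 *\<^sub>v x + M32 *\<^sub>v y"
      have g: "g \<in> carrier_vec c"
        unfolding g_def using mult_mat_vec_carrier[OF M31 x] mult_mat_vec_carrier[OF M32 y] by simp
      have "- g + g = 0\<^sub>v c" using g by auto
      then show "0 \<le> x \<bullet> (M11 *\<^sub>v x) + 2 * (y \<bullet> (M21 *\<^sub>v x)) + y \<bullet> (M22 *\<^sub>v y)
           - (M31 *\<^sub>v x + M32 *\<^sub>v y) \<bullet> (M31 *\<^sub>v x + M32 *\<^sub>v y)"
        using quad[OF x y, of "- g"] g psd_matD(2)[OF psd M, of "(x @\<^sub>v y) @\<^sub>v (- g)"] x y
        by (simp add: g_def[symmetric])
    qed
  next
    assume R: ?R
    show "psd_mat ?M"
    proof (rule psd_matI[OF M sym])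
      fix v :: "real vec" assume "v \<in> carrier_vec (a + b + c)"
      then obtain x y z where u: "x \<in> carrier_vec a" "y \<in> carrier_vec b" "z \<in> carrier_vec c"
        "v = (x @\<^sub>v y) @\<^sub>v z" using split by blast
      show "0 \<le> v \<bullet> (?M *\<^sub>v v)"
        unfolding u(4) quad[OF u(1-3)] using R u(1,2)
          scalar_prod_self_ge_0[of "z + (M31 *\<^sub>v x + M32 *\<^sub>v y)"] by fastforce
    qed
  qed
qed

lemma blk_carrier [simp]:
  "blk11 M k \<in> carrier_mat k k"
  "M \<in> carrier_mat (k + q) (k + q) \<Longrightarrow> blk21 M k \<in> carrier_mat q k"
  "M \<in> carrier_mat (k + q) (k + q) \<Longrightarrow> blk22 M k \<in> carrier_mat q q"
  by (auto simp: blk11_def blk21_def blk22_def)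

lemma blk11_dims [simp]: "dim_row (blk11 M k) = k" "dim_col (blk11 M k) = k"
  by (auto simp: blk11_def)

lemma blk_transpose:
  assumes "M \<in> carrier_mat (k + q) (k + q)" "M\<^sup>T = M"
  shows "(blk11 M k)\<^sup>T = blk11 M k" "(blk22 M k)\<^sup>T = blk22 M k"
proof -
  have "M $$ (i, j) = M $$ (j, i)" if "i < k + q" "j < k + q" for i j
    using arg_cong[OF assms(2), of "\<lambda>M. M $$ (i, j)"] assms(1) that by auto
  then show "(blk11 M k)\<^sup>T = blk11 M k" "(blk22 M k)\<^sup>T = blk22 M k"
    using assms(1) by (auto simp: blk11_def blk22_def)
qed

lemma quad_form_blk:
  fixes M :: "real mat"
  assumes M: "M \<in> carrier_mat (k + q) (k + q)" "M\<^sup>T = M" and c: "c \<in> carrier_vec k" and w: "w \<in> carrier_vec q"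
  shows "(c @\<^sub>v w) \<bullet> (M *\<^sub>v (c @\<^sub>v w)) =
    c \<bullet> (blk11 M k *\<^sub>v c) + 2 * (w \<bullet> (blk21 M k *\<^sub>v c)) + w \<bullet> (blk22 M k *\<^sub>v w)"
proof -
  have sym: "M $$ (i, j) = M $$ (j, i)" if "i < k + q" "j < k + q" for i j
    using arg_cong[OF M(2), of "\<lambda>M. M $$ (i, j)"] M(1) that by auto
  have blk: "M = four_block_mat (blk11 M k) ((blk21 M k)\<^sup>T) (blk21 M k) (blk22 M k)"
    using M(1) sym by (intro eq_matI) (auto simp: blk11_def blk21_def blk22_def)
  have c21: "blk21 M k \<in> carrier_mat q k" and c22: "blk22 M k \<in> carrier_mat q q" using M by auto
  have "M *\<^sub>v (c @\<^sub>v w) = (blk11 M k *\<^sub>v c + (blk21 M k)\<^sup>T *\<^sub>v w) @\<^sub>v (blk21 M k *\<^sub>v c + blk22 M k *\<^sub>v w)"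
    by (subst blk, rule four_block_mat_mult_vec) (use c21 c22 c w in auto)
  moreover have "c \<bullet> ((blk21 M k)\<^sup>T *\<^sub>v w) = w \<bullet> (blk21 M k *\<^sub>v c)"
    using adjoint_scalar_prod[OF c21 c w] comm_scalar_prod[of c k "(blk21 M k)\<^sup>T *\<^sub>v w"] c21 c w by simp
  ultimately show ?thesis using c w c21 c22 by (simp add: scalar_prod_append_dim scalar_prod_dim_simps)
qed

lemma cols_mult_vec:
  fixes \<Phi> :: "real mat"
  assumes "\<Phi> \<in> carrier_mat r (k + q)" "c \<in> carrier_vec k" "w \<in> carrier_vec q"
  shows "colsL \<Phi> k *\<^sub>v c + colsR \<Phi> k *\<^sub>v w = \<Phi> *\<^sub>v (c @\<^sub>v w)"
proof -
  have L: "colsL \<Phi> k \<in> carrier_mat r k" and R: "colsR \<Phi> k \<in> carrier_mat r q"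
    using assms by (auto simp: colsL_def colsR_def)
  have "\<Phi> = hcat (colsL \<Phi> k) (colsR \<Phi> k)"
    using assms(1) by (intro eq_matI) (auto simp: colsL_def colsR_def hcat_def)
  then show ?thesis using hcat_mult_vec[OF L R assms(2,3)] by simp
qed

text \<open>Since \<open>x0\<close> is given, the first block of the inequality has size one. Its
  scalar variable is the \<open>t\<close> that multiplies \<open>x0\<close>, so the matrix
  inequality is a family of inequalities on homogenised vectors. Eliminating the identity block
  turns the factor \<open>S\<close> into the weight \<open>S * S\<close>.\<close>

lemma lmi_iff:
  fixes Om W Lam S \<Phi> :: "real mat" and x0 :: "real vec"
  assumes Om: "Om \<in> carrier_mat (n + q) (n + q)" "Om\<^sup>T = Om"
    and W: "W \<in> carrier_mat (n + q) (n + q)" "W\<^sup>T = W"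
    and Lam: "Lam \<in> carrier_mat q q" "Lam\<^sup>T = Lam"
    and S: "S \<in> carrier_mat r r" "S\<^sup>T = S" and Phi: "\<Phi> \<in> carrier_mat r (n + q)"
    and x0: "x0 \<in> carrier_vec n"
  shows "psd_mat (block3
         (transpose_mat (colm x0) * (blk11 Om n + \<mu> \<cdot>\<^sub>m blk11 W n) * colm x0 - scal l)
         (transpose_mat (colm x0) * (transpose_mat (blk21 Om n) + \<mu> \<cdot>\<^sub>m transpose_mat (blk21 W n)))
         (transpose_mat (colm x0) * transpose_mat (colsL \<Phi> n) * S)
         ((blk21 Om n + \<mu> \<cdot>\<^sub>m blk21 W n) * colm x0)
         (Lam + blk22 Om n + \<mu> \<cdot>\<^sub>m blk22 W n)
         (transpose_mat (colsR \<Phi> n) * S)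
         (S * colsL \<Phi> n * colm x0)
         (S * colsR \<Phi> n)
         (1\<^sub>m r)) \<longleftrightarrow>
    (\<forall>t. \<forall>w \<in> carrier_vec q.
       (\<Phi> *\<^sub>v (t \<cdot>\<^sub>v x0 @\<^sub>v w)) \<bullet> (S * S *\<^sub>v (\<Phi> *\<^sub>v (t \<cdot>\<^sub>v x0 @\<^sub>v w))) + l * t\<^sup>2 \<le>
       (t \<cdot>\<^sub>v x0 @\<^sub>v w) \<bullet> (Om *\<^sub>v (t \<cdot>\<^sub>v x0 @\<^sub>v w)) +
       \<mu> * ((t \<cdot>\<^sub>v x0 @\<^sub>v w) \<bullet> (W *\<^sub>v (t \<cdot>\<^sub>v x0 @\<^sub>v w))) + w \<bullet> (Lam *\<^sub>v w))"
proof -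
  let ?X = "colm x0"
  have X: "?X \<in> carrier_mat n 1" using x0 by (simp add: colm_def)
  have Xv: "?X *\<^sub>v a = a $ 0 \<cdot>\<^sub>v x0" if "a \<in> carrier_vec 1" for a
    using that x0 by (intro eq_vecI) (auto simp: colm_def scalar_prod_def)
  define N11 where "N11 = blk11 Om n + \<mu> \<cdot>\<^sub>m blk11 W n"
  define N21 where "N21 = blk21 Om n + \<mu> \<cdot>\<^sub>m blk21 W n"
  define N22 where "N22 = blk22 Om n + \<mu> \<cdot>\<^sub>m blk22 W n"
  define M11 where "M11 = ?X\<^sup>T * N11 * ?X - scal l"
  define M22 where "M22 = Lam + blk22 Om n + \<mu> \<cdot>\<^sub>m blk22 W n"
  define L where "L = colsL \<Phi> n"
  define R where "R = colsR \<Phi> n"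
  have b: "blk11 Om n \<in> carrier_mat n n" "blk11 W n \<in> carrier_mat n n"
    "blk21 Om n \<in> carrier_mat q n" "blk21 W n \<in> carrier_mat q n"
    "blk22 Om n \<in> carrier_mat q q" "blk22 W n \<in> carrier_mat q q" using Om W by auto
  have L: "L \<in> carrier_mat r n" and R: "R \<in> carrier_mat r q"
    using Phi by (auto simp: L_def R_def colsL_def colsR_def)
  have N11: "N11 \<in> carrier_mat n n" and N21: "N21 \<in> carrier_mat q n" and N22: "N22 \<in> carrier_mat q q"
    using b by (auto simp: N11_def N21_def N22_def)
  have XT: "?X\<^sup>T \<in> carrier_mat 1 n" using X by simp
  have XN: "?X\<^sup>T * N11 \<in> carrier_mat 1 n" by (rule mult_carrier_mat[OF XT N11])
  have XNX: "?X\<^sup>T * N11 * ?X \<in> carrier_mat 1 1" by (rule mult_carrier_mat[OF XN X])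
  have sc: "scal l \<in> carrier_mat 1 1" by (simp add: scal_def)
  have M11: "M11 \<in> carrier_mat 1 1" unfolding M11_def by (rule minus_carrier_mat[OF sc])
  have M11s: "M11\<^sup>T = M11" by (rule eq_matI) (use M11 in auto)
  have M22_eq: "M22 = Lam + N22" using b Lam(1) by (auto simp: M22_def N22_def)
  have M22: "M22 \<in> carrier_mat q q" using Lam(1) N22 by (simp add: M22_eq)
  have M22s: "M22\<^sup>T = M22"
    using b Lam blk_transpose[OF Om] blk_transpose[OF W]
    by (simp add: M22_eq N22_def transpose_add[of _ q q] transpose_smult_mat)
  have M21: "N21 * ?X \<in> carrier_mat q 1" by (rule mult_carrier_mat[OF N21 X])
  have SL: "S * L \<in> carrier_mat r n" by (rule mult_carrier_mat[OF S(1) L])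
  have M31: "S * L * ?X \<in> carrier_mat r 1" by (rule mult_carrier_mat[OF SL X])
  have M32: "S * R \<in> carrier_mat r q" by (rule mult_carrier_mat[OF S(1) R])
  have t21: "?X\<^sup>T * ((blk21 Om n)\<^sup>T + \<mu> \<cdot>\<^sub>m (blk21 W n)\<^sup>T) = (N21 * ?X)\<^sup>T"
    unfolding transpose_mult[OF N21 X] using b
    by (simp add: N21_def transpose_add[of _ q n] transpose_smult_mat)
  have t31: "?X\<^sup>T * L\<^sup>T * S = (S * L * ?X)\<^sup>T"
    unfolding transpose_mult[OF SL X] transpose_mult[OF S(1) L] S(2)
    by (rule assoc_mult_mat[OF XT _ S(1)]) (use L in auto)
  have t32: "R\<^sup>T * S = (S * R)\<^sup>T" unfolding transpose_mult[OF S(1) R] S(2) ..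
  have key: "x \<bullet> (M11 *\<^sub>v x) + 2 * (w \<bullet> (N21 * ?X *\<^sub>v x)) + w \<bullet> (M22 *\<^sub>v w)
           - (S * L * ?X *\<^sub>v x + S * R *\<^sub>v w) \<bullet> (S * L * ?X *\<^sub>v x + S * R *\<^sub>v w) =
      (\<delta> \<bullet> (Om *\<^sub>v \<delta>) + \<mu> * (\<delta> \<bullet> (W *\<^sub>v \<delta>)) + w \<bullet> (Lam *\<^sub>v w)) - ((\<Phi> *\<^sub>v \<delta>) \<bullet> (S * S *\<^sub>v (\<Phi> *\<^sub>v \<delta>)) + l * t\<^sup>2)"
    if x: "x \<in> carrier_vec 1" and w: "w \<in> carrier_vec q" and t: "t = x $ 0" and d: "\<delta> = t \<cdot>\<^sub>v x0 @\<^sub>v w" for x w t \<delta>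
  proof -
    define c where "c = t \<cdot>\<^sub>v x0"
    have c: "c \<in> carrier_vec n" using x0 by (simp add: c_def)
    have Xx: "?X *\<^sub>v x = c" using Xv[OF x] t by (simp add: c_def)
    have dc: "\<delta> = c @\<^sub>v w" using d by (simp add: c_def)
    have "x \<bullet> (M11 *\<^sub>v x) = x \<bullet> (?X\<^sup>T * N11 * ?X *\<^sub>v x) - x \<bullet> (scal l *\<^sub>v x)"
      unfolding M11_def minus_mult_distrib_mat_vec[OF XNX sc x]
      by (rule scalar_prod_minus_distrib[OF x mult_mat_vec_carrier[OF XNX x] mult_mat_vec_carrier[OF sc x]])
    also have "x \<bullet> (scal l *\<^sub>v x) = l * t\<^sup>2"
      using x by (simp add: scal_def scalar_prod_def t power2_eq_square)
    also have "x \<bullet> (?X\<^sup>T * N11 * ?X *\<^sub>v x) = c \<bullet> (N11 *\<^sub>v c)"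
      unfolding assoc_mult_mat_vec[OF XN X x] Xx assoc_mult_mat_vec[OF XT N11 c]
      using adjoint_scalar_prod[OF XT mult_mat_vec_carrier[OF N11 c] x] Xx by simp
    also have "c \<bullet> (N11 *\<^sub>v c) = c \<bullet> (blk11 Om n *\<^sub>v c) + \<mu> * (c \<bullet> (blk11 W n *\<^sub>v c))"
      unfolding N11_def
      using b c by (simp add: add_mult_distrib_mat_vec[of _ n n] smult_mat_mult_vec scalar_prod_dim_simps)
    finally have 1: "x \<bullet> (M11 *\<^sub>v x) = c \<bullet> (blk11 Om n *\<^sub>v c) + \<mu> * (c \<bullet> (blk11 W n *\<^sub>v c)) - l * t\<^sup>2" .
    have 2: "w \<bullet> (N21 * ?X *\<^sub>v x) = w \<bullet> (blk21 Om n *\<^sub>v c) + \<mu> * (w \<bullet> (blk21 W n *\<^sub>v c))"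
      unfolding assoc_mult_mat_vec[OF N21 X x] Xx unfolding N21_def
      using b c w by (simp add: add_mult_distrib_mat_vec[of _ q n] smult_mat_mult_vec scalar_prod_dim_simps)
    have 3: "w \<bullet> (M22 *\<^sub>v w) = w \<bullet> (Lam *\<^sub>v w) + w \<bullet> (blk22 Om n *\<^sub>v w) + \<mu> * (w \<bullet> (blk22 W n *\<^sub>v w))"
      unfolding M22_def
      using b Lam w by (simp add: add_mult_distrib_mat_vec[of _ q q] smult_mat_mult_vec scalar_prod_dim_simps)
    have Pd: "\<Phi> *\<^sub>v \<delta> \<in> carrier_vec r" unfolding dc using mult_mat_vec_carrier[OF Phi] c w by simp
    have SP: "S *\<^sub>v (\<Phi> *\<^sub>v \<delta>) \<in> carrier_vec r" by (rule mult_mat_vec_carrier[OF S(1) Pd])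
    have "S * L * ?X *\<^sub>v x + S * R *\<^sub>v w = S *\<^sub>v (L *\<^sub>v c) + S *\<^sub>v (R *\<^sub>v w)"
      unfolding assoc_mult_mat_vec[OF SL X x] Xx assoc_mult_mat_vec[OF S(1) L c] assoc_mult_mat_vec[OF S(1) R w] ..
    also have "\<dots> = S *\<^sub>v (L *\<^sub>v c + R *\<^sub>v w)"
      by (rule mult_add_distrib_mat_vec[symmetric, OF S(1) mult_mat_vec_carrier[OF L c] mult_mat_vec_carrier[OF R w]])
    also have "L *\<^sub>v c + R *\<^sub>v w = \<Phi> *\<^sub>v \<delta>"
      unfolding L_def R_def dc by (rule cols_mult_vec[OF Phi c w])
    finally have 4: "S * L * ?X *\<^sub>v x + S * R *\<^sub>v w = S *\<^sub>v (\<Phi> *\<^sub>v \<delta>)" .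
    have 5: "(\<Phi> *\<^sub>v \<delta>) \<bullet> (S * S *\<^sub>v (\<Phi> *\<^sub>v \<delta>)) = (S *\<^sub>v (\<Phi> *\<^sub>v \<delta>)) \<bullet> (S *\<^sub>v (\<Phi> *\<^sub>v \<delta>))"
      unfolding assoc_mult_mat_vec[OF S(1) S(1) Pd]
      using adjoint_scalar_prod[OF S(1) SP Pd] S(2) by simp
    show ?thesis
      unfolding 1 2 3 4 5 unfolding dc quad_form_blk[OF Om c w] quad_form_blk[OF W c w]
      by (simp add: algebra_simps)
  qed
  have "psd_mat (block3 M11 ((N21 * ?X)\<^sup>T) ((S * L * ?X)\<^sup>T) (N21 * ?X) M22 ((S * R)\<^sup>T) (S * L * ?X) (S * R) (1\<^sub>m r))
     \<longleftrightarrow> (\<forall>t. \<forall>w \<in> carrier_vec q.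
       (\<Phi> *\<^sub>v (t \<cdot>\<^sub>v x0 @\<^sub>v w)) \<bullet> (S * S *\<^sub>v (\<Phi> *\<^sub>v (t \<cdot>\<^sub>v x0 @\<^sub>v w))) + l * t\<^sup>2 \<le>
       (t \<cdot>\<^sub>v x0 @\<^sub>v w) \<bullet> (Om *\<^sub>v (t \<cdot>\<^sub>v x0 @\<^sub>v w)) +
       \<mu> * ((t \<cdot>\<^sub>v x0 @\<^sub>v w) \<bullet> (W *\<^sub>v (t \<cdot>\<^sub>v x0 @\<^sub>v w))) + w \<bullet> (Lam *\<^sub>v w))"
    unfolding block3_psd_iff[OF M11 M11s M22 M22s M21 M31 M32]
  proof (intro iffI allI ballI)
    fix t :: real and w :: "real vec"
    assume *: "\<forall>x\<in>carrier_vec 1. \<forall>y\<in>carrier_vec q.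
        0 \<le> x \<bullet> (M11 *\<^sub>v x) + 2 * (y \<bullet> (N21 * ?X *\<^sub>v x)) + y \<bullet> (M22 *\<^sub>v y)
           - (S * L * ?X *\<^sub>v x + S * R *\<^sub>v y) \<bullet> (S * L * ?X *\<^sub>v x + S * R *\<^sub>v y)"
      and w: "w \<in> carrier_vec q"
    have x: "vec 1 (\<lambda>_. t) \<in> carrier_vec 1" "t = vec 1 (\<lambda>_. t) $ 0" by auto
    show "(\<Phi> *\<^sub>v (t \<cdot>\<^sub>v x0 @\<^sub>v w)) \<bullet> (S * S *\<^sub>v (\<Phi> *\<^sub>v (t \<cdot>\<^sub>v x0 @\<^sub>v w))) + l * t\<^sup>2 \<le>
       (t \<cdot>\<^sub>v x0 @\<^sub>v w) \<bullet> (Om *\<^sub>v (t \<cdot>\<^sub>v x0 @\<^sub>v w)) +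
       \<mu> * ((t \<cdot>\<^sub>v x0 @\<^sub>v w) \<bullet> (W *\<^sub>v (t \<cdot>\<^sub>v x0 @\<^sub>v w))) + w \<bullet> (Lam *\<^sub>v w)"
      using *[rule_format, OF x(1) w] unfolding key[OF x(1) w x(2) refl] diff_ge_0_iff_ge .
  next
    fix x w :: "real vec" assume x: "x \<in> carrier_vec 1" and w: "w \<in> carrier_vec q"
      and *: "\<forall>t. \<forall>w \<in> carrier_vec q.
       (\<Phi> *\<^sub>v (t \<cdot>\<^sub>v x0 @\<^sub>v w)) \<bullet> (S * S *\<^sub>v (\<Phi> *\<^sub>v (t \<cdot>\<^sub>v x0 @\<^sub>v w))) + l * t\<^sup>2 \<le>
       (t \<cdot>\<^sub>v x0 @\<^sub>v w) \<bullet> (Om *\<^sub>v (t \<cdot>\<^sub>v x0 @\<^sub>v w)) +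
       \<mu> * ((t \<cdot>\<^sub>v x0 @\<^sub>v w) \<bullet> (W *\<^sub>v (t \<cdot>\<^sub>v x0 @\<^sub>v w))) + w \<bullet> (Lam *\<^sub>v w)"
    show "0 \<le> x \<bullet> (M11 *\<^sub>v x) + 2 * (w \<bullet> (N21 * ?X *\<^sub>v x)) + w \<bullet> (M22 *\<^sub>v w)
           - (S * L * ?X *\<^sub>v x + S * R *\<^sub>v w) \<bullet> (S * L * ?X *\<^sub>v x + S * R *\<^sub>v w)"
      unfolding key[OF x w refl refl] diff_ge_0_iff_ge by (rule *[rule_format, OF w])
  qed
  then show ?thesis
    unfolding t21[symmetric] t31[symmetric] t32[symmetric]
    unfolding M11_def N11_def N21_def M22_def L_def R_def .
qed

section \<open>Approximate S-procedure\<close>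

text \<open>The form is pulled back along \<open>K\<close> before rounding. The second moments are
  then preserved in the coordinates on which \<open>K\<close> acts, which can be chosen to
  diagonalise the constraints.\<close>

lemma gaussian_sign_rounding_linear:
  fixes M K :: "real mat"
  assumes M: "M \<in> carrier_mat r r" "psd_mat M" and K: "K \<in> carrier_mat r N"
    and vs: "set vs \<subseteq> carrier_vec N"
  obtains y where "y \<in> carrier_vec N" "\<And>j. j < N \<Longrightarrow> (y $ j)\<^sup>2 = (\<Sum>v\<leftarrow>vs. (v $ j)\<^sup>2)"
    "2 / pi * (\<Sum>v\<leftarrow>vs. (K *\<^sub>v v) \<bullet> (M *\<^sub>v (K *\<^sub>v v))) \<le> (K *\<^sub>v y) \<bullet> (M *\<^sub>v (K *\<^sub>v y))"
proof -
  have KT: "K\<^sup>T \<in> carrier_mat N r" using K by simp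
  have KM: "K\<^sup>T * M \<in> carrier_mat N r" by (rule mult_carrier_mat[OF KT M(1)])
  have KMK: "K\<^sup>T * M * K \<in> carrier_mat N N" by (rule mult_carrier_mat[OF KM K])
  have form: "v \<bullet> (K\<^sup>T * M * K *\<^sub>v v) = (K *\<^sub>v v) \<bullet> (M *\<^sub>v (K *\<^sub>v v))" if v: "v \<in> carrier_vec N" for v
  proof -
    have Kv: "K *\<^sub>v v \<in> carrier_vec r" by (rule mult_mat_vec_carrier[OF K v])
    show ?thesis
      unfolding assoc_mult_mat_vec[OF KM K v] assoc_mult_mat_vec[OF KT M(1) Kv]
      using adjoint_scalar_prod[OF KT mult_mat_vec_carrier[OF M(1) Kv] v] by simp
  qed
  have psd: "0 \<le> v \<bullet> (K\<^sup>T * M * K *\<^sub>v v)" if "v \<in> carrier_vec N" for v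
    unfolding form[OF that] by (rule psd_matD(2)[OF M(2,1) mult_mat_vec_carrier[OF K that]])
  obtain y where y: "y \<in> carrier_vec N" "\<And>j. j < N \<Longrightarrow> (y $ j)\<^sup>2 = (\<Sum>v\<leftarrow>vs. (v $ j)\<^sup>2)"
    "2 / pi * (\<Sum>v\<leftarrow>vs. v \<bullet> (K\<^sup>T * M * K *\<^sub>v v)) \<le> y \<bullet> (K\<^sup>T * M * K *\<^sub>v y)"
    using gaussian_sign_rounding[OF KMK psd vs] by blast
  have "(\<Sum>v\<leftarrow>vs. v \<bullet> (K\<^sup>T * M * K *\<^sub>v v)) = (\<Sum>v\<leftarrow>vs. (K *\<^sub>v v) \<bullet> (M *\<^sub>v (K *\<^sub>v v)))"
    by (intro arg_cong[of _ _ sum_list] map_cong refl form) (use vs in auto)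
  then show thesis using that[OF y(1,2)] y(3) by (simp add: form[OF y(1)])
qed

lemma quad_form_smult:
  fixes M :: "real mat"
  assumes "M \<in> carrier_mat N N" "v \<in> carrier_vec N"
  shows "(a \<cdot>\<^sub>v v) \<bullet> (M *\<^sub>v (a \<cdot>\<^sub>v v)) = a\<^sup>2 * (v \<bullet> (M *\<^sub>v v))"
  using assms by (simp add: mult_mat_vec power2_eq_square)

text \<open>By definition \<open>sigma_max W\<close> is \<open>kappa W * sigma_min W\<close>, and
  \<open>sigma_min\<close> bounds the form from below.\<close>

lemma pd_kappa_bound:
  assumes W: "W \<in> carrier_mat N N" "pd_mat W" "0 < N" and v: "v \<in> carrier_vec N"
  shows "sigma_max W * (v \<bullet> v) \<le> kappa W * (v \<bullet> (W *\<^sub>v v))"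
proof -
  note s = pd_sing_vals[OF W]
  have "kappa W * (sigma_min W * (v \<bullet> v)) \<le> kappa W * (v \<bullet> (W *\<^sub>v v))"
    using s(1,2) s(3)[OF v] by (intro mult_left_mono) (auto simp: kappa_def)
  then show ?thesis using s(1) by (simp add: kappa_def)
qed

text \<open>The multipliers come from the alternative, applied to the homogenised objective and
  constraints on lists of vectors. If all constraint values of a list are positive, it rounds to one
  admissible disturbance; there \<open>feas\<close> applies and makes the objective value of the
  list nonpositive. The condition \<open>0 \<le> \<mu>\<close> preserves the inequalities when
  \<open>W\<close> is compared with the norm.\<close>

lemma pi_half_s_procedure:
  fixes N W P :: "real mat" and x0 :: "real vec"
  assumes N: "N \<in> carrier_mat (n + p * T) (n + p * T)" "psd_mat N"
    and W: "W \<in> carrier_mat (n + p * T) (n + p * T)" "pd_mat W"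
    and P: "P \<in> carrier_mat p p" "psd_mat P" and x0: "x0 \<in> carrier_vec n"
    and n: "0 < n" and T: "0 < T" and \<mu>: "0 \<le> \<mu>"
    and feas: "\<And>w. w \<in> WT p T P \<Longrightarrow> (x0 @\<^sub>v w) \<bullet> (N *\<^sub>v (x0 @\<^sub>v w)) \<le> \<mu> * ((x0 @\<^sub>v w) \<bullet> (W *\<^sub>v (x0 @\<^sub>v w)))"
  obtains lam where "\<And>i. i \<in> {1..T} \<Longrightarrow> 0 \<le> lam i"
    "\<And>t w. w \<in> carrier_vec (p * T) \<Longrightarrow>
      (t \<cdot>\<^sub>v x0 @\<^sub>v w) \<bullet> (N *\<^sub>v (t \<cdot>\<^sub>v x0 @\<^sub>v w)) + (\<Sum>i\<in>{1..T}. lam i) * t\<^sup>2 \<le>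
      pi / 2 * kappa W * \<mu> * ((t \<cdot>\<^sub>v x0 @\<^sub>v w) \<bullet> (W *\<^sub>v (t \<cdot>\<^sub>v x0 @\<^sub>v w))) +
      (\<Sum>i\<in>{1..T}. lam i * (wblk p w (i - 1) \<bullet> (P *\<^sub>v wblk p w (i - 1))))"
proof -
  define q where "q = p * T"
  note N = N[folded q_def] and W = W[folded q_def]
  obtain U d where U: "U \<in> carrier_mat p p" "U\<^sup>T * U = 1\<^sub>m p" "U * U\<^sup>T = 1\<^sub>m p"
    "P = U * mat_diag p d * U\<^sup>T"
    using real_spectral_theorem[OF P(1) psd_matD(1)[OF P(2,1)]] by blast
  have d: "0 \<le> d j" if "j < p" for j
    using psd_matD(2)[OF P(2,1), of "U *\<^sub>v unit_vec p j"] spectral_eigenvector[OF U that] U(1) by simp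
  \<comment> \<open>One copy of the eigenbasis of \<open>P\<close> per time step. In the coordinates
    given by \<open>V'\<close> all \<open>T\<close> constraints are diagonal.\<close>
  define V where "V = diag_block_mat (replicate T U)"
  define V' where "V' = diag_block_mat (replicate T (U\<^sup>T))"
  have V: "V \<in> carrier_mat q q" and V': "V' \<in> carrier_mat q q"
    using diag_block_mat_uniform[of "replicate T U" p p] diag_block_mat_uniform[of "replicate T (U\<^sup>T)" p p] U(1)
    by (auto simp: V_def V'_def q_def)
  have wV: "wblk p (V *\<^sub>v v) i = U *\<^sub>v wblk p v i" "wblk p (V' *\<^sub>v v) i = U\<^sup>T *\<^sub>v wblk p v i"
    if "v \<in> carrier_vec q" "i < T" for v i
    using wblk_diag_block_mat[of "replicate T U" p p v i] wblk_diag_block_mat[of "replicate T (U\<^sup>T)" p p v i]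
      that U(1) by (auto simp: V_def V'_def q_def)
  have VV': "V *\<^sub>v (V' *\<^sub>v v) = v" if v: "v \<in> carrier_vec q" for v
  proof (rule wblk_eqI[of _ p T])
    have c: "V' *\<^sub>v v \<in> carrier_vec q" by (rule mult_mat_vec_carrier[OF V' v])
    show "V *\<^sub>v (V' *\<^sub>v v) \<in> carrier_vec (p * T)"
      using mult_mat_vec_carrier[OF V c] by (simp add: q_def)
    show "wblk p (V *\<^sub>v (V' *\<^sub>v v)) i = wblk p v i" if "i < T" for i
      using wV(1)[OF c that] wV(2)[OF v that] orthogonal_cancel(1)[OF U, of "wblk p v i"] by simp
  qed (use v in \<open>auto simp: q_def\<close>)
  have Vnorm: "(V *\<^sub>v v) \<bullet> (V *\<^sub>v v) = v \<bullet> v" if v: "v \<in> carrier_vec q" for v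
    using mult_mat_vec_carrier[OF V v] v orthogonal_scalar_prod[OF U]
    by (simp add: scalar_prod_wblk[of _ p T] q_def[symmetric] wV(1)[OF v])
  have wP: "wblk p (V *\<^sub>v v) i \<bullet> (P *\<^sub>v wblk p (V *\<^sub>v v) i) = (\<Sum>j<p. d j * (v $ (i * p + j))\<^sup>2)"
    if v: "v \<in> carrier_vec q" and i: "i < T" for v i
    using spectral_quad_form[OF U wblk_carrier(1), of "V *\<^sub>v v" i] wV(1)[OF v i]
      orthogonal_cancel(2)[OF U, of "wblk p v i"] by simp
  \<comment> \<open>Sends a scalar followed by eigen-coordinates to the homogenised vector:
    \<open>x0\<close> scaled by the scalar, then the disturbance in its original basis.\<close>
  define K where "K = four_block_mat (colm x0) (0\<^sub>m n q) (0\<^sub>m q 1) V"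
  have X: "colm x0 \<in> carrier_mat n 1" using x0 by (simp add: colm_def)
  have K: "K \<in> carrier_mat (n + q) (1 + q)" unfolding K_def by (rule four_block_carrier_mat[OF X V])
  have Ky: "K *\<^sub>v y = (y $ 0 \<cdot>\<^sub>v x0) @\<^sub>v (V *\<^sub>v vec_last y q)" if y: "y \<in> carrier_vec (1 + q)" for y
  proof -
    have "colm x0 *\<^sub>v vec_first y 1 = y $ 0 \<cdot>\<^sub>v x0"
      using y x0 by (intro eq_vecI) (auto simp: colm_def scalar_prod_def vec_first_def)
    moreover have "K *\<^sub>v (vec_first y 1 @\<^sub>v vec_last y q) =
        (colm x0 *\<^sub>v vec_first y 1 + 0\<^sub>m n q *\<^sub>v vec_last y q) @\<^sub>v (0\<^sub>m q 1 *\<^sub>v vec_first y 1 + V *\<^sub>v vec_last y q)"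
      unfolding K_def by (rule four_block_mat_mult_vec[OF X _ _ V]) auto
    moreover have "0\<^sub>m n q *\<^sub>v vec_last y q = 0\<^sub>v n" "0\<^sub>m q 1 *\<^sub>v vec_first y 1 = 0\<^sub>v q"
      by (intro eq_vecI; auto)+
    ultimately show ?thesis
      using vec_first_last_append[OF y] x0 mult_mat_vec_carrier[OF V vec_last_carrier] by simp
  qed
  have last: "vec_last y q $ j = y $ (Suc j)" if "y \<in> carrier_vec (1 + q)" "j < q" for y :: "real vec" and j
    using that by (simp add: vec_last_def)
  have Kc: "K *\<^sub>v y \<in> carrier_vec (n + q)" if "y \<in> carrier_vec (1 + q)" for y
    by (rule mult_mat_vec_carrier[OF K that])
  have Knorm: "(K *\<^sub>v y) \<bullet> (K *\<^sub>v y) = (y $ 0)\<^sup>2 * (x0 \<bullet> x0) + (\<Sum>j<q. (y $ Suc j)\<^sup>2)"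
    if y: "y \<in> carrier_vec (1 + q)" for y
  proof -
    have "(K *\<^sub>v y) \<bullet> (K *\<^sub>v y) = (y $ 0 \<cdot>\<^sub>v x0) \<bullet> (y $ 0 \<cdot>\<^sub>v x0) + vec_last y q \<bullet> vec_last y q"
      unfolding Ky[OF y] using V by (simp add: scalar_prod_append_dim Vnorm)
    then show ?thesis using x0
      by (simp add: power2_eq_square scalar_prod_def[of "vec_last y q"] last[OF y] lessThan_atLeast0)
  qed
  \<comment> \<open>The factor \<open>pi / 2\<close> undoes the rounding loss \<open>2 / pi\<close>;
    \<open>kappa W\<close> pays for bounding the form of \<open>W\<close> through the norm.\<close>
  define \<mu>' where "\<mu>' = pi / 2 * kappa W * \<mu>"
  \<comment> \<open>Index 0 is the objective, indices 1 to \<open>T\<close> are the constraints.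
    Constraint \<open>i\<close> reads block \<open>i - 1\<close>, and \<open>Suc\<close> skips
    coordinate 0 of \<open>y\<close>, which holds the homogenising scalar.\<close>
  define \<phi> where "\<phi> i y = (if i = 0 then (K *\<^sub>v y) \<bullet> (N *\<^sub>v (K *\<^sub>v y)) - \<mu>' * ((K *\<^sub>v y) \<bullet> (W *\<^sub>v (K *\<^sub>v y)))
     else (y $ 0)\<^sup>2 - (\<Sum>j<p. d j * (y $ Suc ((i - 1) * p + j))\<^sup>2))" for i and y :: "real vec"
  have idx: "i * p + j < q" if "i < T" "j < p" for i j
    unfolding q_def using that by (rule block_index_less)
  have \<phi>_smult: "\<phi> i (a \<cdot>\<^sub>v y) = a\<^sup>2 * \<phi> i y" if y: "y \<in> carrier_vec (1 + q)" and i: "i \<le> T" for i a y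
  proof (cases "i = 0")
    case True
    then show ?thesis
      using quad_form_smult[OF N(1) Kc[OF y]] quad_form_smult[OF W(1) Kc[OF y]] mult_mat_vec[OF K y]
      by (simp add: \<phi>_def algebra_simps)
  next
    case False
    then have "(i - 1) * p + j < q" if "j < p" for j using idx[of "i - 1" j] that i by simp
    then show ?thesis using False y
      by (simp add: \<phi>_def power_mult_distrib right_diff_distrib sum_distrib_left mult.left_commute)
  qed
  define f where "f i vs = (\<Sum>y\<leftarrow>vs. \<phi> i y)" for i vs
  \<comment> \<open>A list stands for the sum of the rank-one matrices of its members, so
    \<open>f i\<close> is linear in that Gram matrix although each function is quadratic in a
    vector.\<close>
  define C where "C = {vs :: real vec list. set vs \<subseteq> carrier_vec (1 + q)}"
  have "\<exists>c. (\<forall>i\<le>T. 0 \<le> c i) \<and> (\<exists>i\<le>T. c i \<noteq> 0) \<and> (\<forall>vs\<in>C. (\<Sum>i\<le>T. c i * f i vs) \<le> 0)"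
  proof (rule concavelike_alternative)
    fix xs ys and t :: real assume xs: "xs \<in> C" and ys: "ys \<in> C" and t: "0 \<le> t" "t \<le> 1"
    \<comment> \<open>Quadratic forms scale with the square of the argument, hence the square root.
      Concatenation adds values, so the convexity condition holds with equality.\<close>
    define sc where "sc a = map (\<lambda>y :: real vec. sqrt a \<cdot>\<^sub>v y)" for a
    have f_sc: "f i (sc a vs) = a * f i vs" if "vs \<in> C" "0 \<le> a" "i \<le> T" for a vs i
    proof -
      have "map (\<lambda>y. \<phi> i (sqrt a \<cdot>\<^sub>v y)) vs = map (\<lambda>y. a * \<phi> i y) vs"
        using that by (auto simp: C_def \<phi>_smult subset_iff)
      from arg_cong[OF this, of sum_list]
      have "f i (sc a vs) = (\<Sum>y\<leftarrow>vs. a * \<phi> i y)" unfolding f_def sc_def map_map comp_def .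
      then show ?thesis by (simp add: f_def sum_list_const_mult)
    qed
    have "sc t xs @ sc (1 - t) ys \<in> C" using xs ys by (auto simp: C_def sc_def)
    moreover have "f i (sc t xs @ sc (1 - t) ys) = t * f i xs + (1 - t) * f i ys" if "i \<le> T" for i
      using f_sc[OF xs t(1) that] f_sc[OF ys _ that, of "1 - t"] t by (simp add: f_def)
    ultimately show "\<exists>zs\<in>C. \<forall>i\<le>T. t * f i xs + (1 - t) * f i ys \<le> f i zs" by force
  next
    fix vs assume "vs \<in> C"
    then have vs: "set vs \<subseteq> carrier_vec (1 + q)" by (simp add: C_def)
    show "\<exists>i\<le>T. f i vs \<le> 0"
    proof (rule ccontr)
      assume "\<not> ?thesis"
      then have pos: "0 < f i vs" if "i \<le> T" for i using that by (meson not_le)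
      obtain y where y: "y \<in> carrier_vec (1 + q)" "\<And>j. j < 1 + q \<Longrightarrow> (y $ j)\<^sup>2 = (\<Sum>v\<leftarrow>vs. (v $ j)\<^sup>2)"
        "2 / pi * (\<Sum>v\<leftarrow>vs. (K *\<^sub>v v) \<bullet> (N *\<^sub>v (K *\<^sub>v v))) \<le> (K *\<^sub>v y) \<bullet> (N *\<^sub>v (K *\<^sub>v y))"
        using gaussian_sign_rounding_linear[OF N K vs] by blast
      \<comment> \<open>In these coordinates a constraint depends only on squared coordinates, so
        the rounded vector inherits its value from the whole list without loss.\<close>
      have con: "(\<Sum>j<p. d j * (y $ Suc (i * p + j))\<^sup>2) < (y $ 0)\<^sup>2" if i: "i < T" for i
      proof -
        have "f (Suc i) vs = (\<Sum>v\<leftarrow>vs. (v $ 0)\<^sup>2) - (\<Sum>v\<leftarrow>vs. \<Sum>j<p. d j * (v $ Suc (i * p + j))\<^sup>2)"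
          by (simp add: f_def \<phi>_def sum_list_subtractf)
        also have "(\<Sum>v\<leftarrow>vs. \<Sum>j<p. d j * (v $ Suc (i * p + j))\<^sup>2) = (\<Sum>j<p. d j * (\<Sum>v\<leftarrow>vs. (v $ Suc (i * p + j))\<^sup>2))"
          by (induction vs) (simp_all add: sum.distrib distrib_left)
        also have "\<dots> = (\<Sum>j<p. d j * (y $ Suc (i * p + j))\<^sup>2)"
          using idx[OF i] by (intro sum.cong refl) (simp add: y(2))
        also have "(\<Sum>v\<leftarrow>vs. (v $ 0)\<^sup>2) = (y $ 0)\<^sup>2" by (simp add: y(2))
        finally show ?thesis using pos[of "Suc i"] i by simp
      qed
      \<comment> \<open>The first constraint, available because \<open>0 < T\<close>, is strict with
        a nonnegative left side. Hence the scalar of the rounded vector is nonzero and can be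
        normalised to 1.\<close>
      have "0 \<le> (\<Sum>j<p. d j * (y $ Suc (0 * p + j))\<^sup>2)" using d by (intro sum_nonneg) auto
      with con[OF T] have y0: "0 < (y $ 0)\<^sup>2" by linarith
      then have y0': "y $ 0 \<noteq> 0" by auto
      define z where "z = (1 / y $ 0) \<cdot>\<^sub>v y"
      have z: "z \<in> carrier_vec (1 + q)" "y = (y $ 0) \<cdot>\<^sub>v z" "z $ 0 = 1"
        using y(1) y0' by (auto simp: z_def smult_smult_assoc)
      define w where "w = V *\<^sub>v vec_last z q"
      have Kz: "K *\<^sub>v z = x0 @\<^sub>v w" unfolding Ky[OF z(1)] z(3) w_def by simp
      have "w \<in> WT p T P"
        unfolding WT_def
      proof (intro CollectI conjI allI impI)
        show "w \<in> carrier_vec (p * T)"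
          using mult_mat_vec_carrier[OF V vec_last_carrier] by (simp add: w_def q_def)
        fix i assume i: "i < T"
        have "wblk p w i \<bullet> (P *\<^sub>v wblk p w i) = (\<Sum>j<p. d j * (z $ Suc (i * p + j))\<^sup>2)"
          unfolding w_def wP[OF vec_last_carrier i] using idx[OF i] by (simp add: last[OF z(1)])
        also have "\<dots> = (\<Sum>j<p. d j * (y $ Suc (i * p + j))\<^sup>2) / (y $ 0)\<^sup>2"
          using idx[OF i] y(1) by (simp add: z_def power_divide sum_divide_distrib)
        also have "\<dots> \<le> 1" using con[OF i] y0 by simp
        finally show "wblk p w i \<bullet> (P *\<^sub>v wblk p w i) \<le> 1" .
      qed
      from feas[OF this]
      have "(K *\<^sub>v z) \<bullet> (N *\<^sub>v (K *\<^sub>v z)) \<le> \<mu> * ((K *\<^sub>v z) \<bullet> (W *\<^sub>v (K *\<^sub>v z)))" unfolding Kz .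
      then have "(y $ 0)\<^sup>2 * ((K *\<^sub>v z) \<bullet> (N *\<^sub>v (K *\<^sub>v z))) \<le> \<mu> * ((y $ 0)\<^sup>2 * ((K *\<^sub>v z) \<bullet> (W *\<^sub>v (K *\<^sub>v z))))"
        using y0 by (simp add: mult.left_commute)
      then have "(K *\<^sub>v y) \<bullet> (N *\<^sub>v (K *\<^sub>v y)) \<le> \<mu> * ((K *\<^sub>v y) \<bullet> (W *\<^sub>v (K *\<^sub>v y)))"
        unfolding quad_form_smult[OF N(1) Kc[OF z(1)], symmetric] quad_form_smult[OF W(1) Kc[OF z(1)], symmetric]
          mult_mat_vec[OF K z(1), symmetric] z(2)[symmetric] .
      \<comment> \<open>The form of \<open>W\<close> is not preserved by rounding, but the Euclidean
        norm is: through \<open>K\<close> it depends only on squared coordinates. So the form is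
        raised to the norm at \<open>y\<close>, moved to the list, and lowered back to
        \<open>W\<close> at the price of \<open>kappa W\<close>.\<close>
      also have "\<dots> \<le> \<mu> * (sigma_max W * ((K *\<^sub>v y) \<bullet> (K *\<^sub>v y)))"
        using pd_sing_vals(4)[OF W _ Kc[OF y(1)]] n \<mu> by (intro mult_left_mono) auto
      also have "(K *\<^sub>v y) \<bullet> (K *\<^sub>v y) = (\<Sum>v\<leftarrow>vs. (K *\<^sub>v v) \<bullet> (K *\<^sub>v v))"
      proof -
        have "(\<Sum>v\<leftarrow>vs. (K *\<^sub>v v) \<bullet> (K *\<^sub>v v)) = (\<Sum>v\<leftarrow>vs. (v $ 0)\<^sup>2 * (x0 \<bullet> x0) + (\<Sum>j<q. (v $ Suc j)\<^sup>2))"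
          by (intro arg_cong[of _ _ sum_list] map_cong refl Knorm) (use vs in auto)
        also have "\<dots> = (\<Sum>v\<leftarrow>vs. (v $ 0)\<^sup>2) * (x0 \<bullet> x0) + (\<Sum>j<q. \<Sum>v\<leftarrow>vs. (v $ Suc j)\<^sup>2)"
          by (induction vs) (simp_all add: sum.distrib distrib_right)
        also have "\<dots> = (K *\<^sub>v y) \<bullet> (K *\<^sub>v y)" unfolding Knorm[OF y(1)] by (simp add: y(2))
        finally show ?thesis ..
      qed
      also have "\<mu> * (sigma_max W * (\<Sum>v\<leftarrow>vs. (K *\<^sub>v v) \<bullet> (K *\<^sub>v v))) \<le>
          \<mu> * (kappa W * (\<Sum>v\<leftarrow>vs. (K *\<^sub>v v) \<bullet> (W *\<^sub>v (K *\<^sub>v v))))"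
        unfolding sum_list_const_mult[symmetric]
        using vs n \<mu> pd_kappa_bound[OF W _ Kc] by (intro mult_left_mono sum_list_mono) auto
      finally have "2 / pi * (\<Sum>v\<leftarrow>vs. (K *\<^sub>v v) \<bullet> (N *\<^sub>v (K *\<^sub>v v))) \<le>
          \<mu> * (kappa W * (\<Sum>v\<leftarrow>vs. (K *\<^sub>v v) \<bullet> (W *\<^sub>v (K *\<^sub>v v))))" using y(3) by linarith
      then have "(\<Sum>v\<leftarrow>vs. (K *\<^sub>v v) \<bullet> (N *\<^sub>v (K *\<^sub>v v))) \<le> \<mu>' * (\<Sum>v\<leftarrow>vs. (K *\<^sub>v v) \<bullet> (W *\<^sub>v (K *\<^sub>v v)))"
        by (simp add: \<mu>'_def field_simps)
      then have "f 0 vs \<le> 0" by (simp add: f_def \<phi>_def sum_list_subtractf sum_list_const_mult)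
      then show False using pos[of 0] by simp
    qed
  qed
  then obtain c where c: "\<And>i. i \<le> T \<Longrightarrow> 0 \<le> c i" "\<exists>i\<le>T. c i \<noteq> 0"
    "\<And>vs. vs \<in> C \<Longrightarrow> (\<Sum>i\<le>T. c i * f i vs) \<le> 0" by blast
  have ins: "{..T} = insert 0 {1..T}" by auto
  \<comment> \<open>Lists of length one turn the separation statement into a pointwise
    inequality.\<close>
  have c_le: "c 0 * \<phi> 0 y + (\<Sum>i\<in>{1..T}. c i * \<phi> i y) \<le> 0" if "y \<in> carrier_vec (1 + q)" for y
    using c(3)[of "[y]"] that by (simp add: C_def f_def ins)
  \<comment> \<open>The role of a Slater point: at scalar 1 and disturbance 0 each constraint
    function equals 1. With \<open>c 0 = 0\<close>, the nonnegative multipliers of the constraints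
    would sum to at most 0 and all vanish.\<close>
  have "c 0 \<noteq> 0"
  proof
    assume c0: "c 0 = 0"
    have "\<phi> i (unit_vec (1 + q) 0) = 1" if "i \<in> {1..T}" for i
    proof -
      have "i - 1 < T" using that by auto
      then have "(i - 1) * p + j < q" if "j < p" for j using idx[of "i - 1" j] that by simp
      then show ?thesis using that by (simp add: \<phi>_def)
    qed
    then have "(\<Sum>i\<in>{1..T}. c i) \<le> 0" using c_le[of "unit_vec (1 + q) 0"] c0 by simp
    then have "\<forall>i\<in>{1..T}. c i = 0"
      using c(1) by (subst sum_nonneg_eq_0_iff[symmetric]) (auto intro!: antisym sum_nonneg)
    then show False using c(2) c0 by (metis One_nat_def atLeastAtMost_iff le_zero_eq not_less_eq_eq)
  qed
  with c(1)[of 0] have c0: "0 < c 0" by simp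
  show thesis
  proof (rule that[of "\<lambda>i. c i / c 0"])
    show "0 \<le> c i / c 0" if "i \<in> {1..T}" for i using c(1)[of i] c0 that by simp
    fix t :: real and w :: "real vec" assume "w \<in> carrier_vec (p * T)"
    then have w: "w \<in> carrier_vec q" by (simp add: q_def)
    define v where "v = V' *\<^sub>v w"
    have v: "v \<in> carrier_vec q" unfolding v_def by (rule mult_mat_vec_carrier[OF V' w])
    have Vv: "V *\<^sub>v v = w" unfolding v_def by (rule VV'[OF w])
    define y where "y = vec 1 (\<lambda>_. t) @\<^sub>v v"
    have y: "y \<in> carrier_vec (1 + q)" unfolding y_def using v by (rule append_carrier_vec[rotated]) simp
    have "vec_last y q = v" using v by (auto simp: y_def vec_last_def)
    then have Ky': "K *\<^sub>v y = t \<cdot>\<^sub>v x0 @\<^sub>v w" unfolding Ky[OF y] using Vv by (simp add: y_def)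
    have \<phi>i: "\<phi> i y = t\<^sup>2 - wblk p w (i - 1) \<bullet> (P *\<^sub>v wblk p w (i - 1))" if i: "i \<in> {1..T}" for i
    proof -
      have i1: "i - 1 < T" using i by auto
      have "wblk p w (i - 1) \<bullet> (P *\<^sub>v wblk p w (i - 1)) = (\<Sum>j<p. d j * (v $ ((i - 1) * p + j))\<^sup>2)"
        using wP[OF v i1] by (simp add: Vv)
      also have "\<dots> = (\<Sum>j<p. d j * (y $ Suc ((i - 1) * p + j))\<^sup>2)"
        using idx[OF i1] v by (intro sum.cong refl) (simp add: y_def)
      finally show ?thesis using i by (simp add: \<phi>_def) (simp add: y_def)
    qed
    have "c 0 * \<phi> 0 y + (\<Sum>i\<in>{1..T}. c i * \<phi> i y) \<le> 0" by (rule c_le[OF y])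
    then have "(c 0 * \<phi> 0 y + (\<Sum>i\<in>{1..T}. c i * \<phi> i y)) / c 0 \<le> 0"
      using c0 by (simp add: divide_le_0_iff)
    then have "\<phi> 0 y + (\<Sum>i\<in>{1..T}. c i / c 0 * \<phi> i y) \<le> 0"
      using c0 by (simp add: add_divide_distrib sum_divide_distrib)
    also have "(\<Sum>i\<in>{1..T}. c i / c 0 * \<phi> i y) = (\<Sum>i\<in>{1..T}. c i / c 0) * t\<^sup>2 -
        (\<Sum>i\<in>{1..T}. c i / c 0 * (wblk p w (i - 1) \<bullet> (P *\<^sub>v wblk p w (i - 1))))"
      by (simp add: \<phi>i right_diff_distrib sum_subtractf sum_distrib_right del: atLeastAtMost_iff)
    finally show "(t \<cdot>\<^sub>v x0 @\<^sub>v w) \<bullet> (N *\<^sub>v (t \<cdot>\<^sub>v x0 @\<^sub>v w)) + (\<Sum>i\<in>{1..T}. c i / c 0) * t\<^sup>2 \<le>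
      pi / 2 * kappa W * \<mu> * ((t \<cdot>\<^sub>v x0 @\<^sub>v w) \<bullet> (W *\<^sub>v (t \<cdot>\<^sub>v x0 @\<^sub>v w))) +
      (\<Sum>i\<in>{1..T}. c i / c 0 * (wblk p w (i - 1) \<bullet> (P *\<^sub>v wblk p w (i - 1))))"
      unfolding Ky'[symmetric] \<mu>'_def[symmetric] by (simp add: \<phi>_def)
  qed
qed

section \<open>The robust synthesis problem\<close>

lemma quad_form_mat_sum:
  assumes f: "\<And>i. i \<in> I \<Longrightarrow> f i \<in> carrier_mat k k" and w: "w \<in> carrier_vec k"
  shows "w \<bullet> (mat_sum k f I *\<^sub>v w) = (\<Sum>i\<in>I. w \<bullet> (f i *\<^sub>v w))"
proof -
  have "w \<bullet> (mat_sum k f I *\<^sub>v w) = (\<Sum>r<k. \<Sum>c<k. \<Sum>i\<in>I. f i $$ (r, c) * (w $ r * w $ c))"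
    by (subst quad_form_eq_sum[OF _ w]) (auto simp: mat_sum_def sum_distrib_right)
  also have "\<dots> = (\<Sum>i\<in>I. \<Sum>r<k. \<Sum>c<k. f i $$ (r, c) * (w $ r * w $ c))"
    by (subst (2) sum.swap) (auto intro!: sum.cong sum.swap)
  also have "\<dots> = (\<Sum>i\<in>I. w \<bullet> (f i *\<^sub>v w))"
    by (intro sum.cong refl quad_form_eq_sum[symmetric] f w)
  finally show ?thesis .
qed

lemma mat_sum_symmetric:
  assumes "\<And>i. i \<in> I \<Longrightarrow> f i \<in> carrier_mat k k" "\<And>i. i \<in> I \<Longrightarrow> (f i)\<^sup>T = f i"
  shows "(mat_sum k f I)\<^sup>T = mat_sum k f I"
proof (rule eq_matI)
  fix r c assume "r < dim_row (mat_sum k f I)" "c < dim_col (mat_sum k f I)"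
  then have rc: "r < k" "c < k" by (auto simp: mat_sum_def)
  have "f i $$ (c, r) = f i $$ (r, c)" if "i \<in> I" for i
    using arg_cong[OF assms(2)[OF that], of "\<lambda>M. M $$ (r, c)"] assms(1)[OF that] rc by simp
  then show "(mat_sum k f I)\<^sup>T $$ (r, c) = mat_sum k f I $$ (r, c)"
    using rc by (simp add: mat_sum_def)
qed (auto simp: mat_sum_def)

text \<open>\<open>calP\<close> numbers the time blocks from 1 and \<open>wblk\<close> from 0, hence
  the index \<open>i - 1\<close>.\<close>

lemma calP_props:
  assumes P: "P \<in> carrier_mat p p" "P\<^sup>T = P"
  shows "calP p T P i \<in> carrier_mat (p * T) (p * T)" "(calP p T P i)\<^sup>T = calP p T P i"
    and "i \<in> {1..T} \<Longrightarrow> w \<in> carrier_vec (p * T) \<Longrightarrow>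
      w \<bullet> (calP p T P i *\<^sub>v w) = wblk p w (i - 1) \<bullet> (P *\<^sub>v wblk p w (i - 1))"
proof -
  let ?Ms = "map (\<lambda>j. if j = i then P else 0\<^sub>m p p) [1..<Suc T]"
  have Ms: "\<forall>M\<in>set ?Ms. M \<in> carrier_mat p p" using P by auto
  show c: "calP p T P i \<in> carrier_mat (p * T) (p * T)"
    using diag_block_mat_uniform[OF Ms] by (simp add: calP_def del: upt_Suc)
  have form: "w \<bullet> (calP p T P i *\<^sub>v v) =
      (\<Sum>b<T. wblk p w b \<bullet> ((if Suc b = i then P else 0\<^sub>m p p) *\<^sub>v wblk p v b))"
    if "w \<in> carrier_vec (p * T)" "v \<in> carrier_vec (p * T)" for v w
    using bilinear_form_diag_block_mat[OF Ms, of v w] that by (simp add: calP_def del: upt_Suc)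
  show "(calP p T P i)\<^sup>T = calP p T P i"
  proof (rule symmetricI_scalar_prod[OF c])
    fix v w :: "real vec" assume "v \<in> carrier_vec (p * T)" "w \<in> carrier_vec (p * T)"
    then show "w \<bullet> (calP p T P i *\<^sub>v v) = v \<bullet> (calP p T P i *\<^sub>v w)"
      unfolding form[OF \<open>w \<in> _\<close> \<open>v \<in> _\<close>] form[OF \<open>v \<in> _\<close> \<open>w \<in> _\<close>]
      using P by (intro sum.cong refl symmetric_scalar_prod[of _ p]) auto
  qed
  assume i: "i \<in> {1..T}" and w: "w \<in> carrier_vec (p * T)"
  have "wblk p w b \<bullet> (0\<^sub>m p p *\<^sub>v wblk p w b) = 0" for b
  proof -
    have "0\<^sub>m p p *\<^sub>v wblk p w b = 0\<^sub>v p" by (intro eq_vecI) auto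
    then show ?thesis by simp
  qed
  then have "w \<bullet> (calP p T P i *\<^sub>v w) =
      (\<Sum>b<T. if b = i - 1 then wblk p w b \<bullet> (P *\<^sub>v wblk p w b) else 0)"
    unfolding form[OF w w] using i by (intro sum.cong refl) auto
  also have "\<dots> = wblk p w (i - 1) \<bullet> (P *\<^sub>v wblk p w (i - 1))" using i by auto
  finally show "w \<bullet> (calP p T P i *\<^sub>v w) = wblk p w (i - 1) \<bullet> (P *\<^sub>v wblk p w (i - 1))" .
qed

section \<open>Achievable system responses and positivity of their regret\<close>

locale pwb_problem = ltv_system +
  fixes Q R :: "nat \<Rightarrow> real mat" and P Ww :: "real mat" and x0 :: "real vec"
  assumes pos: "0 < n" "0 < p" "0 < T"
    and Q: "\<And>k. k \<le> T \<Longrightarrow> Q k \<in> carrier_mat n n \<and> psd_mat (Q k)"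
    and R: "\<And>k. k \<le> T \<Longrightarrow> R k \<in> carrier_mat m m \<and> pd_mat (R k)"
    and P: "P \<in> carrier_mat p p" "pd_mat P"
    and Ww: "Ww \<in> carrier_mat (n + p * T) (n + p * T)" "pd_mat Ww"
    and x0: "x0 \<in> carrier_vec n"
begin

abbreviation "Om \<equiv> calO n m p T A B E Q R"
abbreviation "Cost \<equiv> calC T Q R"
abbreviation "r \<equiv> (n + m) * Suc T"
abbreviation "q \<equiv> p * T"

lemma calQ_props: "calQ T Q \<in> carrier_mat (n * Suc T) (n * Suc T)" "psd_mat (calQ T Q)"
proof -
  have "\<forall>M\<in>set (map Q [0..<Suc T]). M \<in> carrier_mat n n \<and> psd_mat M"
    using Q by (auto simp: less_Suc_eq_le)
  then show "calQ T Q \<in> carrier_mat (n * Suc T) (n * Suc T)" "psd_mat (calQ T Q)"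
    using diag_block_mat_uniform[of "map Q [0..<Suc T]" n n] psd_diag_block_mat[of "map Q [0..<Suc T]" n]
    by (auto simp: calQ_def simp del: upt_Suc)
qed

lemma calR_props: "calR T R \<in> carrier_mat (m * Suc T) (m * Suc T)" "pd_mat (calR T R)"
proof -
  have "\<forall>M\<in>set (map R [0..<Suc T]). M \<in> carrier_mat m m \<and> pd_mat M"
    using R by (auto simp: less_Suc_eq_le)
  then show "calR T R \<in> carrier_mat (m * Suc T) (m * Suc T)" "pd_mat (calR T R)"
    using diag_block_mat_uniform[of "map R [0..<Suc T]" m m] pd_diag_block_mat[of "map R [0..<Suc T]" m]
    by (auto simp: calR_def simp del: upt_Suc)
qed

lemma r_split: "r = n * Suc T + m * Suc T"
  by (rule distrib_right)

lemma Cost_four_block: "Cost = four_block_mat (calQ T Q) (0\<^sub>m (n * Suc T) (m * Suc T))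
    (0\<^sub>m (m * Suc T) (n * Suc T)) (calR T R)"
proof -
  have "diag_block_mat [X, Y] = four_block_mat X (0\<^sub>m (dim_row X) (dim_col Y)) (0\<^sub>m (dim_row Y) (dim_col X)) Y"
    for X Y :: "real mat"
    unfolding diag_block_mat.simps(2)[of X "[Y]"] diag_block_mat_singleton Let_def ..
  then show ?thesis unfolding calC_def
    using carrier_matD[OF calQ_props(1)] carrier_matD[OF calR_props(1)] by (simp only:)
qed

lemma Cost_bilinear:
  assumes x: "x \<in> carrier_vec (n * Suc T)" "x' \<in> carrier_vec (n * Suc T)"
    and u: "u \<in> carrier_vec (m * Suc T)" "u' \<in> carrier_vec (m * Suc T)"
  shows "(x' @\<^sub>v u') \<bullet> (Cost *\<^sub>v (x @\<^sub>v u)) = x' \<bullet> (calQ T Q *\<^sub>v x) + u' \<bullet> (calR T R *\<^sub>v u)"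
  unfolding Cost_four_block mult_mat_vec_split[OF calQ_props(1) calR_props(1) x(1) u(1)]
  by (rule scalar_prod_append[OF x(2) u(2) mult_mat_vec_carrier[OF calQ_props(1) x(1)]
        mult_mat_vec_carrier[OF calR_props(1) u(1)]])

lemma Cost_props: "Cost \<in> carrier_mat r r" "psd_mat Cost"
proof -
  show C: "Cost \<in> carrier_mat r r"
    unfolding r_split Cost_four_block by (rule four_block_carrier_mat[OF calQ_props(1) calR_props(1)])
  have R: "psd_mat (calR T R)" by (rule pd_matD(1)[OF calR_props(2,1)])
  have split: "\<exists>x u. v = x @\<^sub>v u \<and> x \<in> carrier_vec (n * Suc T) \<and> u \<in> carrier_vec (m * Suc T)"
    if "v \<in> carrier_vec r" for v :: "real vec"
    using vec_first_last_append[of v "n * Suc T" "m * Suc T"] that[unfolded r_split]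
      vec_first_carrier vec_last_carrier by metis
  show "psd_mat Cost"
  proof (rule psd_matI[OF C])
    show "Cost\<^sup>T = Cost"
    proof (rule symmetricI_scalar_prod[OF C])
      fix v w :: "real vec" assume v: "v \<in> carrier_vec r" and w: "w \<in> carrier_vec r"
      obtain x u where v': "v = x @\<^sub>v u" "x \<in> carrier_vec (n * Suc T)" "u \<in> carrier_vec (m * Suc T)"
        using split[OF v] by blast
      obtain y z where w': "w = y @\<^sub>v z" "y \<in> carrier_vec (n * Suc T)" "z \<in> carrier_vec (m * Suc T)"
        using split[OF w] by blast
      show "w \<bullet> (Cost *\<^sub>v v) = v \<bullet> (Cost *\<^sub>v w)"
        unfolding v'(1) w'(1) Cost_bilinear[OF v'(2) w'(2) v'(3) w'(3)] Cost_bilinear[OF w'(2) v'(2) w'(3) v'(3)]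
        using symmetric_scalar_prod[OF calQ_props(1) psd_matD(1)[OF calQ_props(2,1)] v'(2) w'(2)]
          symmetric_scalar_prod[OF calR_props(1) psd_matD(1)[OF R calR_props(1)] v'(3) w'(3)] by simp
    qed
    fix v :: "real vec" assume v: "v \<in> carrier_vec r"
    obtain x u where v': "v = x @\<^sub>v u" "x \<in> carrier_vec (n * Suc T)" "u \<in> carrier_vec (m * Suc T)"
      using split[OF v] by blast
    show "0 \<le> v \<bullet> (Cost *\<^sub>v v)"
      unfolding v'(1) Cost_bilinear[OF v'(2,2,3,3)]
      using psd_matD(2)[OF calQ_props(2,1) v'(2)] psd_matD(2)[OF R calR_props(1) v'(3)] by simp
  qed
qed

text \<open>The bound for arbitrary inputs becomes a bound for trajectories, because the state of a
  trajectory is determined by input and disturbance through \<open>FG\<close>.\<close>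

lemma Om_props:
  shows "Om \<in> carrier_mat (n + q) (n + q)" "Om\<^sup>T = Om"
    and "\<And>x u \<delta>. x \<in> carrier_vec (n * Suc T) \<Longrightarrow> u \<in> carrier_vec (m * Suc T) \<Longrightarrow> \<delta> \<in> carrier_vec (n + q) \<Longrightarrow>
      is_traj n T A B E x u \<delta> \<Longrightarrow> \<delta> \<bullet> (Om *\<^sub>v \<delta>) \<le> (x @\<^sub>v u) \<bullet> (Cost *\<^sub>v (x @\<^sub>v u))"
proof -
  note o = optimal_cost_matrix[OF calQ_props calR_props FG_props(1,2)]
  have Om: "Om = (snd (FG n m p T A B E))\<^sup>T * calQ T Q *
      minv (1\<^sub>m (n * Suc T) + fst (FG n m p T A B E) * minv (calR T R) * (fst (FG n m p T A B E))\<^sup>T * calQ T Q) *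
      snd (FG n m p T A B E)"
    unfolding calO_def Let_def ..
  show "Om \<in> carrier_mat (n + q) (n + q)" "Om\<^sup>T = Om" unfolding Om by (rule o)+
  fix x u \<delta> :: "real vec"
  assume x: "x \<in> carrier_vec (n * Suc T)" and u: "u \<in> carrier_vec (m * Suc T)"
    and d: "\<delta> \<in> carrier_vec (n + q)" and tr: "is_traj n T A B E x u \<delta>"
  show "\<delta> \<bullet> (Om *\<^sub>v \<delta>) \<le> (x @\<^sub>v u) \<bullet> (Cost *\<^sub>v (x @\<^sub>v u))"
    unfolding Om Cost_bilinear[OF x x u u] unfolding iffD1[OF FG_props(3)[OF x u d] tr] by (rule o(3)[OF u d])
qed

definition achievable :: "real mat \<Rightarrow> bool" where
  "achievable \<Phi> \<longleftrightarrow> \<Phi> \<in> carrier_mat r (n + q) \<and> sls_mat n T A B * \<Phi> = calE n T E"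

definition regret :: "real mat \<Rightarrow> real mat" where
  "regret \<Phi> = \<Phi>\<^sup>T * Cost * \<Phi> - Om"

text \<open>The response with zero input: the state follows the free evolution \<open>G\<close>,
  which is a trajectory for every disturbance.\<close>

lemma achievable_ex: "\<exists>\<Phi>. achievable \<Phi>"
proof -
  define G where "G = snd (FG n m p T A B E)"
  define \<Phi> where "\<Phi> = vcat G (0\<^sub>m (m * Suc T) (n + q))"
  have G: "G \<in> carrier_mat (n * Suc T) (n + q)" unfolding G_def by (rule FG_props(2))
  have Phi: "\<Phi> \<in> carrier_mat r (n + q)" unfolding \<Phi>_def r_split by (rule vcat_carrier[OF G]) simp
  have "sls_mat n T A B * \<Phi> = calE n T E"
  proof (rule mat_eq_mult_vecI[OF mult_carrier_mat[OF sls_mat_carrier Phi] calE_carrier])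
    fix d :: "real vec" assume d: "d \<in> carrier_vec (n + q)"
    have z: "0\<^sub>m (m * Suc T) (n + q) *\<^sub>v d = 0\<^sub>v (m * Suc T)" using d by (intro eq_vecI) auto
    have Gd: "G *\<^sub>v d \<in> carrier_vec (n * Suc T)" by (rule mult_mat_vec_carrier[OF G d])
    have "G *\<^sub>v d = fst (FG n m p T A B E) *\<^sub>v 0\<^sub>v (m * Suc T) + G *\<^sub>v d"
      unfolding mult_mat_zero_vec[OF FG_props(1)] using left_zero_vec[OF Gd] by simp
    then have "is_traj n T A B E (G *\<^sub>v d) (0\<^sub>v (m * Suc T)) d"
      unfolding G_def by (rule iffD2[OF FG_props(3)[OF Gd[unfolded G_def] zero_carrier_vec d]])
    then show "sls_mat n T A B * \<Phi> *\<^sub>v d = calE n T E *\<^sub>v d"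
      unfolding is_traj_def assoc_mult_mat_vec[OF sls_mat_carrier Phi d]
      unfolding \<Phi>_def vcat_mult_vec[OF G zero_carrier_mat d] z .
  qed
  then show ?thesis using Phi by (auto simp: achievable_def)
qed

lemma regret_form:
  assumes Phi: "achievable \<Phi>" and d: "\<delta> \<in> carrier_vec (n + q)"
  shows "\<delta> \<bullet> (regret \<Phi> *\<^sub>v \<delta>) = (\<Phi> *\<^sub>v \<delta>) \<bullet> (Cost *\<^sub>v (\<Phi> *\<^sub>v \<delta>)) - \<delta> \<bullet> (Om *\<^sub>v \<delta>)"
    and "regret \<Phi> \<in> carrier_mat (n + q) (n + q)" "\<Phi>\<^sup>T * Cost * \<Phi> \<in> carrier_mat (n + q) (n + q)"
proof -
  have P: "\<Phi> \<in> carrier_mat r (n + q)" using Phi by (simp add: achievable_def)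
  have PT: "\<Phi>\<^sup>T \<in> carrier_mat (n + q) r" using P by (rule transpose_carrier_mat[THEN iffD2])
  have PC: "\<Phi>\<^sup>T * Cost \<in> carrier_mat (n + q) r" by (rule mult_carrier_mat[OF PT Cost_props(1)])
  show PCP: "\<Phi>\<^sup>T * Cost * \<Phi> \<in> carrier_mat (n + q) (n + q)" by (rule mult_carrier_mat[OF PC P])
  show "regret \<Phi> \<in> carrier_mat (n + q) (n + q)"
    unfolding regret_def by (rule minus_carrier_mat[OF Om_props(1)])
  have Pd: "\<Phi> *\<^sub>v \<delta> \<in> carrier_vec r" by (rule mult_mat_vec_carrier[OF P d])
  have CPd: "Cost *\<^sub>v (\<Phi> *\<^sub>v \<delta>) \<in> carrier_vec r" by (rule mult_mat_vec_carrier[OF Cost_props(1) Pd])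
  have "\<delta> \<bullet> (regret \<Phi> *\<^sub>v \<delta>) = \<delta> \<bullet> (\<Phi>\<^sup>T * Cost * \<Phi> *\<^sub>v \<delta>) - \<delta> \<bullet> (Om *\<^sub>v \<delta>)"
    unfolding regret_def minus_mult_distrib_mat_vec[OF PCP Om_props(1) d]
    by (rule scalar_prod_minus_distrib[OF d mult_mat_vec_carrier[OF PCP d] mult_mat_vec_carrier[OF Om_props(1) d]])
  also have "\<delta> \<bullet> (\<Phi>\<^sup>T * Cost * \<Phi> *\<^sub>v \<delta>) = (\<Phi> *\<^sub>v \<delta>) \<bullet> (Cost *\<^sub>v (\<Phi> *\<^sub>v \<delta>))"
    unfolding assoc_mult_mat_vec[OF PC P d] assoc_mult_mat_vec[OF PT Cost_props(1) Pd]
    using adjoint_scalar_prod[OF PT CPd d] by simp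
  finally show "\<delta> \<bullet> (regret \<Phi> *\<^sub>v \<delta>) = (\<Phi> *\<^sub>v \<delta>) \<bullet> (Cost *\<^sub>v (\<Phi> *\<^sub>v \<delta>)) - \<delta> \<bullet> (Om *\<^sub>v \<delta>)" .
qed

text \<open>For each disturbance an achievable response yields a trajectory, so it cannot cost less
  than the best non-causal input. This positivity is what the rounding bound requires of the
  objective.\<close>

lemma regret_psd:
  assumes Phi: "achievable \<Phi>"
  shows "psd_mat (regret \<Phi>)"
proof (rule psd_matI[OF regret_form(2)[OF Phi zero_carrier_vec]])
  have P: "\<Phi> \<in> carrier_mat r (n + q)" and sls: "sls_mat n T A B * \<Phi> = calE n T E"
    using Phi by (auto simp: achievable_def)
  have PT: "\<Phi>\<^sup>T \<in> carrier_mat (n + q) r" using P by (rule transpose_carrier_mat[THEN iffD2])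
  note PCP = regret_form(3)[OF Phi zero_carrier_vec]
  have "(\<Phi>\<^sup>T * Cost * \<Phi>)\<^sup>T = \<Phi>\<^sup>T * Cost * \<Phi>"
    unfolding transpose_mult[OF mult_carrier_mat[OF PT Cost_props(1)] P]
      transpose_mult[OF PT Cost_props(1)] transpose_transpose psd_matD(1)[OF Cost_props(2,1)]
    by (rule assoc_mult_mat[symmetric, OF PT Cost_props(1) P])
  then show "(regret \<Phi>)\<^sup>T = regret \<Phi>"
    unfolding regret_def transpose_minus[OF PCP Om_props(1)] Om_props(2) by simp
  fix \<delta> :: "real vec" assume d: "\<delta> \<in> carrier_vec (n + q)"
  have Pd: "\<Phi> *\<^sub>v \<delta> \<in> carrier_vec (n * Suc T + m * Suc T)"
    using mult_mat_vec_carrier[OF P d] unfolding r_split .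
  define x u where "x = vec_first (\<Phi> *\<^sub>v \<delta>) (n * Suc T)" and "u = vec_last (\<Phi> *\<^sub>v \<delta>) (m * Suc T)"
  have xu: "\<Phi> *\<^sub>v \<delta> = x @\<^sub>v u" unfolding x_def u_def using vec_first_last_append[OF Pd] by simp
  have "is_traj n T A B E x u \<delta>"
    unfolding is_traj_def xu[symmetric] assoc_mult_mat_vec[OF sls_mat_carrier P d, symmetric] sls ..
  then have "\<delta> \<bullet> (Om *\<^sub>v \<delta>) \<le> (x @\<^sub>v u) \<bullet> (Cost *\<^sub>v (x @\<^sub>v u))"
    by (intro Om_props(3) d) (simp_all only: x_def u_def vec_first_carrier vec_last_carrier)
  then show "0 \<le> \<delta> \<bullet> (regret \<Phi> *\<^sub>v \<delta>)" unfolding regret_form(1)[OF Phi d] xu by simp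
qed

end

section \<open>The three problems as quadratic inequalities, and the comparison of their optimal
  values\<close>

context pwb_problem
begin

lemma Ww_sym: "Ww\<^sup>T = Ww"
  by (rule psd_matD(1)[OF pd_matD(1)[OF Ww(2,1)] Ww(1)])

text \<open>The square root of the cost squares back to the cost, and moving \<open>Om\<close> to
  the other side produces the regret. \<open>Lam\<close> and \<open>l\<close> stay general so that
  both semidefinite programs are instances.\<close>

lemma lmi_regret_iff:
  assumes Phi: "achievable \<Phi>" and Lam: "Lam \<in> carrier_mat q q" "Lam\<^sup>T = Lam"
  shows "psd_mat (block3
         (transpose_mat (colm x0) * (blk11 Om n + \<mu> \<cdot>\<^sub>m blk11 Ww n) * colm x0 - scal l)
         (transpose_mat (colm x0) * (transpose_mat (blk21 Om n) + \<mu> \<cdot>\<^sub>m transpose_mat (blk21 Ww n)))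
         (transpose_mat (colm x0) * transpose_mat (colsL \<Phi> n) * psd_sqrt Cost)
         ((blk21 Om n + \<mu> \<cdot>\<^sub>m blk21 Ww n) * colm x0)
         (Lam + blk22 Om n + \<mu> \<cdot>\<^sub>m blk22 Ww n)
         (transpose_mat (colsR \<Phi> n) * psd_sqrt Cost)
         (psd_sqrt Cost * colsL \<Phi> n * colm x0)
         (psd_sqrt Cost * colsR \<Phi> n)
         (1\<^sub>m r)) \<longleftrightarrow>
    (\<forall>t. \<forall>w \<in> carrier_vec q.
       (t \<cdot>\<^sub>v x0 @\<^sub>v w) \<bullet> (regret \<Phi> *\<^sub>v (t \<cdot>\<^sub>v x0 @\<^sub>v w)) + l * t\<^sup>2 \<le>
       \<mu> * ((t \<cdot>\<^sub>v x0 @\<^sub>v w) \<bullet> (Ww *\<^sub>v (t \<cdot>\<^sub>v x0 @\<^sub>v w))) + w \<bullet> (Lam *\<^sub>v w))"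
proof -
  note S = psd_sqrt_props[OF Cost_props]
  have P: "\<Phi> \<in> carrier_mat r (n + q)" using Phi by (simp add: achievable_def)
  have "(\<Phi> *\<^sub>v (t \<cdot>\<^sub>v x0 @\<^sub>v w)) \<bullet> (Cost *\<^sub>v (\<Phi> *\<^sub>v (t \<cdot>\<^sub>v x0 @\<^sub>v w))) + l * t\<^sup>2 \<le>
       (t \<cdot>\<^sub>v x0 @\<^sub>v w) \<bullet> (Om *\<^sub>v (t \<cdot>\<^sub>v x0 @\<^sub>v w)) + \<mu> * ((t \<cdot>\<^sub>v x0 @\<^sub>v w) \<bullet> (Ww *\<^sub>v (t \<cdot>\<^sub>v x0 @\<^sub>v w))) + w \<bullet> (Lam *\<^sub>v w)
    \<longleftrightarrow> (t \<cdot>\<^sub>v x0 @\<^sub>v w) \<bullet> (regret \<Phi> *\<^sub>v (t \<cdot>\<^sub>v x0 @\<^sub>v w)) + l * t\<^sup>2 \<le>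
       \<mu> * ((t \<cdot>\<^sub>v x0 @\<^sub>v w) \<bullet> (Ww *\<^sub>v (t \<cdot>\<^sub>v x0 @\<^sub>v w))) + w \<bullet> (Lam *\<^sub>v w)"
    if "w \<in> carrier_vec q" for t w
  proof -
    have d: "t \<cdot>\<^sub>v x0 @\<^sub>v w \<in> carrier_vec (n + q)" using x0 that by simp
    show ?thesis unfolding regret_form(1)[OF Phi d] by linarith
  qed
  then show ?thesis
    unfolding lmi_iff[OF Om_props(1,2) Ww(1) Ww_sym Lam S(2) psd_matD(1)[OF S(1,2)] P x0] S(3) by blast
qed

definition pwb_feasible :: "real \<Rightarrow> real mat \<Rightarrow> bool" where
  "pwb_feasible \<mu> \<Phi> \<longleftrightarrow> achievable \<Phi> \<and> (\<forall>w \<in> WT p T P.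
     (x0 @\<^sub>v w) \<bullet> (regret \<Phi> *\<^sub>v (x0 @\<^sub>v w)) \<le> \<mu> * ((x0 @\<^sub>v w) \<bullet> (Ww *\<^sub>v (x0 @\<^sub>v w))))"

definition bar_feasible :: "real \<Rightarrow> (nat \<Rightarrow> real) \<Rightarrow> real mat \<Rightarrow> bool" where
  "bar_feasible \<mu> lam \<Phi> \<longleftrightarrow> (\<forall>i \<in> {1..T}. 0 \<le> lam i) \<and> achievable \<Phi> \<and> (\<forall>t. \<forall>w \<in> carrier_vec q.
     (t \<cdot>\<^sub>v x0 @\<^sub>v w) \<bullet> (regret \<Phi> *\<^sub>v (t \<cdot>\<^sub>v x0 @\<^sub>v w)) + (\<Sum>i\<in>{1..T}. lam i) * t\<^sup>2 \<le>
     \<mu> * ((t \<cdot>\<^sub>v x0 @\<^sub>v w) \<bullet> (Ww *\<^sub>v (t \<cdot>\<^sub>v x0 @\<^sub>v w))) +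
     (\<Sum>i\<in>{1..T}. lam i * (wblk p w (i - 1) \<bullet> (P *\<^sub>v wblk p w (i - 1)))))"

definition star_feasible :: "real \<Rightarrow> real \<Rightarrow> real mat \<Rightarrow> bool" where
  "star_feasible \<mu> lam \<Phi> \<longleftrightarrow> 0 \<le> lam \<and> achievable \<Phi> \<and> (\<forall>t. \<forall>w \<in> carrier_vec q.
     (t \<cdot>\<^sub>v x0 @\<^sub>v w) \<bullet> (regret \<Phi> *\<^sub>v (t \<cdot>\<^sub>v x0 @\<^sub>v w)) + lam * (real T / sigma_min P) * t\<^sup>2 \<le>
     \<mu> * ((t \<cdot>\<^sub>v x0 @\<^sub>v w) \<bullet> (Ww *\<^sub>v (t \<cdot>\<^sub>v x0 @\<^sub>v w))) + lam * (w \<bullet> w))"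

lemma mu_PWB_eq: "mu_PWB n m p T A B E Q R P Ww x0 = Inf {\<mu>. \<exists>\<Phi>. pwb_feasible \<mu> \<Phi>}"
proof -
  have "(x0 @\<^sub>v w) \<bullet> ((\<Phi>\<^sup>T * Cost * \<Phi> - Om - \<mu> \<cdot>\<^sub>m Ww) *\<^sub>v (x0 @\<^sub>v w)) \<le> 0 \<longleftrightarrow>
      (x0 @\<^sub>v w) \<bullet> (regret \<Phi> *\<^sub>v (x0 @\<^sub>v w)) \<le> \<mu> * ((x0 @\<^sub>v w) \<bullet> (Ww *\<^sub>v (x0 @\<^sub>v w)))"
    if Phi: "achievable \<Phi>" and w: "w \<in> WT p T P" for \<Phi> w \<mu>
  proof -
    have d: "x0 @\<^sub>v w \<in> carrier_vec (n + q)" using x0 w by (simp add: WT_def)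
    have Rc: "regret \<Phi> \<in> carrier_mat (n + q) (n + q)" by (rule regret_form(2)[OF Phi d])
    have mW: "\<mu> \<cdot>\<^sub>m Ww \<in> carrier_mat (n + q) (n + q)" using Ww by simp
    have Wd: "Ww *\<^sub>v (x0 @\<^sub>v w) \<in> carrier_vec (n + q)" by (rule mult_mat_vec_carrier[OF Ww(1) d])
    have e: "(\<mu> \<cdot>\<^sub>m Ww) *\<^sub>v (x0 @\<^sub>v w) = \<mu> \<cdot>\<^sub>v (Ww *\<^sub>v (x0 @\<^sub>v w))"
      by (rule smult_mat_mult_vec) (simp only: carrier_vecD[OF d] carrier_matD(2)[OF Ww(1)])
    have "(x0 @\<^sub>v w) \<bullet> ((regret \<Phi> - \<mu> \<cdot>\<^sub>m Ww) *\<^sub>v (x0 @\<^sub>v w)) =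
        (x0 @\<^sub>v w) \<bullet> (regret \<Phi> *\<^sub>v (x0 @\<^sub>v w)) - (x0 @\<^sub>v w) \<bullet> (\<mu> \<cdot>\<^sub>v (Ww *\<^sub>v (x0 @\<^sub>v w)))"
      unfolding minus_mult_distrib_mat_vec[OF Rc mW d] e
      by (rule scalar_prod_minus_distrib[OF d mult_mat_vec_carrier[OF Rc d]]) (use Wd in simp)
    then show ?thesis unfolding regret_def using scalar_prod_smult_distrib[OF d Wd, of \<mu>] by simp
  qed
  then have "{\<mu>. \<exists>\<Phi>. \<Phi> \<in> carrier_mat r (n + q) \<and> sls_mat n T A B * \<Phi> = calE n T E \<and>
      (\<forall>w \<in> WT p T P. (x0 @\<^sub>v w) \<bullet> ((\<Phi>\<^sup>T * Cost * \<Phi> - Om - \<mu> \<cdot>\<^sub>m Ww) *\<^sub>v (x0 @\<^sub>v w)) \<le> 0)}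
    = {\<mu>. \<exists>\<Phi>. pwb_feasible \<mu> \<Phi>}"
    unfolding pwb_feasible_def achievable_def by (intro Collect_cong ex_cong1) blast
  then show ?thesis unfolding mu_PWB_def by simp
qed

lemma mu_bar_eq: "mu_bar n m p T A B E Q R P Ww x0 = Inf {\<mu>. \<exists>lam \<Phi>. bar_feasible \<mu> lam \<Phi>}"
proof -
  have Ps: "P\<^sup>T = P" by (rule psd_matD(1)[OF pd_matD(1)[OF P(2,1)] P(1)])
  note cP = calP_props[OF P(1) Ps, where T = T]
  define Lam where "Lam lam = mat_sum q (\<lambda>i. lam i \<cdot>\<^sub>m calP p T P i) {1..T}" for lam
  have Lam: "Lam lam \<in> carrier_mat q q" "(Lam lam)\<^sup>T = Lam lam" for lam
    unfolding Lam_def using cP(1,2)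
    by (auto simp: mat_sum_def[of q] transpose_smult_mat intro!: mat_sum_symmetric[unfolded mat_sum_def])
  have Lform: "w \<bullet> (Lam lam *\<^sub>v w) = (\<Sum>i\<in>{1..T}. lam i * (wblk p w (i - 1) \<bullet> (P *\<^sub>v wblk p w (i - 1))))"
    if w: "w \<in> carrier_vec q" for lam w
  proof -
    have "w \<bullet> (Lam lam *\<^sub>v w) = (\<Sum>i\<in>{1..T}. w \<bullet> ((lam i \<cdot>\<^sub>m calP p T P i) *\<^sub>v w))"
      unfolding Lam_def by (rule quad_form_mat_sum[OF _ w]) (use cP(1) in simp)
    also have "\<dots> = (\<Sum>i\<in>{1..T}. lam i * (wblk p w (i - 1) \<bullet> (P *\<^sub>v wblk p w (i - 1))))"
    proof (rule sum.cong[OF refl])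
      fix i assume i: "i \<in> {1..T}"
      have "(lam i \<cdot>\<^sub>m calP p T P i) *\<^sub>v w = lam i \<cdot>\<^sub>v (calP p T P i *\<^sub>v w)"
        by (rule smult_mat_mult_vec) (use carrier_matD(2)[OF cP(1)] w in simp)
      then show "w \<bullet> ((lam i \<cdot>\<^sub>m calP p T P i) *\<^sub>v w) = lam i * (wblk p w (i - 1) \<bullet> (P *\<^sub>v wblk p w (i - 1)))"
        using scalar_prod_smult_distrib[OF w mult_mat_vec_carrier[OF cP(1) w]] cP(3)[OF i w] by simp
    qed
    finally show ?thesis .
  qed
  \<comment> \<open>\<open>X\<close> stands for the matrix inequality. Its reformulation is
    available only for achievable responses, so it is used under the conjuncts that express
    achievability.\<close>
  have "(\<forall>i\<in>{1..T}. 0 \<le> lam i) \<and> \<Phi> \<in> carrier_mat r (n + q) \<and> sls_mat n T A B * \<Phi> = calE n T E \<and> X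
     \<longleftrightarrow> bar_feasible \<mu> lam \<Phi>"
    if "achievable \<Phi> \<Longrightarrow> X \<longleftrightarrow> (\<forall>t. \<forall>w \<in> carrier_vec q.
       (t \<cdot>\<^sub>v x0 @\<^sub>v w) \<bullet> (regret \<Phi> *\<^sub>v (t \<cdot>\<^sub>v x0 @\<^sub>v w)) + (\<Sum>i\<in>{1..T}. lam i) * t\<^sup>2 \<le>
       \<mu> * ((t \<cdot>\<^sub>v x0 @\<^sub>v w) \<bullet> (Ww *\<^sub>v (t \<cdot>\<^sub>v x0 @\<^sub>v w))) + w \<bullet> (Lam lam *\<^sub>v w))" for lam \<Phi> \<mu> X
    using that Lform unfolding bar_feasible_def achievable_def by auto
  from this[OF lmi_regret_iff[OF _ Lam]] show ?thesis
    unfolding mu_bar_def Let_def Lam_def by (simp only:)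
qed

lemma mu_star_eq: "mu_star n m p T A B E Q R P Ww x0 = Inf {\<mu>. \<exists>lam \<Phi>. star_feasible \<mu> lam \<Phi>}"
proof -
  have Lam: "lam \<cdot>\<^sub>m 1\<^sub>m q \<in> carrier_mat q q" "(lam \<cdot>\<^sub>m 1\<^sub>m q)\<^sup>T = lam \<cdot>\<^sub>m 1\<^sub>m q" for lam :: real
    by (auto simp: transpose_smult_mat)
  have Lform: "w \<bullet> ((lam \<cdot>\<^sub>m 1\<^sub>m q) *\<^sub>v w) = lam * (w \<bullet> w)" if "w \<in> carrier_vec q" for lam :: real and w
    using that by (simp add: smult_mat_mult_vec)
  have "0 \<le> lam \<and> \<Phi> \<in> carrier_mat r (n + q) \<and> sls_mat n T A B * \<Phi> = calE n T E \<and> X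
     \<longleftrightarrow> star_feasible \<mu> lam \<Phi>"
    if "achievable \<Phi> \<Longrightarrow> X \<longleftrightarrow> (\<forall>t. \<forall>w \<in> carrier_vec q.
       (t \<cdot>\<^sub>v x0 @\<^sub>v w) \<bullet> (regret \<Phi> *\<^sub>v (t \<cdot>\<^sub>v x0 @\<^sub>v w)) + lam * (real T / sigma_min P) * t\<^sup>2 \<le>
       \<mu> * ((t \<cdot>\<^sub>v x0 @\<^sub>v w) \<bullet> (Ww *\<^sub>v (t \<cdot>\<^sub>v x0 @\<^sub>v w))) + w \<bullet> ((lam \<cdot>\<^sub>m 1\<^sub>m q) *\<^sub>v w))" for lam \<Phi> \<mu> X
    using that Lform unfolding star_feasible_def achievable_def by auto
  from this[OF lmi_regret_iff[OF _ Lam]] show ?thesis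
    unfolding mu_star_def Let_def by (simp only:)
qed

text \<open>With equal multipliers \<open>lam / sigma_min P\<close> the coefficient of
  \<open>t\<^sup>2\<close> is unchanged, which explains the constant
  \<open>real T / sigma_min P\<close>. On the disturbance side, \<open>sigma_min P\<close> times the
  norm of each block is at most its \<open>P\<close>-form.\<close>

lemma star_feasible_imp_bar_feasible:
  assumes "star_feasible \<mu> lam \<Phi>"
  shows "bar_feasible \<mu> (\<lambda>_. lam / sigma_min P) \<Phi>"
proof -
  note s = pd_sing_vals[OF P pos(2)]
  have lam: "0 \<le> lam" using assms by (simp add: star_feasible_def)
  have "lam * (w \<bullet> w) \<le> (\<Sum>i\<in>{1..T}. lam / sigma_min P * (wblk p w (i - 1) \<bullet> (P *\<^sub>v wblk p w (i - 1))))"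
    if w: "w \<in> carrier_vec q" for w
  proof -
    have "lam * (w \<bullet> w) = (\<Sum>i\<in>{1..T}. lam / sigma_min P * (sigma_min P * (wblk p w (i - 1) \<bullet> wblk p w (i - 1))))"
    proof -
      have "w \<bullet> w = (\<Sum>i\<in>{1..T}. wblk p w (i - 1) \<bullet> wblk p w (i - 1))"
        unfolding scalar_prod_wblk[OF w w]
        by (rule sum.reindex_bij_witness[of _ "\<lambda>i. i - 1" Suc]) auto
      then show ?thesis using s(1) by (simp add: sum_distrib_left)
    qed
    also have "\<dots> \<le> (\<Sum>i\<in>{1..T}. lam / sigma_min P * (wblk p w (i - 1) \<bullet> (P *\<^sub>v wblk p w (i - 1))))"
      using s(1) lam by (intro sum_mono mult_left_mono s(3)) auto
    finally show ?thesis .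
  qed
  moreover have "(\<Sum>i\<in>{1..T}. lam / sigma_min P) = lam * (real T / sigma_min P)" by simp
  ultimately show ?thesis
    using assms s(1) unfolding star_feasible_def bar_feasible_def
    by (smt (verit) divide_nonneg_pos)
qed

text \<open>Weak duality at \<open>t = 1\<close>: on admissible disturbances each multiplier times
  its \<open>P\<close>-form is at most the multiplier, so these terms cancel against the sum on the
  left.\<close>

lemma bar_feasible_imp_pwb_feasible:
  assumes "bar_feasible \<mu> lam \<Phi>"
  shows "pwb_feasible \<mu> \<Phi>"
  unfolding pwb_feasible_def
proof (intro conjI ballI)
  show "achievable \<Phi>" using assms by (simp add: bar_feasible_def)
  fix w assume w: "w \<in> WT p T P"
  then have wc: "w \<in> carrier_vec q" by (simp add: WT_def)
  have le1: "lam i * (wblk p w (i - 1) \<bullet> (P *\<^sub>v wblk p w (i - 1))) \<le> lam i" if "i \<in> {1..T}" for i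
  proof -
    have "i - 1 < T" using that by auto
    then have "wblk p w (i - 1) \<bullet> (P *\<^sub>v wblk p w (i - 1)) \<le> 1" using w by (simp add: WT_def)
    moreover have "0 \<le> lam i" using assms that by (simp add: bar_feasible_def)
    ultimately show ?thesis using mult_left_mono[of _ 1 "lam i"] by simp
  qed
  have "(x0 @\<^sub>v w) \<bullet> (regret \<Phi> *\<^sub>v (x0 @\<^sub>v w)) + (\<Sum>i\<in>{1..T}. lam i) \<le>
     \<mu> * ((x0 @\<^sub>v w) \<bullet> (Ww *\<^sub>v (x0 @\<^sub>v w))) +
     (\<Sum>i\<in>{1..T}. lam i * (wblk p w (i - 1) \<bullet> (P *\<^sub>v wblk p w (i - 1))))"
  proof -
    have "\<forall>t. \<forall>w \<in> carrier_vec q.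
     (t \<cdot>\<^sub>v x0 @\<^sub>v w) \<bullet> (regret \<Phi> *\<^sub>v (t \<cdot>\<^sub>v x0 @\<^sub>v w)) + (\<Sum>i\<in>{1..T}. lam i) * t\<^sup>2 \<le>
     \<mu> * ((t \<cdot>\<^sub>v x0 @\<^sub>v w) \<bullet> (Ww *\<^sub>v (t \<cdot>\<^sub>v x0 @\<^sub>v w))) +
     (\<Sum>i\<in>{1..T}. lam i * (wblk p w (i - 1) \<bullet> (P *\<^sub>v wblk p w (i - 1))))"
      using assms unfolding bar_feasible_def by blast
    from this[rule_format, OF wc, of 1] show ?thesis by simp
  qed
  also have "(\<Sum>i\<in>{1..T}. lam i * (wblk p w (i - 1) \<bullet> (P *\<^sub>v wblk p w (i - 1)))) \<le> (\<Sum>i\<in>{1..T}. lam i)"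
    by (rule sum_mono[OF le1])
  finally show "(x0 @\<^sub>v w) \<bullet> (regret \<Phi> *\<^sub>v (x0 @\<^sub>v w)) \<le> \<mu> * ((x0 @\<^sub>v w) \<bullet> (Ww *\<^sub>v (x0 @\<^sub>v w)))"
    by simp
qed

text \<open>With multiplier 0 a large enough level works, since a positive definite
  \<open>Ww\<close> dominates any form up to a factor. The feasible set of the most restrictive
  problem is thus nonempty, and so are the other two.\<close>

lemma star_feasible_ex: "\<exists>\<mu> \<Phi>. star_feasible \<mu> 0 \<Phi>"
proof -
  obtain \<Phi> where Phi: "achievable \<Phi>" using achievable_ex by blast
  note Rc = regret_form(2)[OF Phi zero_carrier_vec]
  obtain U d where U: "U \<in> carrier_mat (n + q) (n + q)" "U\<^sup>T * U = 1\<^sub>m (n + q)" "U * U\<^sup>T = 1\<^sub>m (n + q)"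
    "regret \<Phi> = U * mat_diag (n + q) d * U\<^sup>T"
    using real_spectral_theorem[OF Rc psd_matD(1)[OF regret_psd[OF Phi] Rc]] by blast
  note s = pd_sing_vals[OF Ww, simplified, OF disjI1[OF pos(1)]]
  \<comment> \<open>A crude bound for every eigenvalue of the regret matrix, nonnegative by
    construction.\<close>
  define D where "D = (\<Sum>j<n + q. \<bar>d j\<bar>)"
  have "x \<bullet> (regret \<Phi> *\<^sub>v x) \<le> D / sigma_min Ww * (x \<bullet> (Ww *\<^sub>v x))" if x: "x \<in> carrier_vec (n + q)" for x
  proof -
    have "x \<bullet> (regret \<Phi> *\<^sub>v x) \<le> D * (x \<bullet> x)"
      unfolding spectral_quad_form[OF U x] spectral_norm[OF U x] sum_distrib_left
    proof (intro sum_mono mult_right_mono)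
      fix j assume "j \<in> {..<n + q}"
      then have "\<bar>d j\<bar> \<le> D" unfolding D_def by (intro member_le_sum) auto
      then show "d j \<le> D" by linarith
    qed simp
    also have "\<dots> = D / sigma_min Ww * (sigma_min Ww * (x \<bullet> x))" using s(1) by simp
    also have "\<dots> \<le> D / sigma_min Ww * (x \<bullet> (Ww *\<^sub>v x))"
      using s(1) s(3)[OF x] by (intro mult_left_mono) (auto simp: D_def sum_nonneg)
    finally show ?thesis .
  qed
  then have "star_feasible (D / sigma_min Ww) 0 \<Phi>"
    using Phi x0 by (auto simp: star_feasible_def)
  then show ?thesis by blast
qed

text \<open>Supplies an admissible disturbance for which the stacked vector is nonzero even if
  \<open>x0 = 0\<close>.\<close>

lemma WT_nonzero_ex:
  obtains w where "w \<in> WT p T P" "w \<noteq> 0\<^sub>v q"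
proof -
  define e where "e = (unit_vec q 0 :: real vec)"
  have q0: "0 < q" using pos by simp
  have e: "e \<in> carrier_vec q" by (simp add: e_def)
  define a where "a = (\<Sum>k<T. wblk p e k \<bullet> (P *\<^sub>v wblk p e k))"
  have nn: "0 \<le> wblk p e k \<bullet> (P *\<^sub>v wblk p e k)" for k
    by (rule psd_matD(2)[OF pd_matD(1)[OF P(2,1)] P(1)]) simp
  \<comment> \<open>Each block value is at most the sum \<open>a\<close>, so after scaling it is at
    most \<open>a / (1 + a)\<close>; the added 1 keeps the denominator positive.\<close>
  define s where "s = 1 / sqrt (1 + a)"
  have a0: "0 \<le> a" unfolding a_def by (intro sum_nonneg nn)
  have s: "s\<^sup>2 = 1 / (1 + a)" "s \<noteq> 0" using a0 by (auto simp: s_def power_divide)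
  have blk: "wblk p (s \<cdot>\<^sub>v e) k = s \<cdot>\<^sub>v wblk p e k" if "k < T" for k
    using e by (intro eq_vecI) (auto simp: block_index_less[OF that])
  show thesis
  proof (rule that[of "s \<cdot>\<^sub>v e"])
    show "s \<cdot>\<^sub>v e \<in> WT p T P"
      unfolding WT_def
    proof (intro CollectI conjI allI impI)
      show "s \<cdot>\<^sub>v e \<in> carrier_vec q" using e by simp
      fix k assume k: "k < T"
      have "wblk p e k \<bullet> (P *\<^sub>v wblk p e k) \<le> a"
        unfolding a_def using k nn by (intro member_le_sum) auto
      then show "wblk p (s \<cdot>\<^sub>v e) k \<bullet> (P *\<^sub>v wblk p (s \<cdot>\<^sub>v e) k) \<le> 1"
        unfolding blk[OF k] quad_form_smult[OF P(1) wblk_carrier(1)] s(1) using a0 by simp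
    qed
    show "s \<cdot>\<^sub>v e \<noteq> 0\<^sub>v q"
    proof
      assume "s \<cdot>\<^sub>v e = 0\<^sub>v q"
      then have "(s \<cdot>\<^sub>v e) $ 0 = 0" using index_zero_vec(1)[OF q0] by metis
      moreover have "(s \<cdot>\<^sub>v e) $ 0 = s" using index_unit_vec(1)[OF q0 q0] q0 by (simp add: e_def)
      ultimately show False using s(2) by simp
    qed
  qed
qed

text \<open>A nonnegative regret is bounded by \<open>\<mu>\<close> times a positive number. This
  bounds all three feasible sets from below and provides the sign condition of the approximate
  S-procedure.\<close>

lemma pwb_feasible_nonneg:
  assumes "pwb_feasible \<mu> \<Phi>"
  shows "0 \<le> \<mu>"
proof -
  obtain w where w: "w \<in> WT p T P" "w \<noteq> 0\<^sub>v q" by (rule WT_nonzero_ex)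
  have wc: "w \<in> carrier_vec q" using w by (simp add: WT_def)
  have d: "x0 @\<^sub>v w \<in> carrier_vec (n + q)" using x0 wc by simp
  have "x0 @\<^sub>v w \<noteq> 0\<^sub>v (n + q)"
  proof
    assume "x0 @\<^sub>v w = 0\<^sub>v (n + q)"
    also have "0\<^sub>v (n + q) = 0\<^sub>v n @\<^sub>v 0\<^sub>v q" by (intro eq_vecI) auto
    finally show False using append_vec_eq[OF x0 zero_carrier_vec] w(2) by simp
  qed
  then have "0 < (x0 @\<^sub>v w) \<bullet> (Ww *\<^sub>v (x0 @\<^sub>v w))" by (rule pd_matD(2)[OF Ww(2,1) d])
  moreover have Phi: "achievable \<Phi>" using assms by (simp add: pwb_feasible_def)
  have "0 \<le> (x0 @\<^sub>v w) \<bullet> (regret \<Phi> *\<^sub>v (x0 @\<^sub>v w))"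
    by (rule psd_matD(2)[OF regret_psd[OF Phi] regret_form(2)[OF Phi d] d])
  then have "0 \<le> \<mu> * ((x0 @\<^sub>v w) \<bullet> (Ww *\<^sub>v (x0 @\<^sub>v w)))"
    using assms w(1) unfolding pwb_feasible_def by force
  ultimately show ?thesis by (simp add: zero_le_mult_iff)
qed

lemma pwb_feasible_imp_bar_feasible:
  assumes "pwb_feasible \<mu> \<Phi>"
  shows "\<exists>lam. bar_feasible (pi / 2 * kappa Ww * \<mu>) lam \<Phi>"
proof -
  have Phi: "achievable \<Phi>" using assms by (simp add: pwb_feasible_def)
  have f: "(x0 @\<^sub>v w) \<bullet> (regret \<Phi> *\<^sub>v (x0 @\<^sub>v w)) \<le> \<mu> * ((x0 @\<^sub>v w) \<bullet> (Ww *\<^sub>v (x0 @\<^sub>v w)))"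
    if "w \<in> WT p T P" for w using assms that by (simp add: pwb_feasible_def)
  obtain lam where "\<And>i. i \<in> {1..T} \<Longrightarrow> 0 \<le> lam i"
    "\<And>t w. w \<in> carrier_vec q \<Longrightarrow>
      (t \<cdot>\<^sub>v x0 @\<^sub>v w) \<bullet> (regret \<Phi> *\<^sub>v (t \<cdot>\<^sub>v x0 @\<^sub>v w)) + (\<Sum>i\<in>{1..T}. lam i) * t\<^sup>2 \<le>
      pi / 2 * kappa Ww * \<mu> * ((t \<cdot>\<^sub>v x0 @\<^sub>v w) \<bullet> (Ww *\<^sub>v (t \<cdot>\<^sub>v x0 @\<^sub>v w))) +
      (\<Sum>i\<in>{1..T}. lam i * (wblk p w (i - 1) \<bullet> (P *\<^sub>v wblk p w (i - 1))))"
    using pi_half_s_procedure[OF regret_form(2)[OF Phi zero_carrier_vec] regret_psd[OF Phi] Ww P(1)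
      pd_matD(1)[OF P(2,1)] x0 pos(1,3) pwb_feasible_nonneg[OF assms] f] by blast
  then show ?thesis using Phi unfolding bar_feasible_def by blast
qed

text \<open>The feasible levels are nested, \<open>?S \<subseteq> ?B \<subseteq> ?W\<close>, which
  orders the infima; multiplication by \<open>pi / 2 * kappa Ww\<close> maps \<open>?W\<close> back
  into \<open>?B\<close>. Nonemptiness and the lower bound 0 are required because \<open>Inf\<close>
  on the reals is informative only for such sets.\<close>

lemma regret_bounds:
  "2 / (pi * kappa Ww) * mu_bar n m p T A B E Q R P Ww x0 \<le> mu_PWB n m p T A B E Q R P Ww x0"
  "mu_PWB n m p T A B E Q R P Ww x0 \<le> mu_bar n m p T A B E Q R P Ww x0"
  "mu_bar n m p T A B E Q R P Ww x0 \<le> mu_star n m p T A B E Q R P Ww x0"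
proof -
  let ?W = "{\<mu>. \<exists>\<Phi>. pwb_feasible \<mu> \<Phi>}" and ?B = "{\<mu>. \<exists>lam \<Phi>. bar_feasible \<mu> lam \<Phi>}"
    and ?S = "{\<mu>. \<exists>lam \<Phi>. star_feasible \<mu> lam \<Phi>}"
  have SB: "?S \<subseteq> ?B" using star_feasible_imp_bar_feasible by blast
  have BW: "?B \<subseteq> ?W" using bar_feasible_imp_pwb_feasible by blast
  have S: "?S \<noteq> {}" using star_feasible_ex by blast
  have bW: "bdd_below ?W" using pwb_feasible_nonneg by (intro bdd_belowI[of _ 0]) auto
  have bB: "bdd_below ?B" by (rule bdd_below_mono[OF bW BW])
  show "mu_PWB n m p T A B E Q R P Ww x0 \<le> mu_bar n m p T A B E Q R P Ww x0"
    unfolding mu_PWB_eq mu_bar_eq using S SB by (intro cInf_superset_mono bW BW) blast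
  show "mu_bar n m p T A B E Q R P Ww x0 \<le> mu_star n m p T A B E Q R P Ww x0"
    unfolding mu_bar_eq mu_star_eq by (intro cInf_superset_mono S bB SB)
  have k: "0 < kappa Ww"
    using pd_sing_vals(1,2)[OF Ww] pos by (simp add: kappa_def)
  show "2 / (pi * kappa Ww) * mu_bar n m p T A B E Q R P Ww x0 \<le> mu_PWB n m p T A B E Q R P Ww x0"
    unfolding mu_PWB_eq mu_bar_eq
  proof (rule cInf_greatest)
    show "?W \<noteq> {}" using S SB BW by blast
    fix \<mu> assume "\<mu> \<in> ?W"
    then have "pi / 2 * kappa Ww * \<mu> \<in> ?B" using pwb_feasible_imp_bar_feasible by blast
    then have "Inf ?B \<le> pi / 2 * kappa Ww * \<mu>" by (rule cInf_lower[OF _ bB])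
    then show "2 / (pi * kappa Ww) * Inf ?B \<le> \<mu>" using k by (simp add: field_simps)
  qed
qed

end

theorem theorem2:
  fixes n m p T :: nat
    and A B E Q R :: "nat \<Rightarrow> real mat"
    and P Ww :: "real mat"
    and x0 :: "real vec"
  assumes "0 < n" "0 < m" "0 < p" "0 < T"
    and "\<forall>k \<le> T. A k \<in> carrier_mat n n \<and> B k \<in> carrier_mat n m"
    and "\<forall>k < T. E k \<in> carrier_mat n p \<and> vec_space.rank n (E k) = n"
    and "\<forall>k \<le> T. Q k \<in> carrier_mat n n \<and> psd_mat (Q k)"
    and "\<forall>k \<le> T. R k \<in> carrier_mat m m \<and> pd_mat (R k)"
    and "P \<in> carrier_mat p p" "pd_mat P"
    and "Ww \<in> carrier_mat (n + p * T) (n + p * T)" "pd_mat Ww"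
    and "x0 \<in> carrier_vec n"
  shows "2 / (pi * kappa Ww) * mu_bar n m p T A B E Q R P Ww x0
           \<le> mu_PWB n m p T A B E Q R P Ww x0
       \<and> mu_PWB n m p T A B E Q R P Ww x0 \<le> mu_bar n m p T A B E Q R P Ww x0
       \<and> mu_bar n m p T A B E Q R P Ww x0 \<le> mu_star n m p T A B E Q R P Ww x0"
proof -
  interpret pwb_problem n m p T A B E Q R P Ww x0
    by unfold_locales (use assms in auto)
  show ?thesis using regret_bounds by blast
qed

end
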